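(* Let $N\geq 1$ and $0<\alpha<N$. Then, for any $m>0$, the equation $$-\Delta u+\omega u+|x|^{2}u+(I_{\alpha}\ast|u|^{2})u=0 \quad\text{in } \mathbb{R}^N$$ possesses a normalized ground state for the prescribed mass constraint $\mathcal{M}(u)=m$; that is, there is a positive minimizer $Q$ of $d(m)=\inf\{\mathcal{E}(u) : u\in H(\mathbb{R}^N),\ \mathcal{M}(u)=m\}$, and $Q$ solves this equation with some Lagrange multiplier $\omega\in\mathbb{R}$. Moreover, the Lagrange multiplier satisfies $\omega<0$.
   Context: Functions on $\mathbb{R}^N$ are complex-valued. The Riesz potential $I_\alpha:\mathbb{R}^N\setminus\{0\}\to\mathbb{R}$ is $I_{\alpha}(x)=\dfrac{\Gamma(\frac{N-\alpha}{2})}{\Gamma(\frac{\alpha}{2})\pi^{N/2}2^{\alpha}|x|^{N-\alpha}}$, where $\Gamma$ is the Gamma function, and $*$ denotes convolution on $\mathbb{R}^N$. The energy space is $H(\mathbb{R}^{N})=\{u\in H^{1}(\mathbb{R}^{N}) : \int_{\mathbb{R}^{N}}|x|^{2}|u|^{2}dx<\infty\}$. The mass and energy are $\mathcal{M}(u)=\int_{\mathbb{R}^{N}}|u|^{2}dx$ and $\mathcal{E}(u)=\frac{1}{2}\int_{\mathbb{R}^{N}}\big(|\nabla u|^{2}+|x|^{2}|u|^{2}+\frac{1}{2}(I_{\alpha}\ast|u|^{2})|u|^{2}\big)dx$. A normalized ground state of mass $m$ is a positive minimizer of the variational problem $d(m)$; the displayed equation is the Euler-Lagrange equation of that problem, with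 $\omega$ the Lagrange multiplier of the mass constraint. *)

theory Defs
  imports "HOL-Analysis.Analysis"
begin

text \<open>Throughout, \<open>\<real>\<^sup>N\<close> is an arbitrary type \<open>'a\<close> of class \<^class>\<open>euclidean_space\<close> with
  \<open>N = DIM('a)\<close>, which is automatically at least 1. Elements of the function spaces are
  represented by Lebesgue measurable functions; classes modulo null sets are not formed.\<close>

subsection \<open>Test functions and weak derivatives\<close>

definition partial :: "'a::euclidean_space \<Rightarrow> ('a \<Rightarrow> real) \<Rightarrow> 'a \<Rightarrow> real" where
  "partial b f x = frechet_derivative f (at x) b"

definition smooth :: "('a::euclidean_space \<Rightarrow> real) \<Rightarrow> bool" where
  "smooth f \<longleftrightarrow> (\<forall>bs \<in> lists Basis. \<forall>x. foldr partial bs f differentiable (at x))"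

definition test_functions :: "('a::euclidean_space \<Rightarrow> real) set" where
  "test_functions = {\<phi>. smooth \<phi> \<and> compact (closure {x. \<phi> x \<noteq> 0})}"

definition locally_integrable :: "('a::euclidean_space \<Rightarrow> complex) \<Rightarrow> bool" where
  "locally_integrable u \<longleftrightarrow> (\<forall>K. compact K \<longrightarrow> set_integrable lebesgue K u)"

definition has_weak_partial ::
    "('a::euclidean_space \<Rightarrow> complex) \<Rightarrow> 'a \<Rightarrow> ('a \<Rightarrow> complex) \<Rightarrow> bool" where
  "has_weak_partial u b g \<longleftrightarrow>
     locally_integrable u \<and> locally_integrable g \<and>
     (\<forall>\<phi> \<in> test_functions.
        (LINT x|lebesgue. partial b \<phi> x *\<^sub>R u x) = - (LINT x|lebesgue. \<phi> x *\<^sub>R g x))"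

text \<open>A weak derivative is only unique up to null sets. The choice made here is harmless
  because it is only used under integrals.\<close>

definition weak_partial ::
    "'a::euclidean_space \<Rightarrow> ('a \<Rightarrow> complex) \<Rightarrow> 'a \<Rightarrow> complex" where
  "weak_partial b u = (SOME g. has_weak_partial u b g)"

subsection \<open>The energy space\<close>

definition L2 :: "('a::euclidean_space \<Rightarrow> complex) set" where
  "L2 = {u \<in> borel_measurable lebesgue. integrable lebesgue (\<lambda>x. (norm (u x))\<^sup>2)}"

definition H1 :: "('a::euclidean_space \<Rightarrow> complex) set" where
  "H1 = {u \<in> L2. \<forall>b \<in> Basis. \<exists>g \<in> L2. has_weak_partial u b g}"

definition energy_space :: "('a::euclidean_space \<Rightarrow> complex) set" where
  "energy_space = {u \<in> H1. integrable lebesgue (\<lambda>x. (norm x)\<^sup>2 * (norm (u x))\<^sup>2)}"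

subsection \<open>Mass, energy and the minimization problem\<close>

text \<open>At the origin the following has the value 0 (division by zero); this concerns a null set
  only.\<close>

definition riesz_potential :: "real \<Rightarrow> 'a::euclidean_space \<Rightarrow> real" where
  "riesz_potential \<alpha> x =
     Gamma ((real DIM('a) - \<alpha>) / 2) /
     (Gamma (\<alpha> / 2) * pi powr (real DIM('a) / 2) * 2 powr \<alpha> * norm x powr (real DIM('a) - \<alpha>))"

text \<open>The convolution of \<open>I\<^sub>\<alpha>\<close> with a nonnegative function, with values in \<open>[0, \<infinity>]\<close>.\<close>

definition riesz_conv :: "real \<Rightarrow> ('a::euclidean_space \<Rightarrow> real) \<Rightarrow> 'a \<Rightarrow> ennreal" where
  "riesz_conv \<alpha> f x = (\<integral>\<^sup>+ y. ennreal (riesz_potential \<alpha> (x - y) * f y) \<partial>lebesgue)"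

definition mass :: "('a::euclidean_space \<Rightarrow> complex) \<Rightarrow> real" where
  "mass u = (LINT x|lebesgue. (norm (u x))\<^sup>2)"

text \<open>The energy takes values in \<open>[0, \<infinity>]\<close>: for \<open>\<alpha> < N - 4\<close> the nonlocal term is infinite for some
  elements of the energy space, and a Bochner integral would assign the value 0 to it.\<close>

definition energy :: "real \<Rightarrow> ('a::euclidean_space \<Rightarrow> complex) \<Rightarrow> ennreal" where
  "energy \<alpha> u =
     (\<integral>\<^sup>+ x. (ennreal ((\<Sum>b\<in>Basis. (norm (weak_partial b u x))\<^sup>2) + (norm x)\<^sup>2 * (norm (u x))\<^sup>2)
              + riesz_conv \<alpha> (\<lambda>y. (norm (u y))\<^sup>2) x * ennreal ((norm (u x))\<^sup>2) / 2) \<partial>lebesgue) / 2"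

definition min_energy :: "'a::euclidean_space itself \<Rightarrow> real \<Rightarrow> real \<Rightarrow> ennreal" where
  "min_energy _ \<alpha> m = (INF u \<in> {u :: 'a \<Rightarrow> complex. u \<in> energy_space \<and> mass u = m}. energy \<alpha> u)"

text \<open>The finiteness requirement excludes the degenerate situation in which every competitor has
  infinite energy.\<close>

definition is_minimizer :: "real \<Rightarrow> real \<Rightarrow> ('a::euclidean_space \<Rightarrow> complex) \<Rightarrow> bool" where
  "is_minimizer \<alpha> m u \<longleftrightarrow>
     u \<in> energy_space \<and> mass u = m \<and> energy \<alpha> u < \<infinity> \<and> energy \<alpha> u = min_energy TYPE('a) \<alpha> m"

text \<open>Positivity of the chosen representative at every point; up to the choice of the
  representative this is positivity almost everywhere.\<close>

definition positive_fun :: "('a::euclidean_space \<Rightarrow> complex) \<Rightarrow> bool" where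
  "positive_fun u \<longleftrightarrow> (\<forall>x. u x \<in> \<real> \<and> Re (u x) > 0)"

definition normalized_ground_state ::
    "real \<Rightarrow> real \<Rightarrow> ('a::euclidean_space \<Rightarrow> complex) \<Rightarrow> bool" where
  "normalized_ground_state \<alpha> m u \<longleftrightarrow> positive_fun u \<and> is_minimizer \<alpha> m u"

subsection \<open>The equation\<close>

text \<open>Solutions are understood in the weak sense. The equation is complex linear in the test function,
  so real test functions suffice. For \<open>u\<close> in the energy space all terms except the nonlocal
  one are integrable automatically.\<close>

definition solves_equation ::
    "real \<Rightarrow> real \<Rightarrow> ('a::euclidean_space \<Rightarrow> complex) \<Rightarrow> bool" where
  "solves_equation \<alpha> \<omega> u \<longleftrightarrow>
     u \<in> energy_space \<and>
     (AE x in lebesgue. riesz_conv \<alpha> (\<lambda>y. (norm (u y))\<^sup>2) x < \<infinity>) \<and>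
     locally_integrable (\<lambda>x. enn2real (riesz_conv \<alpha> (\<lambda>y. (norm (u y))\<^sup>2) x) *\<^sub>R u x) \<and>
     (\<forall>\<phi> \<in> test_functions.
        (LINT x|lebesgue.
           (\<Sum>b\<in>Basis. partial b \<phi> x *\<^sub>R weak_partial b u x)
           + \<phi> x *\<^sub>R (\<omega> *\<^sub>R u x + (norm x)\<^sup>2 *\<^sub>R u x
                     + enn2real (riesz_conv \<alpha> (\<lambda>y. (norm (u y))\<^sup>2) x) *\<^sub>R u x)) = 0)"

end

theory Submission
  imports Defs
begin

text \<open>Difference quotients carry the whole argument. A function of \<open>L\<^sup>2\<close> has a weak derivative in \<open>L\<^sup>2\<close>
  iff its difference quotients are bounded there, and the energy of a nonnegative function is, up to
  a factor, the supremum of the difference-quotient energies plus the harmonic and nonlocal terms.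
  In this form the energy is visibly convex in the density \<open>f\<^sup>2\<close>: the gradient term by the reverse
  triangle inequality, the nonlocal term because the Riesz kernel is a superposition of Gaussians.

  Existence: the sublevel sets \<open>E \<le> d + 1/n\<close> are convex in the density, so near-minimizers in
  them of the strictly convex functional \<open>\<integral> exp (- f\<^sup>2 - |x|\<^sup>2)\<close> form a Cauchy sequence and converge almost
  everywhere. Fatou's lemma gives lower semicontinuity; no mass is lost at infinity because of the
  harmonic term, and none concentrates because translation differences are controlled.

  Positivity: comparison with \<open>sqrt ((1 - t) f\<^sup>2 + t \<phi>\<^sup>2)\<close> bounds the translation differences of
  \<open>ln (f / \<phi> + sqrt t)\<close> uniformly in \<open>t\<close>. Hence the zero set of \<open>f\<close> is invariant under translations up to
  null sets, and is therefore null.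

  Equation: rescaling \<open>f + t \<phi>\<close> to mass \<open>m\<close> gives a polynomial inequality in \<open>t\<close> whose first-order
  term is the weak equation with \<open>\<omega> = - (A + B) / m\<close>, where \<open>A\<close> and \<open>B\<close> are the quadratic and the
  quartic part of the energy of \<open>f\<close>.\<close>

subsection \<open>Smooth functions and test functions\<close>

text \<open>Mass and harmonic term are linear in the density, so the mass constraint is convex as
  well and midpoints of densities can stand in for weak limits. The integrand
  \<open>exp (- f^2 - |x|^2)\<close> is chosen because its value at a midpoint density is the
  geometric mean of the two values: the convexity deficit is then half a squared L2 distance, and
  the integrand is bounded by a fixed Gaussian whatever \<open>f\<close> is. Two obstacles shape the
  rest. The nonlocal term can be infinite on part of the energy space; therefore energies are
  \<open>ennreal\<close> valued, inequalities avoid subtraction by adding a deficit to the smaller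
  side, and the minimizer is varied only along test functions, whose Riesz potential is bounded. The
  potential of the minimizer is controlled only in an integral sense, so positivity is drawn from
  minimality instead of a maximum principle: the deficit in the convexity of the gradient term
  dominates squared differences of a logarithm, and a logarithm cannot cross the boundary of a zero
  set at bounded cost.\<close>

text \<open>Smoothness is the largest class of everywhere differentiable functions closed under
  \<open>partial\<close>, so it is enough to find one such class containing \<open>f\<close>. This
  avoids formulas for iterated derivatives.\<close>

lemma smooth_coinduct:
  assumes "f \<in> S"
    and "\<And>g x. g \<in> S \<Longrightarrow> g differentiable (at x)"
    and "\<And>g b. g \<in> S \<Longrightarrow> b \<in> Basis \<Longrightarrow> partial b g \<in> S"
  shows "smooth f"
proof -
  have "foldr partial bs f \<in> S" if "bs \<in> lists Basis" for bs
    using that by (induction bs) (auto simp: assms)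
  then show ?thesis unfolding smooth_def using assms(2) by blast
qed

lemma smooth_differentiable: "smooth f \<Longrightarrow> f differentiable (at x)"
  unfolding smooth_def by (drule bspec[of _ _ "[]"]) auto

lemma smooth_partial: "smooth f \<Longrightarrow> b \<in> Basis \<Longrightarrow> smooth (partial b f)"
  unfolding smooth_def
proof (intro ballI allI)
  fix bs :: "'a list" and x :: 'a assume *: "\<forall>bs\<in>lists Basis. \<forall>x. foldr partial bs f differentiable at x"
    "b \<in> Basis" "bs \<in> lists Basis"
  then have "bs @ [b] \<in> lists Basis" by auto
  with * have "foldr partial (bs @ [b]) f differentiable at x" by blast
  then show "foldr partial bs (partial b f) differentiable at x" by simp
qed

lemma has_derivative_partial:
  "f differentiable (at x) \<Longrightarrow> (f has_derivative frechet_derivative f (at x)) (at x)"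
  by (simp add: frechet_derivative_works)

lemma partialI: "(f has_derivative f') (at x) \<Longrightarrow> partial b f x = f' b"
  by (simp add: partial_def frechet_derivative_at[symmetric])

lemma partial_line:
  assumes "f differentiable (at (x + s *\<^sub>R b))"
  shows "((\<lambda>s. f (x + s *\<^sub>R b)) has_real_derivative partial b f (x + s *\<^sub>R b)) (at s)"
proof -
  have "((\<lambda>s. f (x + s *\<^sub>R b)) has_derivative
      (\<lambda>t. frechet_derivative f (at (x + s *\<^sub>R b)) (t *\<^sub>R b))) (at s)"
    by (rule has_derivative_compose[where f = "\<lambda>s. x + s *\<^sub>R b", simplified o_def])
       (auto intro!: derivative_eq_intros has_derivative_partial assms)
  moreover have "frechet_derivative f (at (x + s *\<^sub>R b)) (t *\<^sub>R b) = t * partial b f (x + s *\<^sub>R b)" for t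
    using linear_cmul[OF linear_frechet_derivative[OF assms]] by (simp add: partial_def)
  ultimately show ?thesis by (simp add: has_field_derivative_def mult_commute_abs)
qed

lemma smooth_mult:
  assumes "smooth f" "smooth g"
  shows "smooth (\<lambda>x. f x * g x)"
proof -
  \<comment> \<open>Differentiating a product yields two products, so a class closed under
    \<open>partial\<close> has to contain finite sums of products.\<close>
  define S where "S = {h. \<exists>fs. (\<forall>p\<in>set fs. smooth (fst p) \<and> smooth (snd p)) \<and>
    h = (\<lambda>x::'a. \<Sum>p\<leftarrow>fs. fst p x * snd p x)}"
  have 1: "((\<lambda>x. \<Sum>p\<leftarrow>fs. fst p x * snd p x) has_derivative
      (\<lambda>v. \<Sum>p\<leftarrow>fs. fst p x * frechet_derivative (snd p) (at x) v + frechet_derivative (fst p) (at x) v * snd p x)) (at x)"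
    if "\<forall>p\<in>set fs. smooth (fst p) \<and> smooth (snd p)" for fs :: "(('a\<Rightarrow>real) \<times> ('a \<Rightarrow> real)) list" and x
    using that
  proof (induction fs)
    case (Cons p fs)
    then show ?case
      by (auto intro!: has_derivative_add has_derivative_mult has_derivative_partial smooth_differentiable)
  qed simp
  show ?thesis
  proof (rule smooth_coinduct[of _ S])
    show "(\<lambda>x. f x * g x) \<in> S"
      unfolding S_def using assms by (auto intro!: exI[of _ "[(f,g)]"])
    show "h differentiable (at x)" if "h \<in> S" for h x
      using that 1 unfolding S_def differentiable_def by blast
    show "partial b h \<in> S" if "h \<in> S" "b \<in> Basis" for h b
    proof -
      from that obtain fs where fs: "\<forall>p\<in>set fs. smooth (fst p) \<and> smooth (snd p)"
        "h = (\<lambda>x. \<Sum>p\<leftarrow>fs. fst p x * snd p x)" unfolding S_def by blast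
      let ?L = "concat (map (\<lambda>p. [(fst p, partial b (snd p)), (partial b (fst p), snd p)]) fs)"
      have "partial b h x = (\<Sum>p\<leftarrow>?L. fst p x * snd p x)" for x
      proof -
        have "partial b h x = (\<Sum>p\<leftarrow>fs. fst p x * frechet_derivative (snd p) (at x) b + frechet_derivative (fst p) (at x) b * snd p x)"
          unfolding fs(2) by (rule partialI[OF 1[OF fs(1)]])
        also have "\<dots> = (\<Sum>p\<leftarrow>?L. fst p x * snd p x)"
          by (induction fs) (auto simp: partial_def)
        finally show ?thesis .
      qed
      then show ?thesis unfolding S_def using fs(1) that(2)
        by (auto intro!: exI[of _ ?L] smooth_partial)
    qed
  qed
qed

lemma partial_mult:
  assumes "smooth f" "smooth g"
  shows "partial b (\<lambda>x. f x * g x) x = f x * partial b g x + partial b f x * g x"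
  unfolding partial_def
  by (subst frechet_derivative_at[OF has_derivative_mult[OF has_derivative_partial has_derivative_partial], symmetric])
     (auto intro: smooth_differentiable assms)

lemma partial_const: "partial b (\<lambda>x. c) = (\<lambda>x. 0)"
  by (auto simp: partial_def)

lemma smooth_const: "smooth (\<lambda>x. c)"
  by (rule smooth_coinduct[of _ "range (\<lambda>c x. c)"]) (auto simp: partial_const)

lemma smooth_prod:
  assumes "finite I" "\<And>i. i \<in> I \<Longrightarrow> smooth (f i)"
  shows "smooth (\<lambda>x. \<Prod>i\<in>I. f i x)"
  using assms by (induction I rule: finite_induct) (auto intro!: smooth_const smooth_mult)

lemma partial_translate:
  assumes "\<And>x. f differentiable (at x)"
  shows "partial b (\<lambda>x. f (x + c)) = (\<lambda>x. partial b f (x + c))"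
proof
  fix x
  have "((\<lambda>x. f (x + c)) has_derivative frechet_derivative f (at (x + c))) (at x)"
    by (rule has_derivative_compose[OF _ has_derivative_partial[OF assms]])
       (auto intro!: derivative_eq_intros)
  then show "partial b (\<lambda>x. f (x + c)) x = partial b f (x + c)"
    by (auto simp: partialI partial_def[of b f])
qed

lemma smooth_translate:
  assumes "smooth f" shows "smooth (\<lambda>x. f (x + c))"
proof (rule smooth_coinduct[of _ "{\<lambda>x. g (x + c) | g. smooth g}"])
  fix h x assume "h \<in> {\<lambda>x. g (x + c) | g. smooth g}"
  then obtain g where h: "h = (\<lambda>x. g (x + c))" and g: "smooth g" by blast
  have "(g \<circ> (\<lambda>x. x + c)) differentiable (at x)"
    by (intro differentiable_chain_at smooth_differentiable g) auto
  then show "h differentiable (at x)" by (simp add: h o_def)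
qed (use assms in \<open>auto simp: partial_translate smooth_differentiable intro: smooth_partial\<close>)

section \<open>Flat exponentials and smooth bumps on boxes\<close>

text \<open>Closed under differentiation: \<open>p(1/s) exp(-1/s)\<close> has derivative
  \<open>((p - p') X\<^sup>2)(1/s) exp(-1/s)\<close>.\<close>

definition flat_exp :: "real poly \<Rightarrow> real \<Rightarrow> real" where
  "flat_exp p s = (if s \<le> 0 then 0 else poly p (1 / s) * exp (- 1 / s))"

lemma poly_exp_minus_tendsto_0: "((\<lambda>y. poly p y * exp (- y)) \<longlongrightarrow> (0::real)) at_top"
proof -
  have "((\<lambda>y::real. \<Sum>i\<le>degree p. coeff p i * (y ^ i / exp y)) \<longlongrightarrow> (\<Sum>i\<le>degree p. coeff p i * 0)) at_top"
    by (intro tendsto_sum tendsto_mult tendsto_const tendsto_power_div_exp_0)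
  then show ?thesis
    by (simp add: poly_altdef sum_distrib_right exp_minus divide_inverse mult.assoc)
qed

lemma flat_exp_tendsto_0: "((\<lambda>s. poly p (1 / s) * exp (- 1 / s)) \<longlongrightarrow> (0::real)) (at_right 0)"
proof -
  have "filterlim (\<lambda>s::real. 1 / s) at_top (at_right 0)"
    using filterlim_inverse_at_top_right by (simp add: inverse_eq_divide)
  from filterlim_compose[OF poly_exp_minus_tendsto_0[of p] this] show ?thesis by simp
qed

lemma flat_exp_has_derivative:
  "(flat_exp p has_real_derivative flat_exp ((p - pderiv p) * [:0,0,1:]) s) (at s)"
proof -
  consider "s < 0" | "s > 0" | "s = 0" by linarith
  then show ?thesis
  proof cases
    case 1
    have "((\<lambda>s. 0) has_real_derivative 0) (at s)" by simp
    then have "(flat_exp p has_real_derivative 0) (at s)"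
      by (rule DERIV_cong_ev[THEN iffD1, OF refl _ refl, rotated])
         (use 1 in \<open>auto simp: flat_exp_def eventually_at_topological intro!: eventually_nhds[THEN iffD2] exI[of _ "{..<0}"]\<close>)
    then show ?thesis using 1 by (simp add: flat_exp_def)
  next
    case 2
    have "((\<lambda>s. poly p (1 / s) * exp (- 1 / s)) has_real_derivative
        poly ((p - pderiv p) * [:0,0,1:]) (1/s) * exp (- 1 / s)) (at s)"
      using 2
      by (auto intro!: derivative_eq_intros DERIV_chain2[OF poly_DERIV] simp: field_simps power2_eq_square)
    then have "(flat_exp p has_real_derivative poly ((p - pderiv p) * [:0,0,1:]) (1/s) * exp (- 1 / s)) (at s)"
      by (rule DERIV_cong_ev[THEN iffD1, OF refl _ refl, rotated])
         (use 2 in \<open>auto simp: flat_exp_def intro!: eventually_nhds[THEN iffD2] exI[of _ "{0<..}"]\<close>)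
    then show ?thesis using 2 by (simp add: flat_exp_def)
  next
    case 3
    have l: "((\<lambda>y. flat_exp p y / y) \<longlongrightarrow> 0) (at_left 0)"
      by (rule tendsto_eventually) (auto simp: eventually_at_filter flat_exp_def)
    \<comment> \<open>At 0 the difference quotient is \<open>p(1/s) exp(-1/s) / s\<close>, which has
      the same form with \<open>p\<close> multiplied by the variable.\<close>
    have "((\<lambda>s. poly ([:0,1:] * p) (1 / s) * exp (- 1 / s)) \<longlongrightarrow> (0::real)) (at_right 0)"
      by (rule flat_exp_tendsto_0)
    then have r: "((\<lambda>y. flat_exp p y / y) \<longlongrightarrow> 0) (at_right 0)"
      by (rule Lim_transform_eventually) (auto simp: eventually_at_filter flat_exp_def)
    have "((\<lambda>y. flat_exp p y / y) \<longlongrightarrow> 0) (at 0)"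
      using l r by (simp add: filterlim_at_split)
    then show ?thesis using 3 by (simp add: has_field_derivative_iff flat_exp_def)
  qed
qed

lemma smooth_flat_exp:
  fixes v :: "'a::euclidean_space"
  shows "smooth (\<lambda>x. flat_exp p (x \<bullet> v + c))"
proof -
  let ?S = "{\<lambda>x. flat_exp p (x \<bullet> v + c) | p. True}"
  have d: "((\<lambda>x. flat_exp p (x \<bullet> v + c)) has_derivative
      (\<lambda>h. (h \<bullet> v) * flat_exp ((p - pderiv p) * [:0,0,1:]) (x \<bullet> v + c))) (at x)" for p and x
    unfolding mult.commute[of "_ \<bullet> v"]
    by (rule has_derivative_compose[OF _ flat_exp_has_derivative[unfolded has_field_derivative_def]])
       (auto intro!: derivative_eq_intros)
  \<comment> \<open>The inner derivative \<open>b \<bullet> v\<close> is absorbed into the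
    polynomial, which keeps the family closed under \<open>partial\<close>.\<close>
  have s: "(\<lambda>x. (b \<bullet> v) * flat_exp p (x \<bullet> v + c)) = (\<lambda>x. flat_exp (smult (b \<bullet> v) p) (x \<bullet> v + c))" for b p
    by (auto simp: flat_exp_def)
  have e: "partial b (\<lambda>x. flat_exp p (x \<bullet> v + c)) = (\<lambda>x. flat_exp (smult (b \<bullet> v) ((p - pderiv p) * [:0,0,1:])) (x \<bullet> v + c))" for b p
    unfolding s[symmetric] by (rule ext) (rule partialI[OF d])
  show ?thesis
  proof (rule smooth_coinduct[of _ ?S])
    show "g differentiable (at x)" if "g \<in> ?S" for g x using that d by (auto simp: differentiable_def)
    show "partial b g \<in> ?S" if "g \<in> ?S" for g b using that e by auto
  qed auto
qed

text \<open>The two factors for \<open>b\<close> are \<open>exp (-1/s)\<close> at \<open>k\<close>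
  times the distances of \<open>x\<close> from the two faces orthogonal to \<open>b\<close>. A large
  \<open>k\<close> pushes the product towards 1 inside the box without moving the support.\<close>

definition box_bump :: "real \<Rightarrow> 'a::euclidean_space \<Rightarrow> 'a \<Rightarrow> 'a \<Rightarrow> real" where
  "box_bump k p q x =
     (\<Prod>b\<in>Basis. flat_exp 1 (x \<bullet> (k *\<^sub>R b) - k * (p \<bullet> b)) * flat_exp 1 (x \<bullet> (- k *\<^sub>R b) + k * (q \<bullet> b)))"

lemma flat_exp_1: "flat_exp 1 s = (if s \<le> 0 then 0 else exp (- 1 / s))"
  by (simp add: flat_exp_def)

lemma flat_exp_1_bounds: "0 \<le> flat_exp 1 s" "flat_exp 1 s \<le> 1"
  by (auto simp: flat_exp_1)

lemma box_bump_bounds: "0 \<le> box_bump k p q x" "box_bump k p q x \<le> 1"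
  unfolding box_bump_def
  by (auto intro!: prod_nonneg prod_le_1 mult_nonneg_nonneg mult_le_one flat_exp_1_bounds)

lemma box_bump_pos_iff:
  assumes "k > 0" shows "box_bump k p q x > 0 \<longleftrightarrow> x \<in> box p q"
proof -
  have "box_bump k p q x > 0 \<longleftrightarrow> box_bump k p q x \<noteq> 0" using box_bump_bounds(1)[of k p q x] by linarith
  also have "\<dots> \<longleftrightarrow> x \<in> box p q"
    using assms by (auto simp: box_bump_def flat_exp_1 mem_box mult_le_cancel_left not_le)
  finally show ?thesis .
qed

lemma box_bump_test:
  assumes "k > 0" shows "box_bump k p q \<in> test_functions"
proof -
  have "smooth (box_bump k p q)"
    unfolding box_bump_def[abs_def]
    by (intro smooth_prod smooth_mult finite_Basis smooth_flat_exp[where c = "- _", unfolded add_uminus_conv_diff] smooth_flat_exp)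
  moreover have "{x. box_bump k p q x \<noteq> 0} \<subseteq> box p q"
    using box_bump_pos_iff[OF assms, of p q] box_bump_bounds(1)[of k p q] by (force simp: less_le)
  then have "compact (closure {x. box_bump k p q x \<noteq> 0})"
    using bounded_subset bounded_box compact_closure by blast
  ultimately show ?thesis by (simp add: test_functions_def)
qed

lemma box_bump_tendsto:
  "(\<lambda>n. box_bump (real (Suc n)) p q x) \<longlonglongrightarrow> indicator (box p q) x"
proof (cases "x \<in> box p q")
  case True
  have *: "(\<lambda>n. exp (- 1 / (real (Suc n) * s))) \<longlonglongrightarrow> 1" if "s > 0" for s
  proof -
    have "(\<lambda>n. exp (- (1/s) * inverse (real (Suc n)))) \<longlonglongrightarrow> exp (- (1/s) * 0)"
      by (intro tendsto_intros LIMSEQ_inverse_real_of_nat)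
    then show ?thesis by (simp add: field_simps)
  qed
  have "(\<lambda>n. \<Prod>b\<in>Basis. exp (- 1 / (real (Suc n) * (x \<bullet> b - p \<bullet> b))) * exp (- 1 / (real (Suc n) * (q \<bullet> b - x \<bullet> b)))) \<longlonglongrightarrow> (\<Prod>b\<in>(Basis::'a set). 1 * 1)"
    using True by (intro tendsto_prod tendsto_mult *) (auto simp: mem_box)
  moreover have "box_bump (real (Suc n)) p q x = (\<Prod>b\<in>Basis. exp (- 1 / (real (Suc n) * (x \<bullet> b - p \<bullet> b))) * exp (- 1 / (real (Suc n) * (q \<bullet> b - x \<bullet> b))))" for n
    unfolding box_bump_def
  proof (intro prod.cong refl arg_cong2[of _ _ _ _ "(*)"])
    fix b :: 'a assume "b \<in> Basis"
    then have b: "0 < x \<bullet> b - p \<bullet> b" "0 < q \<bullet> b - x \<bullet> b" using True by (auto simp: mem_box)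
    have e: "x \<bullet> (real (Suc n) *\<^sub>R b) - real (Suc n) * (p \<bullet> b) = real (Suc n) * (x \<bullet> b - p \<bullet> b)"
      "x \<bullet> (- real (Suc n) *\<^sub>R b) + real (Suc n) * (q \<bullet> b) = real (Suc n) * (q \<bullet> b - x \<bullet> b)"
      by (simp_all add: algebra_simps)
    have "0 < real (Suc n) * (x \<bullet> b - p \<bullet> b)" "0 < real (Suc n) * (q \<bullet> b - x \<bullet> b)"
      using b by (auto intro!: mult_pos_pos simp del: of_nat_Suc)
    then show "flat_exp 1 (x \<bullet> (real (Suc n) *\<^sub>R b) - real (Suc n) * (p \<bullet> b)) = exp (- 1 / (real (Suc n) * (x \<bullet> b - p \<bullet> b)))"
      "flat_exp 1 (x \<bullet> (- real (Suc n) *\<^sub>R b) + real (Suc n) * (q \<bullet> b)) = exp (- 1 / (real (Suc n) * (q \<bullet> b - x \<bullet> b)))"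
      unfolding e flat_exp_1 by (auto simp del: of_nat_Suc)
  qed
  ultimately show ?thesis using True by simp
next
  case False
  then have "box_bump (real (Suc n)) p q x = 0" for n
    using box_bump_pos_iff[of "real (Suc n)" p q x] box_bump_bounds(1)[of "real (Suc n)" p q x] by linarith
  then show ?thesis using False by simp
qed

section \<open>Supports, bounds and closure properties of test functions\<close>

lemma test_smooth: "\<phi> \<in> test_functions \<Longrightarrow> smooth \<phi>"
  by (simp add: test_functions_def)

lemma test_bounded_support:
  assumes "\<phi> \<in> test_functions" shows "\<exists>R>0. \<forall>x. norm x > R \<longrightarrow> \<phi> x = 0"
proof -
  have "bounded (closure {x. \<phi> x \<noteq> 0})" using assms compact_imp_bounded by (auto simp: test_functions_def)
  then obtain R where R: "R > 0" "\<And>x. x \<in> closure {x. \<phi> x \<noteq> 0} \<Longrightarrow> norm x \<le> R"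
    by (auto simp: bounded_pos)
  have "\<phi> x = 0" if "norm x > R" for x
    using R(2)[of x] that closure_subset[of "{x. \<phi> x \<noteq> 0}"] by fastforce
  with R(1) show ?thesis by blast
qed

lemma testI:
  assumes "smooth \<phi>" "\<And>x. norm x > R \<Longrightarrow> \<phi> x = 0" shows "\<phi> \<in> test_functions"
proof -
  have "{x. \<phi> x \<noteq> 0} \<subseteq> cball 0 R" using assms(2) by (auto simp: not_less[symmetric])
  then show ?thesis using assms(1) bounded_subset[OF bounded_cball] compact_closure
    by (auto simp: test_functions_def)
qed

lemma test_partial:
  assumes "\<phi> \<in> test_functions" "b \<in> Basis" shows "partial b \<phi> \<in> test_functions"
proof -
  obtain R where R: "R > 0" "\<And>x. norm x > R \<Longrightarrow> \<phi> x = 0" using test_bounded_support[OF assms(1)] by auto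
  have "partial b \<phi> x = 0" if "norm x > R" for x
  proof -
    have "open (- cball (0::'a) R)" "x \<in> - cball 0 R" using that by auto
    then have "(\<phi> has_derivative (\<lambda>h. 0)) (at x)"
      using R(2) by (intro has_derivative_transform_within_open[OF has_derivative_const]) auto
    then show ?thesis by (rule partialI)
  qed
  then show ?thesis by (rule testI[OF smooth_partial[OF test_smooth[OF assms(1)] assms(2)]])
qed

lemma test_mult:
  assumes "\<phi> \<in> test_functions" "smooth \<psi>" shows "(\<lambda>x. \<phi> x * \<psi> x) \<in> test_functions"
proof -
  obtain R where R: "R > 0" "\<And>x. norm x > R \<Longrightarrow> \<phi> x = 0" using test_bounded_support[OF assms(1)] by auto
  show ?thesis
    by (rule testI[of _ R], rule smooth_mult[OF test_smooth[OF assms(1)] assms(2)]) (simp add: R)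
qed

lemma test_translate:
  assumes "\<phi> \<in> test_functions" shows "(\<lambda>x. \<phi> (x + c)) \<in> test_functions"
proof -
  obtain R where R: "R > 0" "\<And>x. norm x > R \<Longrightarrow> \<phi> x = 0" using test_bounded_support[OF assms(1)] by auto
  show ?thesis
  proof (rule testI[of _ "R + norm c"])
    show "\<phi> (x + c) = 0" if "norm x > R + norm c" for x
      using R(2)[of "x + c"] that norm_triangle_ineq4[of "x + c" c] by simp
  qed (auto intro: smooth_translate test_smooth assms)
qed

lemma test_continuous: "\<phi> \<in> test_functions \<Longrightarrow> continuous_on A \<phi>"
  by (meson continuous_at_imp_continuous_on differentiable_imp_continuous_within smooth_differentiable test_smooth)

lemma test_bounded:
  assumes "\<phi> \<in> test_functions" shows "\<exists>M>0. \<forall>x. \<bar>\<phi> x\<bar> \<le> M"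
proof -
  obtain R where R: "R > 0" "\<And>x. norm x > R \<Longrightarrow> \<phi> x = 0" using test_bounded_support[OF assms(1)] by auto
  have "compact (\<phi> ` cball 0 R)" by (intro compact_continuous_image test_continuous assms compact_cball)
  then obtain M where M: "M > 0" "\<And>x. norm x \<le> R \<Longrightarrow> \<bar>\<phi> x\<bar> \<le> M"
    using compact_imp_bounded by (force simp: bounded_pos)
  have "\<bar>\<phi> x\<bar> \<le> M" for x using M R(2)[of x] by (cases "norm x \<le> R") auto
  with M(1) show ?thesis by blast
qed

lemma test_measurable [measurable_dest]: "\<phi> \<in> test_functions \<Longrightarrow> \<phi> \<in> borel_measurable borel"
  by (simp add: borel_measurable_continuous_onI test_continuous)

lemma test_integrable_mult:
  assumes "\<phi> \<in> test_functions" and [measurable]: "u \<in> borel_measurable borel"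
    and u: "\<And>R. integrable lborel (\<lambda>x. indicator (cball 0 R) x * u x)"
  shows "integrable lborel (\<lambda>x. \<phi> x * u x :: real)"
proof -
  note [measurable] = test_measurable[OF assms(1)]
  obtain R where R: "R > 0" "\<And>x. norm x > R \<Longrightarrow> \<phi> x = 0" using test_bounded_support[OF assms(1)] by auto
  obtain M where M: "M > 0" "\<And>x. \<bar>\<phi> x\<bar> \<le> M" using test_bounded[OF assms(1)] by auto
  show ?thesis
  proof (rule Bochner_Integration.integrable_bound)
    show "integrable lborel (\<lambda>x. M * (indicator (cball 0 R) x * u x))" using u by simp
    show "AE x in lborel. norm (\<phi> x * u x) \<le> norm (M * (indicator (cball 0 R) x * u x))"
      using R(2) M by (intro AE_I2) (auto simp: abs_mult indicator_def mult_right_mono not_le intro: order_trans)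
  qed simp
qed

lemma test_integrable:
  assumes "\<phi> \<in> test_functions" shows "integrable lborel \<phi>"
proof -
  have "integrable lborel (indicator (cball 0 R) :: 'a \<Rightarrow> real)" for R
    by (rule integrable_real_indicator) (use emeasure_lborel_cball_finite in auto)
  then show ?thesis using test_integrable_mult[OF assms, of "\<lambda>x. 1"] by simp
qed

subsection \<open>Square integrable functions and the fundamental lemma\<close>

lemma nn_integral_lborel_translate:
  fixes f :: "'a::euclidean_space \<Rightarrow> ennreal"
  assumes [measurable]: "f \<in> borel_measurable borel"
  shows "(\<integral>\<^sup>+x. f (x + c) \<partial>lborel) = (\<integral>\<^sup>+x. f x \<partial>lborel)"
proof -
  have "(\<integral>\<^sup>+x. f x \<partial>lborel) = (\<integral>\<^sup>+x. f x \<partial>distr lborel borel ((+) c))"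
    by (simp add: lborel_distr_plus)
  also have "\<dots> = (\<integral>\<^sup>+x. f (x + c) \<partial>lborel)"
    by (subst nn_integral_distr) (auto simp: add.commute)
  finally show ?thesis ..
qed

lemma integral_lborel_translate:
  fixes f :: "'a::euclidean_space \<Rightarrow> real"
  assumes [measurable]: "f \<in> borel_measurable borel"
  shows "(LINT x|lborel. f (x + c)) = (LINT x|lborel. f x)"
proof -
  have "(LINT x|lborel. f x) = (LINT x|distr lborel borel ((+) c). f x)"
    by (simp add: lborel_distr_plus)
  also have "\<dots> = (LINT x|lborel. f (x + c))"
    by (subst integral_distr) (auto simp: add.commute)
  finally show ?thesis ..
qed

lemma integrable_lborel_translate:
  fixes f :: "'a::euclidean_space \<Rightarrow> real"
  assumes "integrable lborel f"
  shows "integrable lborel (\<lambda>x. f (x + c))"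
proof -
  have "integrable (distr lborel borel ((+) c)) f"
    using assms by (simp add: lborel_distr_plus)
  then have "integrable lborel (\<lambda>x. f (c + x))"
    by (rule integrable_distr[rotated]) simp
  then show ?thesis by (simp add: add.commute)
qed

lemma AE_lborel_translate:
  fixes P :: "'a::euclidean_space \<Rightarrow> bool"
  assumes "AE x in lborel. P x" shows "AE x in lborel. P (x + c)"
proof -
  have "AE x in distr lborel borel ((+) c). P x"
    unfolding lborel_distr_plus using assms .
  then have "AE x in lborel. P (c + x)"
    by (rule AE_distrD[rotated]) simp
  then show ?thesis by (simp add: add.commute)
qed

lemma enn2real_eq: "x \<noteq> top \<Longrightarrow> y \<noteq> top \<Longrightarrow> enn2real x = enn2real y \<longleftrightarrow> x = y"
  by (cases x; cases y) auto

text \<open>Real functions with Borel representatives: Borel measurability survives translations and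
  is what Tonelli's theorem on products of \<open>lborel\<close> asks for. Complex and Lebesgue
  measurable functions are reduced to this setting at the end, through \<open>rep\<close>.\<close>

definition sqint :: "('a::euclidean_space \<Rightarrow> real) \<Rightarrow> bool" where
  "sqint f \<longleftrightarrow> f \<in> borel_measurable borel \<and> integrable lborel (\<lambda>x. (f x)\<^sup>2)"

lemma sqint_measurable [measurable_dest]: "sqint f \<Longrightarrow> f \<in> borel_measurable borel"
  by (simp add: sqint_def)

lemma sqint_integrable: "sqint f \<Longrightarrow> integrable lborel (\<lambda>x. (f x)\<^sup>2)"
  by (simp add: sqint_def)

lemma sqint_nn_integral: "sqint f \<Longrightarrow> (\<integral>\<^sup>+x. ennreal ((f x)\<^sup>2) \<partial>lborel) = ennreal (LINT x|lborel. (f x)\<^sup>2)"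
  by (rule nn_integral_eq_integral) (auto simp: sqint_def)

lemma sqint_iff:
  "sqint f \<longleftrightarrow> f \<in> borel_measurable borel \<and> (\<integral>\<^sup>+x. ennreal ((f x)\<^sup>2) \<partial>lborel) < \<infinity>"
  by (auto simp: sqint_def integrable_iff_bounded)

lemma sqintI:
  assumes [measurable]: "f \<in> borel_measurable borel" and "integrable lborel g" "\<And>x. (f x)\<^sup>2 \<le> g x"
  shows "sqint f"
proof -
  have "(f x)\<^sup>2 \<le> \<bar>g x\<bar>" for x using assms(3)[of x] by linarith
  then have "integrable lborel (\<lambda>x. (f x)\<^sup>2)"
    by (intro Bochner_Integration.integrable_bound[OF assms(2)] AE_I2) simp_all
  then show ?thesis by (simp add: sqint_def)
qed

lemma sum_sq_bound: "(a + b)\<^sup>2 \<le> 2 * a\<^sup>2 + 2 * (b::real)\<^sup>2"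
  using sum_squares_bound[of a b] unfolding power2_sum by linarith

lemma sqint_mult_integrable:
  assumes [measurable_dest]: "sqint f" "sqint g"
  shows "integrable lborel (\<lambda>x. f x * g x)"
proof (rule Bochner_Integration.integrable_bound)
  show "integrable lborel (\<lambda>x. (f x)\<^sup>2 + (g x)\<^sup>2)"
    using assms by (simp add: sqint_def)
  have "\<bar>a * b\<bar> \<le> a\<^sup>2 + b\<^sup>2" for a b :: real
    using sum_squares_bound[of "\<bar>a\<bar>" "\<bar>b\<bar>"] mult_nonneg_nonneg[of "\<bar>a\<bar>" "\<bar>b\<bar>"]
    unfolding abs_mult power2_abs by linarith
  then show "AE x in lborel. norm (f x * g x) \<le> norm ((f x)\<^sup>2 + (g x)\<^sup>2)"
    by (intro AE_I2) simp
qed (use assms in measurable)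

lemma sqint_add: assumes "sqint f" "sqint g" shows "sqint (\<lambda>x. f x + g x)"
  by (rule sqintI[of _ "\<lambda>x. 2 * (f x)\<^sup>2 + 2 * (g x)\<^sup>2"])
     (use assms in \<open>auto simp: sqint_def sum_sq_bound\<close>)

lemma sqint_cmult: "sqint f \<Longrightarrow> sqint (\<lambda>x. c * f x)"
  by (auto simp: sqint_def power_mult_distrib)

lemma sqint_diff: assumes "sqint f" "sqint g" shows "sqint (\<lambda>x. f x - g x)"
  using sqint_add[OF assms(1) sqint_cmult[OF assms(2), of "-1"]] by simp

lemma sqint_translate: assumes "sqint f" shows "sqint (\<lambda>x. f (x + c))"
  using integrable_lborel_translate[OF sqint_integrable[OF assms], of c] sqint_measurable[OF assms]
  by (simp add: sqint_def)

lemma test_sqint: assumes "\<phi> \<in> test_functions" shows "sqint \<phi>"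
  using test_integrable[OF test_mult[OF assms test_smooth[OF assms]]] test_measurable[OF assms]
  by (simp add: sqint_def power2_eq_square)

lemma sqint_indicator_cball: "sqint (indicator (cball a R))"
proof -
  have "integrable lborel (indicator (cball a R) :: 'a \<Rightarrow> real)"
    by (rule integrable_real_indicator) (use emeasure_lborel_cball_finite in auto)
  then show ?thesis by (simp add: sqint_def power2_eq_square flip: indicator_inter_arith)
qed

lemma sqint_locally_integrable: "sqint f \<Longrightarrow> integrable lborel (\<lambda>x. indicator (cball 0 R) x * f x)"
  by (rule sqint_mult_integrable[OF sqint_indicator_cball])

text \<open>Smooth bumps increase to indicators of boxes, and boxes generate the Borel sets.\<close>

lemma test_orthogonal_imp_zero:
  fixes w :: "'a::euclidean_space \<Rightarrow> real"
  assumes [measurable]: "w \<in> borel_measurable borel"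
    and int: "\<And>R. integrable lborel (\<lambda>x. indicator (cball 0 R) x * w x)"
    and zero: "\<And>\<phi>. \<phi> \<in> test_functions \<Longrightarrow> (LINT x|lborel. \<phi> x * w x) = 0"
  shows "AE x in lborel. w x = 0"
proof -
  have ibox: "integrable lborel (\<lambda>x. indicator (box p q) x * w x)" for p q
  proof -
    obtain R where "box p q \<subseteq> cball 0 R" using bounded_box[of p q] by (auto simp: bounded_iff subset_iff)
    then show ?thesis
      by (intro Bochner_Integration.integrable_bound[OF int[of R]] AE_I2) (auto simp: indicator_def)
  qed
  have box0: "(LINT x|lborel. indicator (box p q) x * w x) = 0" for p q
  proof -
    have "(\<lambda>n. LINT x|lborel. box_bump (real (Suc n)) p q x * w x) \<longlonglongrightarrow> (LINT x|lborel. indicator (box p q) x * w x)"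
    proof (rule integral_dominated_convergence[where w = "\<lambda>x. \<bar>indicator (box p q) x * w x\<bar>"])
      show "AE x in lborel. (\<lambda>n. box_bump (real (Suc n)) p q x * w x) \<longlonglongrightarrow> indicator (box p q) x * w x"
        by (intro AE_I2 tendsto_mult box_bump_tendsto tendsto_const)
      show "AE x in lborel. norm (box_bump (real (Suc n)) p q x * w x) \<le> \<bar>indicator (box p q) x * w x\<bar>" for n
      proof (rule AE_I2)
        fix x
        show "norm (box_bump (real (Suc n)) p q x * w x) \<le> \<bar>indicator (box p q) x * w x\<bar>"
          using box_bump_pos_iff[of "real (Suc n)" p q x] box_bump_bounds[of "real (Suc n)" p q x]
          by (cases "x \<in> box p q") (auto simp: abs_mult mult_left_le_one_le)
      qed
      show "(\<lambda>x. box_bump (real (Suc n)) p q x * w x) \<in> borel_measurable lborel" for n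
        using test_measurable[OF box_bump_test, of "real (Suc n)" p q] by simp
      show "integrable lborel (\<lambda>x. \<bar>indicator (box p q) x * w x\<bar>)" using ibox by (rule integrable_abs)
    qed simp
    moreover have "(LINT x|lborel. box_bump (real (Suc n)) p q x * w x) = 0" for n
      by (intro zero box_bump_test) simp
    ultimately show ?thesis by (simp add: LIMSEQ_const_iff)
  qed
  have "AE x in lborel. x \<in> box (- real n *\<^sub>R One) (real n *\<^sub>R One) \<longrightarrow> w x = 0" for n
  proof -
    let ?B = "box (- real n *\<^sub>R One) (real n *\<^sub>R One) :: 'a set"
    \<comment> \<open>Positive and negative part of \<open>w\<close> on a bounded box, since
      \<open>ennreal\<close> truncates negative values to 0. The cutoff makes the two measures
      finite, so that agreement on boxes determines them.\<close>
    define f g where "f x = ennreal (indicator ?B x * w x)" and "g x = ennreal (- (indicator ?B x * w x))" for x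
    have [measurable]: "f \<in> borel_measurable borel" "g \<in> borel_measurable borel"
      by (auto simp: f_def[abs_def] g_def[abs_def])
    have fin: "(\<integral>\<^sup>+x. f x \<partial>lborel) < \<infinity>" 
      using ibox[of "- real n *\<^sub>R One" "real n *\<^sub>R One"] by (auto simp: real_integrable_def f_def top.not_eq_extremum)
    have eq: "emeasure (density lborel f) (box p q) = emeasure (density lborel g) (box p q)" for p q
    proof -
      obtain p' q' where pq: "box p q \<inter> ?B = box p' q'" unfolding box_Int_box by blast
      have "(\<integral>\<^sup>+x. f x * indicator (box p q) x \<partial>lborel) = (\<integral>\<^sup>+x. ennreal (indicator (box p' q') x * w x) \<partial>lborel)"
        unfolding pq[symmetric] by (intro nn_integral_cong) (auto simp: f_def indicator_def)
      moreover have "(\<integral>\<^sup>+x. g x * indicator (box p q) x \<partial>lborel) = (\<integral>\<^sup>+x. ennreal (- (indicator (box p' q') x * w x)) \<partial>lborel)"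
        unfolding pq[symmetric] by (intro nn_integral_cong) (auto simp: g_def indicator_def)
      moreover have "enn2real (\<integral>\<^sup>+x. ennreal (indicator (box p' q') x * w x) \<partial>lborel) = enn2real (\<integral>\<^sup>+x. ennreal (- (indicator (box p' q') x * w x)) \<partial>lborel)"
        using real_lebesgue_integral_def[OF ibox[of p' q']] box0[of p' q'] by simp
      then have "(\<integral>\<^sup>+x. ennreal (indicator (box p' q') x * w x) \<partial>lborel) = (\<integral>\<^sup>+x. ennreal (- (indicator (box p' q') x * w x)) \<partial>lborel)"
        using ibox[of p' q'] unfolding real_integrable_def infinity_ennreal_def
        by (elim conjE) (subst (asm) enn2real_eq, assumption+)
      ultimately show ?thesis by (simp add: emeasure_density)
    qed
    have "density lborel f = density lborel g"
    proof (rule measure_eqI_generator_eq)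
      let ?E = "range (\<lambda>(a, b). box a b::'a set)"
      show "Int_stable ?E"
        by (auto simp: Int_stable_def box_Int_box)
      show "?E \<subseteq> Pow UNIV" "sets (density lborel f) = sigma_sets UNIV ?E" "sets (density lborel g) = sigma_sets UNIV ?E"
        by (simp_all add: borel_eq_box)
      let ?A = "\<lambda>n::nat. box (- (real n *\<^sub>R One)) (real n *\<^sub>R One) :: 'a set"
      show "range ?A \<subseteq> ?E" "(\<Union>i. ?A i) = UNIV"
        unfolding UN_box_eq_UNIV by auto
      show "emeasure (density lborel f) (?A i) \<noteq> \<infinity>" for i
      proof -
        have "emeasure (density lborel f) (?A i) \<le> emeasure (density lborel f) UNIV"
          by (intro emeasure_mono) auto
        also have "\<dots> = (\<integral>\<^sup>+x. f x \<partial>lborel)" by (simp add: emeasure_density)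
        finally show ?thesis using fin by auto
      qed
      show "emeasure (density lborel f) X = emeasure (density lborel g) X" if "X \<in> ?E" for X
        using that eq by auto
    qed
    then have "AE x in lborel. f x = g x"
      by (intro sigma_finite_measure.density_unique[OF lborel.sigma_finite_measure_axioms]) auto
    then show ?thesis
    proof eventually_elim
      case (elim x)
      show ?case
      proof
        assume x: "x \<in> ?B"
        \<comment> \<open>At most one of \<open>w x\<close> and \<open>- w x\<close> is positive, so
          equality of the truncations forces \<open>w x = 0\<close>.\<close>
        from elim x have "ennreal (w x) = ennreal (- w x)" by (simp add: f_def g_def)
        then show "w x = 0" by (cases "w x \<ge> 0") (auto simp: ennreal_neg ennreal_eq_0_iff)
      qed
    qed
  qed
  then have "AE x in lborel. \<forall>n. x \<in> box (- real n *\<^sub>R One) (real n *\<^sub>R One) \<longrightarrow> w x = 0"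
    unfolding AE_all_countable by blast
  moreover have "\<exists>n. x \<in> box (- real n *\<^sub>R One) (real n *\<^sub>R One)" for x :: 'a
    using UN_box_eq_UNIV[where 'a = 'a] by (auto simp: set_eq_iff)
  ultimately show ?thesis by (auto elim!: eventually_mono)
qed

subsection \<open>Weak derivatives and difference quotients\<close>

definition wpd :: "('a::euclidean_space \<Rightarrow> real) \<Rightarrow> 'a \<Rightarrow> ('a \<Rightarrow> real) \<Rightarrow> bool" where
  "wpd f b g \<longleftrightarrow> sqint f \<and> sqint g \<and>
     (\<forall>\<phi>\<in>test_functions. (LINT x|lborel. partial b \<phi> x * f x) = - (LINT x|lborel. \<phi> x * g x))"

lemma wpd_sqint: "wpd f b g \<Longrightarrow> sqint f" "wpd f b g \<Longrightarrow> sqint g"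
  by (auto simp: wpd_def)

lemma wpdD:
  "wpd f b g \<Longrightarrow> \<phi> \<in> test_functions \<Longrightarrow>
    (LINT x|lborel. partial b \<phi> x * f x) = - (LINT x|lborel. \<phi> x * g x)"
  by (auto simp: wpd_def)

lemma wpd_unique:
  assumes "wpd f b g" "wpd f b g'" shows "AE x in lborel. g x = g' x"
proof -
  note [measurable] = wpd_sqint(2)[OF assms(1), THEN sqint_measurable] wpd_sqint(2)[OF assms(2), THEN sqint_measurable]
  have "AE x in lborel. g x - g' x = 0"
  proof (rule test_orthogonal_imp_zero)
    show "integrable lborel (\<lambda>x. indicator (cball 0 R) x * (g x - g' x))" for R
      by (intro sqint_locally_integrable sqint_diff wpd_sqint(2)[OF assms(1)] wpd_sqint(2)[OF assms(2)])
    show "(LINT x|lborel. \<phi> x * (g x - g' x)) = 0" if "\<phi> \<in> test_functions" for \<phi>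
      using wpdD[OF assms(1) that] wpdD[OF assms(2) that]
      by (simp add: right_diff_distrib sqint_mult_integrable[OF test_sqint[OF that] wpd_sqint(2)[OF assms(1)]]
          sqint_mult_integrable[OF test_sqint[OF that] wpd_sqint(2)[OF assms(2)]])
  qed simp
  then show ?thesis by simp
qed

lemma wpd_add_cmult:
  assumes "wpd f b g" "wpd f' b g'" "b \<in> Basis"
  shows "wpd (\<lambda>x. f x + c * f' x) b (\<lambda>x. g x + c * g' x)"
  unfolding wpd_def
proof (intro conjI ballI)
  show "sqint (\<lambda>x. f x + c * f' x)" "sqint (\<lambda>x. g x + c * g' x)"
    using assms by (auto intro!: sqint_add sqint_cmult simp: wpd_def)
  fix \<phi> :: "'a \<Rightarrow> real" assume t: "\<phi> \<in> test_functions"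
  note i = test_sqint[OF t, THEN sqint_mult_integrable] test_sqint[OF test_partial[OF t assms(3)], THEN sqint_mult_integrable]
  have d: "u * (v + c * w) = u * v + c * (u * w)" for u v w :: real by (simp add: algebra_simps)
  show "(LINT x|lborel. partial b \<phi> x * (f x + c * f' x)) = - (LINT x|lborel. \<phi> x * (g x + c * g' x))"
    unfolding d using wpdD[OF assms(1) t] wpdD[OF assms(2) t]
    by (simp add: i wpd_sqint[OF assms(1)] wpd_sqint[OF assms(2)])
qed

text \<open>The increment of \<open>f\<close> from \<open>x\<close> to \<open>x + h b\<close>,
  written as an integral of the derivative \<open>g\<close>. Where \<open>g\<close> is not
  integrable on the segment the value is 0 by default.\<close>

definition seg :: "real \<Rightarrow> 'a::euclidean_space \<Rightarrow> ('a \<Rightarrow> real) \<Rightarrow> 'a \<Rightarrow> real" where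
  "seg h b g x = (LINT s|lborel. indicator {0..h} s * g (x + s *\<^sub>R b))"

lemma seg_measurable [measurable]:
  assumes [measurable]: "g \<in> borel_measurable borel"
  shows "seg h b g \<in> borel_measurable borel"
  unfolding seg_def[abs_def] by measurable

text \<open>Cauchy-Schwarz on the segment gives one factor \<open>h\<close>; Tonelli's theorem and
  translation invariance give the other.\<close>

lemma nn_integral_seg_sq:
  fixes g :: "'a::euclidean_space \<Rightarrow> real"
  assumes [measurable]: "g \<in> borel_measurable borel" and h: "h \<ge> 0"
  shows "(\<integral>\<^sup>+x. ennreal ((seg h b g x)\<^sup>2) \<partial>lborel) \<le> ennreal (h\<^sup>2) * (\<integral>\<^sup>+x. ennreal ((g x)\<^sup>2) \<partial>lborel)"
proof -
  have i2: "(\<integral>\<^sup>+s. (ennreal (indicator {0..h} s))\<^sup>2 \<partial>lborel) = ennreal h"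
  proof -
    have "(\<integral>\<^sup>+s. (ennreal (indicator {0..h} s))\<^sup>2 \<partial>lborel) = (\<integral>\<^sup>+s. indicator {0..h} s \<partial>lborel)"
      by (intro nn_integral_cong) (auto simp: indicator_def)
    then show ?thesis using h by simp
  qed
  have 1: "ennreal ((seg h b g x)\<^sup>2) \<le> ennreal h * (\<integral>\<^sup>+s. indicator {0..h} s * ennreal ((g (x + s *\<^sub>R b))\<^sup>2) \<partial>lborel)" for x
  proof -
    have "ennreal \<bar>seg h b g x\<bar> \<le> (\<integral>\<^sup>+s. ennreal (indicator {0..h} s) * ennreal (indicator {0..h} s * \<bar>g (x + s *\<^sub>R b)\<bar>) \<partial>lborel)" (is "_ \<le> ?I")
    proof (cases "integrable lborel (\<lambda>s. indicator {0..h} s * g (x + s *\<^sub>R b))")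
      case True
      have "ennreal \<bar>seg h b g x\<bar> \<le> (\<integral>\<^sup>+s. ennreal \<bar>indicator {0..h} s * g (x + s *\<^sub>R b)\<bar> \<partial>lborel)"
        using integral_norm_bound_ennreal[OF True] by (simp add: seg_def)
      also have "\<dots> = ?I" by (intro nn_integral_cong) (auto simp: indicator_def)
      finally show ?thesis .
    next
      case False
      then show ?thesis by (simp add: seg_def not_integrable_integral_eq)
    qed
    then have "(ennreal \<bar>seg h b g x\<bar>)\<^sup>2 \<le> ?I\<^sup>2" by (rule power_mono) simp
    also have "\<dots> \<le> (\<integral>\<^sup>+s. (ennreal (indicator {0..h} s))\<^sup>2 \<partial>lborel) * (\<integral>\<^sup>+s. (ennreal (indicator {0..h} s * \<bar>g (x + s *\<^sub>R b)\<bar>))\<^sup>2 \<partial>lborel)"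
      by (rule Cauchy_Schwarz_nn_integral) measurable
    also have "(\<integral>\<^sup>+s. (ennreal (indicator {0..h} s * \<bar>g (x + s *\<^sub>R b)\<bar>))\<^sup>2 \<partial>lborel) = (\<integral>\<^sup>+s. indicator {0..h} s * ennreal ((g (x + s *\<^sub>R b))\<^sup>2) \<partial>lborel)"
      by (intro nn_integral_cong) (auto simp: indicator_def ennreal_power)
    finally have "(ennreal \<bar>seg h b g x\<bar>)\<^sup>2 \<le> ennreal h * (\<integral>\<^sup>+s. indicator {0..h} s * ennreal ((g (x + s *\<^sub>R b))\<^sup>2) \<partial>lborel)"
      unfolding i2 .
    then show ?thesis by (simp add: ennreal_power)
  qed
  have "(\<integral>\<^sup>+x. ennreal ((seg h b g x)\<^sup>2) \<partial>lborel) \<le> (\<integral>\<^sup>+x. ennreal h * (\<integral>\<^sup>+s. indicator {0..h} s * ennreal ((g (x + s *\<^sub>R b))\<^sup>2) \<partial>lborel) \<partial>lborel)"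
    by (intro nn_integral_mono 1)
  also have "\<dots> = ennreal h * (\<integral>\<^sup>+x. \<integral>\<^sup>+s. indicator {0..h} s * ennreal ((g (x + s *\<^sub>R b))\<^sup>2) \<partial>lborel \<partial>lborel)"
    by (rule nn_integral_cmult) measurable
  also have "(\<integral>\<^sup>+x. \<integral>\<^sup>+s. indicator {0..h} s * ennreal ((g (x + s *\<^sub>R b))\<^sup>2) \<partial>lborel \<partial>lborel)
      = (\<integral>\<^sup>+s. \<integral>\<^sup>+x. indicator {0..h} s * ennreal ((g (x + s *\<^sub>R b))\<^sup>2) \<partial>lborel \<partial>lborel)"
    by (rule lborel_pair.Fubini') measurable
  also have "\<dots> = (\<integral>\<^sup>+s. indicator {0..h} s * (\<integral>\<^sup>+x. ennreal ((g x)\<^sup>2) \<partial>lborel) \<partial>lborel)"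
    by (subst nn_integral_cmult) (simp_all add: nn_integral_lborel_translate[of "\<lambda>x. ennreal ((g x)\<^sup>2)"])
  also have "\<dots> = ennreal h * (\<integral>\<^sup>+x. ennreal ((g x)\<^sup>2) \<partial>lborel)"
    using h by (subst nn_integral_multc) auto
  finally show ?thesis using h by (simp add: power2_eq_square ennreal_mult mult.assoc)
qed

lemma sqint_seg:
  assumes "sqint g" "h \<ge> 0" shows "sqint (seg h b g)"
proof -
  note [measurable] = sqint_measurable[OF assms(1)]
  have "(\<integral>\<^sup>+x. ennreal ((g x)\<^sup>2) \<partial>lborel) < \<infinity>" using assms(1) by (simp add: sqint_iff)
  then have "ennreal (h\<^sup>2) * (\<integral>\<^sup>+x. ennreal ((g x)\<^sup>2) \<partial>lborel) < \<infinity>"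
    by (simp add: ennreal_mult_less_top)
  then show ?thesis
    unfolding sqint_iff using nn_integral_seg_sq[of g h b] assms(2) by (auto intro: le_less_trans)
qed

text \<open>Fubini's theorem, where \<open>|f g| \<le> f^2 + g^2\<close> and translation invariance
  bound the inner integral uniformly in \<open>s\<close>.\<close>

lemma integral_mult_seg:
  fixes f g :: "'a::euclidean_space \<Rightarrow> real"
  assumes "sqint f" "sqint g" "h \<ge> 0"
  shows "(LINT x|lborel. f x * seg h b g x) =
    (LINT s|lborel. indicator {0..h} s * (LINT x|lborel. f x * g (x + s *\<^sub>R b)))"
proof -
  note [measurable] = sqint_measurable[OF assms(1)] sqint_measurable[OF assms(2)]
  define C where "C = (\<integral>\<^sup>+x. ennreal ((f x)\<^sup>2) \<partial>lborel) + (\<integral>\<^sup>+x. ennreal ((g x)\<^sup>2) \<partial>lborel)"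
  have C: "C < \<infinity>" using assms by (simp add: sqint_iff C_def)
  have b: "(\<integral>\<^sup>+x. ennreal (norm (f x * g (x + s *\<^sub>R b))) \<partial>lborel) \<le> C" for s
  proof -
    have *: "\<bar>u * v\<bar> \<le> u\<^sup>2 + v\<^sup>2" for u v :: real
      using sum_squares_bound[of "\<bar>u\<bar>" "\<bar>v\<bar>"] mult_nonneg_nonneg[of "\<bar>u\<bar>" "\<bar>v\<bar>"]
      unfolding abs_mult power2_abs by linarith
    have "(\<integral>\<^sup>+x. ennreal (norm (f x * g (x + s *\<^sub>R b))) \<partial>lborel) \<le> (\<integral>\<^sup>+x. ennreal ((f x)\<^sup>2) + ennreal ((g (x + s *\<^sub>R b))\<^sup>2) \<partial>lborel)"
      by (intro nn_integral_mono) (simp add: * flip: ennreal_plus)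
    also have "\<dots> = C"
      by (subst nn_integral_add) (simp_all add: C_def nn_integral_lborel_translate[of "\<lambda>x. ennreal ((g x)\<^sup>2)"])
    finally show ?thesis .
  qed
  have "integrable (lborel \<Otimes>\<^sub>M lborel) (\<lambda>(s, x). indicator {0..h} s * (f x * g (x + s *\<^sub>R b)))"
  proof (rule integrableI_bounded)
    have "(\<integral>\<^sup>+p. ennreal (norm (case p of (s, x) \<Rightarrow> indicator {0..h} s * (f x * g (x + s *\<^sub>R b)))) \<partial>(lborel \<Otimes>\<^sub>M lborel))
      = (\<integral>\<^sup>+s. \<integral>\<^sup>+x. ennreal (norm (indicator {0..h} s * (f x * g (x + s *\<^sub>R b)))) \<partial>lborel \<partial>lborel)"
      by (subst lborel.nn_integral_fst[symmetric]) simp_all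
    also have "\<dots> \<le> (\<integral>\<^sup>+s. C * indicator {0..h} s \<partial>lborel)"
      using b by (intro nn_integral_mono) (auto simp: indicator_def)
    also have "\<dots> = C * ennreal h" using assms(3) by (subst nn_integral_cmult) auto
    also have "\<dots> < \<infinity>" using C by (simp add: ennreal_mult_less_top)
    finally show "(\<integral>\<^sup>+p. ennreal (norm (case p of (s, x) \<Rightarrow> indicator {0..h} s * (f x * g (x + s *\<^sub>R b)))) \<partial>(lborel \<Otimes>\<^sub>M lborel)) < \<infinity>" .
  qed measurable
  from lborel_pair.Fubini_integral[OF this]
  have "(LINT x|lborel. LINT s|lborel. indicator {0..h} s * (f x * g (x + s *\<^sub>R b))) =
    (LINT s|lborel. LINT x|lborel. indicator {0..h} s * (f x * g (x + s *\<^sub>R b)))" .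
  moreover have "(LINT s|lborel. indicator {0..h} s * (f x * g (x + s *\<^sub>R b))) = f x * seg h b g x" for x
    unfolding seg_def mult.left_commute[of _ "f x"] by (rule integral_mult_right_zero)
  ultimately show ?thesis by simp
qed

text \<open>The fundamental theorem of calculus along a segment. The reversed direction occurs
  because a change of variables transfers a shift to the test function with the opposite
  sign.\<close>

lemma seg_partial:
  assumes "\<phi> \<in> test_functions" "b \<in> Basis" "h \<ge> 0"
  shows "seg h b (partial b \<phi>) x = \<phi> (x + h *\<^sub>R b) - \<phi> x"
    and "seg h (- b) (partial b \<phi>) x = \<phi> x - \<phi> (x - h *\<^sub>R b)"
proof -
  have d: "\<phi> differentiable (at y)" for y using assms(1) by (intro smooth_differentiable test_smooth)
  have c: "continuous_on UNIV (partial b \<phi>)" by (intro test_continuous test_partial assms)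
  have cc: "continuous_on {0..h} (\<lambda>s. partial b \<phi> (x + s *\<^sub>R v))" for v
    by (rule continuous_on_compose2[OF c]) (auto intro!: continuous_intros)
  have "(LINT s|lborel. indicator {0..h} s *\<^sub>R partial b \<phi> (x + s *\<^sub>R b)) = \<phi> (x + h *\<^sub>R b) - \<phi> (x + 0 *\<^sub>R b)"
    by (rule integral_FTC_atLeastAtMost[OF assms(3)],
        rule has_field_derivative_at_within[OF partial_line[OF d], THEN has_real_derivative_iff_has_vector_derivative[THEN iffD1]], rule cc)
  then show "seg h b (partial b \<phi>) x = \<phi> (x + h *\<^sub>R b) - \<phi> x" by (simp add: seg_def)
  have D: "((\<lambda>s. - \<phi> (x + s *\<^sub>R (- b))) has_real_derivative partial b \<phi> (x + s *\<^sub>R (- b))) (at s)" for s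
  proof -
    have "((\<lambda>s. \<phi> (x + s *\<^sub>R b)) has_real_derivative partial b \<phi> (x + (- s) *\<^sub>R b)) (at (- s))"
      by (rule partial_line[OF d])
    then have "((\<lambda>s. \<phi> (x + (- s) *\<^sub>R b)) has_real_derivative - partial b \<phi> (x + (- s) *\<^sub>R b)) (at s)"
      unfolding DERIV_mirror by simp
    from DERIV_minus[OF this] show ?thesis by simp
  qed
  have "(LINT s|lborel. indicator {0..h} s *\<^sub>R partial b \<phi> (x + s *\<^sub>R (- b))) = - \<phi> (x + h *\<^sub>R (- b)) - - \<phi> (x + 0 *\<^sub>R (- b))"
    by (rule integral_FTC_atLeastAtMost[OF assms(3)],
        rule has_field_derivative_at_within[OF D, THEN has_real_derivative_iff_has_vector_derivative[THEN iffD1]], rule cc)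
  then show "seg h (- b) (partial b \<phi>) x = \<phi> x - \<phi> (x - h *\<^sub>R b)" by (simp add: seg_def)
qed

text \<open>The increments \<open>\<phi> (x + b) - \<phi> x\<close> have integral 0 by translation
  invariance, while Fubini's theorem turns the same integral into that of the partial
  derivative.\<close>

lemma integral_partial_test:
  assumes "\<phi> \<in> test_functions" "b \<in> Basis"
  shows "(LINT x|lborel. partial b \<phi> x) = 0"
proof -
  note t = test_partial[OF assms]
  note [measurable] = test_measurable[OF assms(1)] test_measurable[OF t]
  obtain R where R: "R > 0" "\<And>x. norm x > R \<Longrightarrow> \<phi> x = 0" using test_bounded_support[OF assms(1)] by auto
  obtain R' where R': "R' > 0" "\<And>x. norm x > R' \<Longrightarrow> partial b \<phi> x = 0" using test_bounded_support[OF t] by auto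
  \<comment> \<open>The indicator replaces the constant 1, which is not square integrable. The
    additional 1 in the radius makes room for the supports of all translates by \<open>s b\<close>
    with \<open>0 \<le> s \<le> 1\<close>.\<close>
  define B where "B = cball (0::'a) (max R R' + 1)"
  have n: "norm x \<le> norm (x + s *\<^sub>R b) + 1" if "0 \<le> s" "s \<le> 1" for x s
    using norm_triangle_ineq4[of "x + s *\<^sub>R b" "s *\<^sub>R b"] that assms(2) by simp
  have e1: "indicator B x * (\<phi> (x + b) - \<phi> x) = \<phi> (x + b) - \<phi> x" for x
    using R(2)[of x] R(2)[of "x + b"] n[of 1 x] by (auto simp: B_def indicator_def)
  have e2: "indicator B x * partial b \<phi> (x + s *\<^sub>R b) = partial b \<phi> (x + s *\<^sub>R b)" if "0 \<le> s" "s \<le> 1" for x s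
    using R'(2)[of "x + s *\<^sub>R b"] n[OF that, of x] by (auto simp: B_def indicator_def)
  have "(LINT x|lborel. indicator B x * seg 1 b (partial b \<phi>) x) =
    (LINT s|lborel. indicator {0..1} s * (LINT x|lborel. indicator B x * partial b \<phi> (x + s *\<^sub>R b)))"
    by (rule integral_mult_seg) (auto intro: test_sqint t simp: B_def sqint_indicator_cball)
  also have "\<dots> = (LINT s|lborel. indicator {0..1::real} s * (LINT x|lborel. partial b \<phi> x))"
  proof (rule Bochner_Integration.integral_cong[OF refl])
    fix s :: real
    show "indicator {0..1} s * (LINT x|lborel. indicator B x * partial b \<phi> (x + s *\<^sub>R b)) = indicator {0..1} s * (LINT x|lborel. partial b \<phi> x)"
      by (cases "s \<in> {0..1}") (simp_all add: e2 integral_lborel_translate)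
  qed
  also have "\<dots> = (LINT x|lborel. partial b \<phi> x)" by simp
  also have "(LINT x|lborel. indicator B x * seg 1 b (partial b \<phi>) x) = (LINT x|lborel. \<phi> (x + b) - \<phi> x)"
    by (simp only: seg_partial(1)[OF assms zero_le_one] e1 scaleR_one)
  also have "\<dots> = 0"
    by (simp add: integrable_lborel_translate test_integrable assms integral_lborel_translate)
  finally show ?thesis ..
qed

text \<open>Integration by parts: the product of two test functions is a test function, and its
  partial derivative integrates to 0.\<close>

lemma wpd_test:
  assumes "\<phi> \<in> test_functions" "b \<in> Basis"
  shows "wpd \<phi> b (partial b \<phi>)"
  unfolding wpd_def
proof (intro conjI ballI test_sqint test_partial assms)
  fix \<psi> :: "'a \<Rightarrow> real" assume t: "\<psi> \<in> test_functions"
  have "(LINT x|lborel. \<psi> x * partial b \<phi> x + partial b \<psi> x * \<phi> x) = 0"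
    using integral_partial_test[OF test_mult[OF t test_smooth[OF assms(1)]] assms(2)]
    by (simp add: partial_mult[OF test_smooth[OF t] test_smooth[OF assms(1)]])
  then show "(LINT x|lborel. partial b \<psi> x * \<phi> x) = - (LINT x|lborel. \<psi> x * partial b \<phi> x)"
    by (simp add: sqint_mult_integrable test_sqint test_partial t assms)
qed

text \<open>Duality: paired with a test function, the segment integral is carried by Fubini's
  theorem and the weak derivative over to the reversed segment, where the classical fundamental
  theorem applies to the test function.\<close>

lemma wpd_shift:
  fixes f :: "'a::euclidean_space \<Rightarrow> real"
  assumes w: "wpd f b g" and b: "b \<in> Basis" and h: "h \<ge> 0"
  shows "AE x in lborel. f (x + h *\<^sub>R b) - f x = seg h b g x"
proof -
  note s = wpd_sqint[OF w]
  note [measurable] = sqint_measurable[OF s(1)] sqint_measurable[OF s(2)]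
  have sq: "sqint (\<lambda>x. f (x + h *\<^sub>R b) - f x)"
    by (intro sqint_diff sqint_translate s)
  have "AE x in lborel. (f (x + h *\<^sub>R b) - f x) - seg h b g x = 0"
  proof (rule test_orthogonal_imp_zero)
    show "integrable lborel (\<lambda>x. indicator (cball 0 R) x * (f (x + h *\<^sub>R b) - f x - seg h b g x))" for R
      by (intro sqint_locally_integrable sqint_diff[OF sq] sqint_seg s h)
    fix \<phi> :: "'a \<Rightarrow> real" assume t: "\<phi> \<in> test_functions"
    note ts = test_sqint[OF t]
    note [measurable] = test_measurable[OF t]
    have a: "(LINT x|lborel. \<phi> x * g (x + c)) = - (LINT x|lborel. f x * partial b \<phi> (x - c))" for c
    proof -
      have "(LINT x|lborel. \<phi> x * g (x + c)) = (LINT x|lborel. \<phi> (x - c) * g x)"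
        using integral_lborel_translate[of "\<lambda>x. \<phi> (x - c) * g x" c] by simp
      also have "\<dots> = - (LINT x|lborel. partial b (\<lambda>x. \<phi> (x - c)) x * f x)"
        using wpdD[OF w test_translate[OF t, of "- c"]] by simp
      also have "partial b (\<lambda>x. \<phi> (x - c)) = (\<lambda>x. partial b \<phi> (x - c))"
        using partial_translate[of \<phi> b "- c", OF smooth_differentiable[OF test_smooth[OF t]]] by simp
      finally show ?thesis by (simp add: mult.commute)
    qed
    have "(LINT x|lborel. \<phi> x * seg h b g x) = (LINT s|lborel. indicator {0..h} s * (LINT x|lborel. \<phi> x * g (x + s *\<^sub>R b)))"
      by (intro integral_mult_seg ts s h)
    also have "\<dots> = (LINT s|lborel. - (indicator {0..h} s * (LINT x|lborel. f x * partial b \<phi> (x + s *\<^sub>R (- b)))))"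
      by (simp add: a)
    also have "\<dots> = - (LINT s|lborel. indicator {0..h} s * (LINT x|lborel. f x * partial b \<phi> (x + s *\<^sub>R (- b))))"
      by (rule integral_minus)
    also have "\<dots> = - (LINT x|lborel. f x * seg h (- b) (partial b \<phi>) x)"
      by (subst integral_mult_seg[OF s(1) test_sqint[OF test_partial[OF t b]] h]) simp
    also have "\<dots> = - (LINT x|lborel. f x * \<phi> x - f x * \<phi> (x - h *\<^sub>R b))"
      by (simp only: seg_partial(2)[OF t b h] right_diff_distrib)
    also have "\<dots> = (LINT x|lborel. f x * \<phi> (x - h *\<^sub>R b)) - (LINT x|lborel. f x * \<phi> x)"
      using sqint_mult_integrable[OF s(1) sqint_translate[OF ts, of "- (h *\<^sub>R b)"]]
      by (simp add: sqint_mult_integrable[OF s(1) ts])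
    also have "(LINT x|lborel. f x * \<phi> (x - h *\<^sub>R b)) = (LINT x|lborel. f (x + h *\<^sub>R b) * \<phi> x)"
      using integral_lborel_translate[of "\<lambda>x. f x * \<phi> (x - h *\<^sub>R b)" "h *\<^sub>R b"] by simp
    finally show "(LINT x|lborel. \<phi> x * (f (x + h *\<^sub>R b) - f x - seg h b g x)) = 0"
      using sqint_mult_integrable[OF ts sqint_translate[OF s(1), of "h *\<^sub>R b"]]
        sqint_mult_integrable[OF ts s(1)] sqint_mult_integrable[OF ts sqint_seg[OF s(2) h, of b]]
      by (simp add: right_diff_distrib mult.commute)
  qed measurable
  then show ?thesis by simp
qed

definition dq :: "'a::euclidean_space \<Rightarrow> real \<Rightarrow> ('a \<Rightarrow> real) \<Rightarrow> ennreal" where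
  "dq b h f = (\<integral>\<^sup>+x. ennreal (((f (x + h *\<^sub>R b) - f x) / h)\<^sup>2) \<partial>lborel)"

lemma wpd_imp_dq_le:
  assumes w: "wpd f b g" and b: "b \<in> Basis" and h: "h > 0"
  shows "dq b h f \<le> (\<integral>\<^sup>+x. ennreal ((g x)\<^sup>2) \<partial>lborel)"
proof -
  note [measurable] = sqint_measurable[OF wpd_sqint(2)[OF w]]
  have "dq b h f = (\<integral>\<^sup>+x. ennreal (1 / h\<^sup>2) * ennreal ((seg h b g x)\<^sup>2) \<partial>lborel)"
    unfolding dq_def
  proof (rule nn_integral_cong_AE)
    show "AE x in lborel. ennreal (((f (x + h *\<^sub>R b) - f x) / h)\<^sup>2) = ennreal (1 / h\<^sup>2) * ennreal ((seg h b g x)\<^sup>2)"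
      using wpd_shift[OF w b less_imp_le[OF h]]
      by eventually_elim (simp add: power_divide flip: ennreal_mult)
  qed
  also have "\<dots> = ennreal (1 / h\<^sup>2) * (\<integral>\<^sup>+x. ennreal ((seg h b g x)\<^sup>2) \<partial>lborel)"
    by (rule nn_integral_cmult) measurable
  also have "\<dots> \<le> ennreal (1 / h\<^sup>2) * (ennreal (h\<^sup>2) * (\<integral>\<^sup>+x. ennreal ((g x)\<^sup>2) \<partial>lborel))"
    using h by (intro mult_left_mono nn_integral_seg_sq) auto
  also have "\<dots> = (\<integral>\<^sup>+x. ennreal ((g x)\<^sup>2) \<partial>lborel)"
    using h by (simp add: mult.assoc[symmetric] flip: ennreal_mult)
  finally show ?thesis .
qed

subsection \<open>Weak derivatives from bounded difference quotients\<close>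

lemma fatou_le:
  fixes u :: "nat \<Rightarrow> 'b \<Rightarrow> ennreal"
  assumes [measurable]: "\<And>n. u n \<in> borel_measurable M"
    and lim: "AE x in M. (\<lambda>n. u n x) \<longlonglongrightarrow> u' x"
    and le: "eventually (\<lambda>n. (\<integral>\<^sup>+x. u n x \<partial>M) \<le> c) sequentially"
  shows "(\<integral>\<^sup>+x. u' x \<partial>M) \<le> c"
proof -
  have "(\<integral>\<^sup>+x. u' x \<partial>M) = (\<integral>\<^sup>+x. liminf (\<lambda>n. u n x) \<partial>M)"
    by (rule nn_integral_cong_AE) (use lim in \<open>eventually_elim, simp add: lim_imp_Liminf\<close>)
  also have "\<dots> \<le> liminf (\<lambda>n. \<integral>\<^sup>+x. u n x \<partial>M)"
    by (rule nn_integral_liminf) simp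
  also have "\<dots> \<le> liminf (\<lambda>n. c)"
    by (rule Liminf_mono[OF le])
  also have "\<dots> = c" by (simp add: Liminf_const)
  finally show ?thesis .
qed

text \<open>The integrals decay like \<open>4^(-n)\<close>, so even the series weighted by
  \<open>2^n\<close> is finite almost everywhere. This bounds the increments pointwise by a
  geometric sequence with ratio \<open>sqrt (1/2)\<close>.\<close>

lemma fast_Cauchy_AE_convergent:
  fixes v :: "nat \<Rightarrow> 'b \<Rightarrow> real"
  assumes [measurable]: "\<And>n. v n \<in> borel_measurable M"
    and le: "\<And>n. (\<integral>\<^sup>+x. ennreal ((v (Suc n) x - v n x)\<^sup>2) \<partial>M) \<le> ennreal ((1/4)^n)"
  shows "AE x in M. convergent (\<lambda>n. v n x)"
proof -
  let ?S = "\<lambda>x. \<Sum>n. ennreal (2^n * (v (Suc n) x - v n x)\<^sup>2)"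
  have "(\<integral>\<^sup>+x. ?S x \<partial>M) = (\<Sum>n. \<integral>\<^sup>+x. ennreal (2^n * (v (Suc n) x - v n x)\<^sup>2) \<partial>M)"
    by (rule nn_integral_suminf) measurable
  also have "\<dots> \<le> (\<Sum>n. ennreal ((1/2)^n))"
  proof (rule suminf_le)
    fix n
    have "(\<integral>\<^sup>+x. ennreal (2^n * (v (Suc n) x - v n x)\<^sup>2) \<partial>M) = ennreal (2^n) * (\<integral>\<^sup>+x. ennreal ((v (Suc n) x - v n x)\<^sup>2) \<partial>M)"
      by (subst nn_integral_cmult[symmetric]) (auto simp: ennreal_mult)
    also have "\<dots> \<le> ennreal (2^n) * ennreal ((1/4)^n)" by (intro mult_left_mono le) simp
    also have "\<dots> = ennreal ((1/2)^n)" by (simp flip: ennreal_mult power_mult_distrib)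
    finally show "(\<integral>\<^sup>+x. ennreal (2^n * (v (Suc n) x - v n x)\<^sup>2) \<partial>M) \<le> ennreal ((1/2)^n)" .
  qed auto
  also have "\<dots> = ennreal (\<Sum>n. (1/2)^n)" by (rule suminf_ennreal2) (auto intro: summable_geometric)
  also have "\<dots> < \<infinity>" by simp
  finally have "AE x in M. ?S x \<noteq> \<infinity>"
    by (intro nn_integral_noteq_infinite) auto
  then show ?thesis
  proof eventually_elim
    case (elim x)
    define S where "S = enn2real (?S x)"
    have S: "?S x = ennreal S" using elim by (simp add: S_def top.not_eq_extremum)
    have "S \<ge> 0" by (simp add: S_def)
    have d: "\<bar>v (Suc n) x - v n x\<bar> \<le> sqrt S * (sqrt (1/2))^n" for n
    proof -
      have "ennreal (2^n * (v (Suc n) x - v n x)\<^sup>2) \<le> ?S x"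
        by (rule order_trans[OF _ sum_le_suminf[of _ "{n}"]]) auto
      then have "2^n * (v (Suc n) x - v n x)\<^sup>2 \<le> S" unfolding S using \<open>S \<ge> 0\<close> by (simp add: ennreal_le_iff)
      then have "(v (Suc n) x - v n x)\<^sup>2 \<le> S * (1/2)^n" by (simp add: field_simps)
      then have "sqrt ((v (Suc n) x - v n x)\<^sup>2) \<le> sqrt (S * (1/2)^n)" by (rule real_sqrt_le_mono)
      then show ?thesis by (simp only: real_sqrt_abs real_sqrt_mult[of S] real_sqrt_power[of "1/2"])
    qed
    have "summable (\<lambda>n. v (Suc n) x - v n x)"
    proof (rule summable_comparison_test')
      show "summable (\<lambda>n. sqrt S * (sqrt (1/2))^n)"
        by (intro summable_mult summable_geometric) (simp add: real_sqrt_divide)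
      show "norm (v (Suc n) x - v n x) \<le> sqrt S * (sqrt (1/2))^n" if "0 \<le> n" for n using d by simp
    qed
    then have "(\<lambda>n. \<Sum>k<n. v (Suc k) x - v k x) \<longlonglongrightarrow> (\<Sum>k. v (Suc k) x - v k x)"
      by (rule summable_LIMSEQ)
    then have "(\<lambda>n. (\<Sum>k<n. v (Suc k) x - v k x) + v 0 x) \<longlonglongrightarrow> (\<Sum>k. v (Suc k) x - v k x) + v 0 x"
      by (intro tendsto_intros)
    then show ?case by (auto simp: sum_lessThan_telescope[of "\<lambda>n. v n x"] convergent_def)
  qed
qed

text \<open>Near-minimizers of a uniformly midpoint-convex functional over decreasing midpoint-convex
  sets form a Cauchy sequence. This takes the place of weak compactness.\<close>

lemma nested_near_minimizers:
  fixes C :: "nat \<Rightarrow> 'b set" and J :: "'b \<Rightarrow> real" and D :: "'b \<Rightarrow> 'b \<Rightarrow> ennreal"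
  assumes ne: "\<And>n. C n \<noteq> {}" and dec: "\<And>n m. n \<le> m \<Longrightarrow> C m \<subseteq> C n"
    and mid: "\<And>n x y. x \<in> C n \<Longrightarrow> y \<in> C n \<Longrightarrow> mid x y \<in> C n"
    and J: "\<And>n x. x \<in> C n \<Longrightarrow> 0 \<le> J x \<and> J x \<le> B"
    and D: "\<And>n x y. x \<in> C n \<Longrightarrow> y \<in> C n \<Longrightarrow> D x y \<le> ennreal ((J x + J y) / 2 - J (mid x y))"
  shows "\<exists>x. (\<forall>n. x n \<in> C n) \<and> (\<forall>n m. n \<le> m \<longrightarrow> D (x n) (x m) \<le> ennreal ((1/4)^n))"
proof -
  define j where "j n = (INF x\<in>C n. J x)" for n
  have bd: "bdd_below (J ` C n)" for n using J by (auto intro!: bdd_belowI[of _ 0])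
  have j_le: "j n \<le> J x" if "x \<in> C n" for n x
    unfolding j_def using bd that by (intro cINF_lower) auto
  have "incseq j" unfolding j_def
    by (intro incseq_SucI cINF_superset_mono) (use ne bd dec in auto)
  moreover have "j n \<le> B" for n using ne[of n] j_le J by fastforce
  ultimately obtain L where L: "j \<longlonglongrightarrow> L" "\<And>n. j n \<le> L"
    using incseq_convergent[of j B] by auto
  \<comment> \<open>The two values of \<open>J\<close> will sum to at most
    \<open>2 * j (k n) + 3 * \<delta> n\<close>, and the value at the midpoint is at least
    \<open>j (k n)\<close>; the difference is at most \<open>3/2 * \<delta> n\<close>, below
    \<open>2 * \<delta> n = (1/4)^n\<close>.\<close>
  define \<delta> where "\<delta> n = (1/4)^n / (2::real)" for n :: nat
  have \<delta>: "\<delta> n > 0" "\<And>m. n \<le> m \<Longrightarrow> \<delta> m \<le> \<delta> n" for n by (auto simp: \<delta>_def intro!: power_decreasing)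
  have "\<exists>K. \<forall>k\<ge>K. L - j k \<le> \<delta> n" for n
    using L(1)[THEN LIMSEQ_D, OF \<delta>(1)[of n]] L(2) by (auto simp: abs_real_def split: if_splits) (smt (verit))
  then obtain K where K: "\<And>n k. k \<ge> K n \<Longrightarrow> L - j k \<le> \<delta> n" by metis
  \<comment> \<open>The sum makes the index monotone and at least \<open>K n\<close>; the summand
    \<open>n\<close> gives \<open>C (k n) \<subseteq> C n\<close>.\<close>
  define k where "k n = n + sum K {..n}" for n
  have kK: "K n \<le> k n" for n unfolding k_def using member_le_sum[of n "{..n}" K] by auto
  have kmono: "k n \<le> k m" if "n \<le> m" for n m
    unfolding k_def using that by (intro add_mono sum_mono2) auto
  have kn: "n \<le> k n" for n by (simp add: k_def)
  have "\<exists>x. x \<in> C (k n) \<and> J x \<le> j (k n) + \<delta> n" for n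
  proof -
    have "j (k n) < j (k n) + \<delta> n" using \<delta> by simp
    then obtain x where "x \<in> C (k n)" "J x < j (k n) + \<delta> n"
      unfolding j_def using cINF_less_iff[OF ne bd] by blast
    then show ?thesis by (auto intro!: exI[of _ x])
  qed
  then obtain x where x: "\<And>n. x n \<in> C (k n)" "\<And>n. J (x n) \<le> j (k n) + \<delta> n" by metis
  show ?thesis
  proof (intro exI[of _ x] conjI allI impI)
    show "x n \<in> C n" for n using x(1) dec[OF kn] by blast
    fix n m :: nat assume nm: "n \<le> m"
    have m: "x m \<in> C (k n)" using x(1) dec[OF kmono[OF nm]] by blast
    have "D (x n) (x m) \<le> ennreal ((J (x n) + J (x m)) / 2 - J (mid (x n) (x m)))"
      by (rule D[OF x(1) m])
    also have "\<dots> \<le> ennreal ((1/4)^n)"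
    proof (rule ennreal_leI)
      have e: "(1/4)^n = 2 * \<delta> n" by (simp add: \<delta>_def)
      show "(J (x n) + J (x m)) / 2 - J (mid (x n) (x m)) \<le> (1/4)^n"
      proof -
        have "J (x m) \<le> L + \<delta> n" using x(2)[of m] L(2)[of "k m"] \<delta>(2)[OF nm] by linarith
        then have "J (x n) + J (x m) \<le> 2 * j (k n) + 3 * \<delta> n" using x(2)[of n] K[OF kK, of n] by linarith
        moreover have "j (k n) \<le> J (mid (x n) (x m))" by (rule j_le[OF mid[OF x(1) m]])
        moreover have "a + b \<le> 2 * c + 3 * d \<Longrightarrow> c \<le> e \<Longrightarrow> 0 < d \<Longrightarrow> (a + b) / 2 - e \<le> 2 * d" for a b c d e :: real
          by (simp add: field_simps)
        ultimately show ?thesis unfolding e using \<delta>(1)[of n] by blast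
      qed
    qed
    finally show "D (x n) (x m) \<le> ennreal ((1/4)^n)" .
  qed
qed

text \<open>Translation moves the quotient to the test function with the opposite step; there it
  converges pointwise and is bounded by the mean value theorem.\<close>

lemma test_difference_quotient_tendsto:
  fixes f :: "'a::euclidean_space \<Rightarrow> real"
  assumes f: "sqint f" and b: "b \<in> Basis" and h: "\<And>k. h k > 0" "h \<longlonglongrightarrow> 0" and t: "\<phi> \<in> test_functions"
  shows "(\<lambda>k. LINT x|lborel. \<phi> x * ((f (x + h k *\<^sub>R b) - f x) / h k)) \<longlonglongrightarrow> - (LINT x|lborel. partial b \<phi> x * f x)"
proof -
  note [measurable] = sqint_measurable[OF f] test_measurable[OF t] test_measurable[OF test_partial[OF t b]]
  have eq: "(LINT x|lborel. \<phi> x * ((f (x + c *\<^sub>R b) - f x) / c)) = (LINT x|lborel. ((\<phi> (x - c *\<^sub>R b) - \<phi> x) / c) * f x)" for c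
  proof -
    have i: "integrable lborel (\<lambda>x. \<phi> x * f (x + v))" "integrable lborel (\<lambda>x. \<phi> (x - v) * f x)" "integrable lborel (\<lambda>x. \<phi> x * f x)" for v
      using sqint_mult_integrable[OF test_sqint[OF t] sqint_translate[OF f]]
        sqint_mult_integrable[OF sqint_translate[OF test_sqint[OF t], of "- v"] f]
        sqint_mult_integrable[OF test_sqint[OF t] f] by auto
    have "(LINT x|lborel. \<phi> x * f (x + c *\<^sub>R b)) = (LINT x|lborel. \<phi> (x - c *\<^sub>R b) * f x)"
      using integral_lborel_translate[of "\<lambda>x. \<phi> (x - c *\<^sub>R b) * f x" "c *\<^sub>R b"] by simp
    then have "(LINT x|lborel. \<phi> x * f (x + c *\<^sub>R b) - \<phi> x * f x) = (LINT x|lborel. \<phi> (x - c *\<^sub>R b) * f x - \<phi> x * f x)"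
      using i by simp
    then have "(LINT x|lborel. (\<phi> x * f (x + c *\<^sub>R b) - \<phi> x * f x) / c) = (LINT x|lborel. (\<phi> (x - c *\<^sub>R b) * f x - \<phi> x * f x) / c)"
      by simp
    then show ?thesis by (simp add: right_diff_distrib left_diff_distrib)
  qed
  \<comment> \<open>Without the finitely many steps of size at least 1, all translated supports lie
    in the ball of radius \<open>R + 1\<close>.\<close>
  obtain N where N: "\<And>k. k \<ge> N \<Longrightarrow> h k < 1"
    using order_tendstoD(2)[OF h(2), of 1] by (auto simp: eventually_sequentially)
  obtain R where R: "R > 0" "\<And>x. norm x > R \<Longrightarrow> \<phi> x = 0" using test_bounded_support[OF t] by auto
  obtain M where M: "M > 0" "\<And>x. \<bar>partial b \<phi> x\<bar> \<le> M" using test_bounded[OF test_partial[OF t b]] by auto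
  have d: "\<phi> differentiable (at y)" for y using t by (intro smooth_differentiable test_smooth)
  have "(\<lambda>k. LINT x|lborel. ((\<phi> (x - h (k + N) *\<^sub>R b) - \<phi> x) / h (k + N)) * f x) \<longlonglongrightarrow> (LINT x|lborel. - partial b \<phi> x * f x)"
  proof (rule integral_dominated_convergence[where w = "\<lambda>x. M * \<bar>indicator (cball 0 (R + 1)) x * f x\<bar>"])
    show "integrable lborel (\<lambda>x. M * \<bar>indicator (cball 0 (R + 1)) x * f x\<bar>)"
      by (intro integrable_mult_right integrable_abs sqint_locally_integrable f)
    show "AE x in lborel. (\<lambda>k. (\<phi> (x - h (k + N) *\<^sub>R b) - \<phi> x) / h (k + N) * f x) \<longlonglongrightarrow> - partial b \<phi> x * f x"
    proof (intro AE_I2 tendsto_mult tendsto_const)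
      fix x
      have "((\<lambda>s. \<phi> (x + s *\<^sub>R b)) has_real_derivative partial b \<phi> x) (at 0)"
        using partial_line[OF d, where x = x and s = 0 and b = b] by simp
      then have "((\<lambda>s. (\<phi> (x + s *\<^sub>R b) - \<phi> x) / s) \<longlongrightarrow> partial b \<phi> x) (at 0)"
        by (simp add: has_field_derivative_iff)
      moreover have "filterlim (\<lambda>k. - h (k + N)) (at 0) sequentially"
        unfolding filterlim_at
        using tendsto_minus[OF LIMSEQ_ignore_initial_segment[OF h(2), of N]] h(1) by (auto intro!: always_eventually simp: less_imp_neq[symmetric])
      ultimately have "(\<lambda>k. (\<phi> (x + (- h (k + N)) *\<^sub>R b) - \<phi> x) / (- h (k + N))) \<longlonglongrightarrow> partial b \<phi> x"
        by (rule filterlim_compose)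
      from tendsto_minus[OF this]
      show "(\<lambda>k. (\<phi> (x - h (k + N) *\<^sub>R b) - \<phi> x) / h (k + N)) \<longlonglongrightarrow> - partial b \<phi> x" by simp
    qed
    show "AE x in lborel. norm ((\<phi> (x - h (k + N) *\<^sub>R b) - \<phi> x) / h (k + N) * f x) \<le> M * \<bar>indicator (cball 0 (R + 1)) x * f x\<bar>" for k
    proof (rule AE_I2)
      fix x
      let ?h = "h (k + N)"
      have h1: "0 < ?h" "?h < 1" using h(1) N by auto
      show "norm ((\<phi> (x - ?h *\<^sub>R b) - \<phi> x) / ?h * f x) \<le> M * \<bar>indicator (cball 0 (R + 1)) x * f x\<bar>"
      proof (cases "norm x > R + 1")
        case True
        have "norm x \<le> norm (x - ?h *\<^sub>R b) + 1"
          using norm_triangle_ineq[of "x - ?h *\<^sub>R b" "?h *\<^sub>R b"] h1 b by simp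
        then show ?thesis using R(2)[of x] R(2)[of "x - ?h *\<^sub>R b"] True by simp
      next
        case False
        have "\<exists>s>- ?h. s < 0 \<and> \<phi> (x + 0 *\<^sub>R b) - \<phi> (x + (- ?h) *\<^sub>R b) = (0 - (- ?h)) * partial b \<phi> (x + s *\<^sub>R b)"
          using h1 by (intro MVT2 partial_line d) auto
        then obtain s where s: "\<phi> x - \<phi> (x - ?h *\<^sub>R b) = ?h * partial b \<phi> (x + s *\<^sub>R b)" by auto
        have "(\<phi> (x - ?h *\<^sub>R b) - \<phi> x) / ?h = - partial b \<phi> (x + s *\<^sub>R b)"
          using s h1 by (simp add: field_simps)
        then have "norm ((\<phi> (x - ?h *\<^sub>R b) - \<phi> x) / ?h * f x) = \<bar>partial b \<phi> (x + s *\<^sub>R b)\<bar> * \<bar>f x\<bar>"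
          by (simp add: abs_mult)
        also have "\<dots> \<le> M * \<bar>f x\<bar>" using M by (intro mult_right_mono) auto
        finally show ?thesis using False by simp
      qed
    qed
  qed measurable
  then have "(\<lambda>k. LINT x|lborel. \<phi> x * ((f (x + h (k + N) *\<^sub>R b) - f x) / h (k + N))) \<longlonglongrightarrow> - (LINT x|lborel. partial b \<phi> x * f x)"
    unfolding eq by simp
  then show ?thesis by (rule LIMSEQ_offset)
qed

text \<open>The derivative is the weak limit of the quotients. It is reached here as a strong limit:
  elements of almost minimal norm in shrinking convex sets attached to the tails of the sequence are
  Cauchy. The bound \<open>c\<close> survives with the same constant, which makes the later identity
  for \<open>gradE\<close> sharp.\<close>

lemma dq_bounded_imp_wpd:
  fixes f :: "'a::euclidean_space \<Rightarrow> real"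
  assumes f: "sqint f" and b: "b \<in> Basis" and h: "\<And>k. h k > 0" "h \<longlonglongrightarrow> 0"
    and c: "\<And>k. dq b (h k) f \<le> ennreal c" and c0: "c \<ge> 0"
  shows "\<exists>g. wpd f b g \<and> (\<integral>\<^sup>+x. ennreal ((g x)\<^sup>2) \<partial>lborel) \<le> ennreal c"
proof -
  note [measurable] = sqint_measurable[OF f]
  define q where "q k x = (f (x + h k *\<^sub>R b) - f x) / h k" for k x
  define T where "T \<phi> = (LINT x|lborel. partial b \<phi> x * f x)" for \<phi>
  define I where "I \<phi> v = (LINT x|lborel. \<phi> x * v x)" for \<phi> v :: "'a \<Rightarrow> real"
  have q: "sqint (q k)" for k
  proof -
    have "sqint (\<lambda>x. (1 / h k) * (f (x + h k *\<^sub>R b) - f x))"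
      by (intro sqint_cmult sqint_diff sqint_translate f)
    then show ?thesis by (simp add: q_def[abs_def])
  qed
  \<comment> \<open>A substitute for the closed convex hull of the tail \<open>q k\<close>,
    \<open>k \<ge> n\<close>: whatever bounds the pairing error of all these quotients also bounds
    that of \<open>v\<close>. The set contains \<open>q n\<close>, shrinks with \<open>n\<close> and
    is closed under midpoints, and the errors of its members tend to 0 as \<open>n\<close>
    grows.\<close>
  define C where "C n = {v. sqint v \<and> (LINT x|lborel. (v x)\<^sup>2) \<le> c \<and>
    (\<forall>\<phi>\<in>test_functions. \<forall>B. (\<forall>k\<ge>n. \<bar>I \<phi> (q k) + T \<phi>\<bar> \<le> B) \<longrightarrow> \<bar>I \<phi> v + T \<phi>\<bar> \<le> B)}" for n
  have Cs: "sqint v" if "v \<in> C n" for v n using that by (simp add: C_def)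
  have avg: "sqint (\<lambda>x. (v x + w x) / 2)" "sqint (\<lambda>x. (v x - w x) / 2)" if "sqint v" "sqint w" for v w :: "'a \<Rightarrow> real"
    using sqint_cmult[OF sqint_add[OF that], of "1/2"] sqint_cmult[OF sqint_diff[OF that], of "1/2"] by auto
  \<comment> \<open>The parallelogram law, which makes the squared norm uniformly midpoint
    convex.\<close>
  have par: "(LINT x|lborel. ((v x + w x) / 2)\<^sup>2) = ((LINT x|lborel. (v x)\<^sup>2) + (LINT x|lborel. (w x)\<^sup>2)) / 2 - (LINT x|lborel. ((v x - w x) / 2)\<^sup>2)"
    if vw: "sqint v" "sqint w" for v w :: "'a \<Rightarrow> real"
  proof -
    have "(LINT x|lborel. ((v x + w x) / 2)\<^sup>2) + (LINT x|lborel. ((v x - w x) / 2)\<^sup>2) = (LINT x|lborel. ((v x + w x) / 2)\<^sup>2 + ((v x - w x) / 2)\<^sup>2)"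
      using avg[OF vw] by (simp add: sqint_def)
    also have "\<dots> = (LINT x|lborel. (v x)\<^sup>2 / 2 + (w x)\<^sup>2 / 2)"
      by (rule Bochner_Integration.integral_cong) (simp_all add: power2_eq_square field_simps)
    also have "\<dots> = ((LINT x|lborel. (v x)\<^sup>2) + (LINT x|lborel. (w x)\<^sup>2)) / 2"
      using vw by (simp add: sqint_def)
    finally show ?thesis by linarith
  qed
  have "\<exists>x. (\<forall>n. x n \<in> C n) \<and> (\<forall>n m. n \<le> m \<longrightarrow> (\<integral>\<^sup>+y. ennreal (((x n y - x m y) / 2)\<^sup>2) \<partial>lborel) \<le> ennreal ((1/4)^n))"
  proof (rule nested_near_minimizers[where J = "\<lambda>v. LINT x|lborel. (v x)\<^sup>2" and B = c and mid = "\<lambda>v w x. (v x + w x) / 2"])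
    show "C n \<noteq> {}" for n
    proof -
      have "(\<integral>\<^sup>+x. ennreal ((q n x)\<^sup>2) \<partial>lborel) \<le> ennreal c"
        using c[of n] by (simp add: dq_def q_def)
      then have "ennreal (LINT x|lborel. (q n x)\<^sup>2) \<le> ennreal c"
        unfolding sqint_nn_integral[OF q] .
      then have "q n \<in> C n" using q c0 by (simp add: C_def)
      then show ?thesis by blast
    qed
    show "C m \<subseteq> C n" if "n \<le> m" for n m
      using that by (auto simp: C_def)
    show "0 \<le> (LINT x|lborel. (v x)\<^sup>2) \<and> (LINT x|lborel. (v x)\<^sup>2) \<le> c" if "v \<in> C n" for n v
      using that by (simp add: C_def)
    show "(\<lambda>x. (v x + w x) / 2) \<in> C n" if vw: "v \<in> C n" "w \<in> C n" for n v w
    proof -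
      note s = Cs[OF vw(1)] Cs[OF vw(2)]
      have "(LINT x|lborel. ((v x + w x) / 2)\<^sup>2) \<le> ((LINT x|lborel. (v x)\<^sup>2) + (LINT x|lborel. (w x)\<^sup>2)) / 2"
        unfolding par[OF s] diff_le_eq le_add_same_cancel1 by (rule Bochner_Integration.integral_nonneg) simp
      also have "\<dots> \<le> c" using vw by (simp add: C_def)
      finally have 1: "(LINT x|lborel. ((v x + w x) / 2)\<^sup>2) \<le> c" .
      have "\<bar>I \<phi> (\<lambda>x. (v x + w x) / 2) + T \<phi>\<bar> \<le> B" if t: "\<phi> \<in> test_functions" and B: "\<forall>k\<ge>n. \<bar>I \<phi> (q k) + T \<phi>\<bar> \<le> B" for \<phi> B
      proof -
        have "I \<phi> (\<lambda>x. (v x + w x) / 2) = (I \<phi> v + I \<phi> w) / 2"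
          unfolding I_def using sqint_mult_integrable[OF test_sqint[OF t] s(1)] sqint_mult_integrable[OF test_sqint[OF t] s(2)]
          by (simp add: distrib_left add_divide_distrib)
        moreover have "\<bar>I \<phi> v + T \<phi>\<bar> \<le> B" "\<bar>I \<phi> w + T \<phi>\<bar> \<le> B"
          using vw t B by (auto simp: C_def)
        ultimately show ?thesis by (simp add: abs_le_iff field_simps)
      qed
      then show ?thesis using 1 avg[OF s] by (auto simp: C_def)
    qed
    show "(\<integral>\<^sup>+y. ennreal (((v y - w y) / 2)\<^sup>2) \<partial>lborel) \<le> ennreal (((LINT x|lborel. (v x)\<^sup>2) + (LINT x|lborel. (w x)\<^sup>2)) / 2 - (LINT x|lborel. ((v x + w x) / 2)\<^sup>2))"
      if vw: "v \<in> C n" "w \<in> C n" for n v w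
      using sqint_nn_integral[OF avg(2)[OF Cs[OF vw(1)] Cs[OF vw(2)]]] par[OF Cs[OF vw(1)] Cs[OF vw(2)]] by simp
  qed
  then obtain x where x: "\<And>n. x n \<in> C n"
    and xd: "\<And>n m. n \<le> m \<Longrightarrow> (\<integral>\<^sup>+y. ennreal (((x n y - x m y) / 2)\<^sup>2) \<partial>lborel) \<le> ennreal ((1/4)^n)" by blast
  note [measurable] = sqint_measurable[OF Cs[OF x]]
  have "AE y in lborel. convergent (\<lambda>n. x n y / 2)"
  proof (rule fast_Cauchy_AE_convergent)
    show "(\<integral>\<^sup>+y. ennreal ((x (Suc n) y / 2 - x n y / 2)\<^sup>2) \<partial>lborel) \<le> ennreal ((1/4)^n)" for n
      using xd[of n "Suc n"] by (simp add: power2_commute[of "x (Suc n) _ / 2"] diff_divide_distrib)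
  qed simp
  then have conv: "AE y in lborel. (\<lambda>n. x n y) \<longlonglongrightarrow> lim (\<lambda>n. x n y)"
  proof eventually_elim
    case (elim y)
    then obtain l where "(\<lambda>n. x n y / 2) \<longlonglongrightarrow> l" by (auto simp: convergent_def)
    from tendsto_mult_left[OF this, of 2] have "convergent (\<lambda>n. x n y)" by (auto simp: convergent_def)
    then show ?case by (simp add: convergent_LIMSEQ_iff)
  qed
  define g where "g y = lim (\<lambda>n. x n y)" for y
  have [measurable]: "g \<in> borel_measurable borel"
    unfolding g_def[abs_def] by measurable
  have gc: "(\<integral>\<^sup>+y. ennreal ((g y)\<^sup>2) \<partial>lborel) \<le> ennreal c"
  proof (rule fatou_le[where u = "\<lambda>n y. ennreal ((x n y)\<^sup>2)"])
    show "AE y in lborel. (\<lambda>n. ennreal ((x n y)\<^sup>2)) \<longlonglongrightarrow> ennreal ((g y)\<^sup>2)"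
      using conv by eventually_elim (auto intro!: tendsto_intros simp: g_def)
    show "\<forall>\<^sub>F n in sequentially. (\<integral>\<^sup>+y. ennreal ((x n y)\<^sup>2) \<partial>lborel) \<le> ennreal c"
    proof (intro always_eventually allI)
      fix n
      have "(LINT y|lborel. (x n y)\<^sup>2) \<le> c" using x[of n] by (simp add: C_def)
      then show "(\<integral>\<^sup>+y. ennreal ((x n y)\<^sup>2) \<partial>lborel) \<le> ennreal c"
        unfolding sqint_nn_integral[OF Cs[OF x]] by (rule ennreal_leI)
    qed
  qed simp
  then have sg: "sqint g" by (simp add: sqint_iff le_less_trans[OF gc])
  have gd: "(LINT y|lborel. (x n y - g y)\<^sup>2) \<le> 4 * (1/4)^n" for n
  proof -
    have "(\<integral>\<^sup>+y. ennreal (((x n y - g y) / 2)\<^sup>2) \<partial>lborel) \<le> ennreal ((1/4)^n)"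
    proof (rule fatou_le[where u = "\<lambda>m y. ennreal (((x n y - x m y) / 2)\<^sup>2)"])
      show "AE y in lborel. (\<lambda>m. ennreal (((x n y - x m y) / 2)\<^sup>2)) \<longlonglongrightarrow> ennreal (((x n y - g y) / 2)\<^sup>2)"
        using conv by eventually_elim (auto intro!: tendsto_intros simp: g_def)
      show "\<forall>\<^sub>F m in sequentially. (\<integral>\<^sup>+y. ennreal (((x n y - x m y) / 2)\<^sup>2) \<partial>lborel) \<le> ennreal ((1/4)^n)"
        by (rule eventually_mono[OF eventually_ge_at_top[of n]]) (rule xd)
    qed simp
    then have "(LINT y|lborel. ((x n y - g y) / 2)\<^sup>2) \<le> (1/4)^n"
      by (subst (asm) sqint_nn_integral[OF avg(2)[OF Cs[OF x] sg]]) simp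
    then show ?thesis by (simp add: power_divide)
  qed
  have "wpd f b g"
    unfolding wpd_def
  proof (intro conjI ballI f sg)
    fix \<phi> :: "'a \<Rightarrow> real" assume t: "\<phi> \<in> test_functions"
    note ts = test_sqint[OF t]
    have l1: "(\<lambda>n. I \<phi> (x n)) \<longlonglongrightarrow> - T \<phi>"
    proof (rule LIMSEQ_I)
      fix r :: real assume r: "r > 0"
      have "(\<lambda>k. I \<phi> (q k)) \<longlonglongrightarrow> - T \<phi>"
        unfolding I_def T_def q_def by (rule test_difference_quotient_tendsto[OF f b h t])
      from LIMSEQ_D[OF this, of "r / 2"] r obtain N where N: "\<And>k. k \<ge> N \<Longrightarrow> \<bar>I \<phi> (q k) + T \<phi>\<bar> < r / 2" by auto
      have "\<bar>I \<phi> (x n) + T \<phi>\<bar> \<le> r / 2" if "n \<ge> N" for n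
      proof -
        have "\<forall>k\<ge>n. \<bar>I \<phi> (q k) + T \<phi>\<bar> \<le> r / 2" using N that by (meson less_imp_le order_trans)
        moreover have "\<forall>\<phi>\<in>test_functions. \<forall>B. (\<forall>k\<ge>n. \<bar>I \<phi> (q k) + T \<phi>\<bar> \<le> B) \<longrightarrow> \<bar>I \<phi> (x n) + T \<phi>\<bar> \<le> B"
          using x[of n] by (simp add: C_def)
        ultimately show ?thesis using t by blast
      qed
      then show "\<exists>N. \<forall>n\<ge>N. norm (I \<phi> (x n) - - T \<phi>) < r"
        using r by (intro exI[of _ N]) fastforce
    qed
    have "(\<lambda>n. I \<phi> (x n) - I \<phi> g) \<longlonglongrightarrow> 0"
    proof (rule Lim_null_comparison)
      show "\<forall>\<^sub>F n in sequentially. norm (I \<phi> (x n) - I \<phi> g) \<le> (1/2)^n * ((LINT y|lborel. (\<phi> y)\<^sup>2) + 4)"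
      proof (intro always_eventually allI)
        fix n
        note sd = sqint_diff[OF Cs[OF x] sg, of n]
        have "I \<phi> (x n) - I \<phi> g = (LINT y|lborel. \<phi> y * (x n y - g y))"
          unfolding I_def using sqint_mult_integrable[OF ts Cs[OF x, of n]] sqint_mult_integrable[OF ts sg]
          by (simp add: right_diff_distrib)
        also have "norm \<dots> \<le> (LINT y|lborel. norm (\<phi> y * (x n y - g y)))" by (rule integral_norm_bound)
        \<comment> \<open>A weighted arithmetic-geometric mean. As the squared distance of
          \<open>x n\<close> from \<open>g\<close> is at most \<open>4 * (1/4)^n\<close>, the
          weights \<open>(1/2)^n\<close> and \<open>2^n\<close> make both terms of order
          \<open>(1/2)^n\<close>.\<close>
        also have "\<dots> \<le> (LINT y|lborel. (1/2)^n * (\<phi> y)\<^sup>2 + 2^n * (x n y - g y)\<^sup>2)"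
        proof (rule integral_mono)
          show "integrable lborel (\<lambda>y. norm (\<phi> y * (x n y - g y)))"
            by (intro integrable_norm sqint_mult_integrable ts sd)
          show "integrable lborel (\<lambda>y. (1/2)^n * (\<phi> y)\<^sup>2 + 2^n * (x n y - g y)\<^sup>2)"
            using ts sd by (simp add: sqint_def)
          fix y
          have *: "\<bar>u * v\<bar> \<le> a\<^sup>2 * u\<^sup>2 + (1/a)\<^sup>2 * v\<^sup>2" if "a > 0" for u v a :: real
          proof -
            have "2 * (a * \<bar>u\<bar>) * ((1/a) * \<bar>v\<bar>) = 2 * (\<bar>u\<bar> * \<bar>v\<bar>)" using that by simp
            with sum_squares_bound[of "a * \<bar>u\<bar>" "(1/a) * \<bar>v\<bar>"]
            have "2 * (\<bar>u\<bar> * \<bar>v\<bar>) \<le> a\<^sup>2 * u\<^sup>2 + (1/a)\<^sup>2 * v\<^sup>2"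
              by (simp only: power_mult_distrib power2_abs)
            then show ?thesis using mult_nonneg_nonneg[of "\<bar>u\<bar>" "\<bar>v\<bar>"] unfolding abs_mult by linarith
          qed
          show "norm (\<phi> y * (x n y - g y)) \<le> (1/2)^n * (\<phi> y)\<^sup>2 + 2^n * (x n y - g y)\<^sup>2"
            using *[of "sqrt ((1/2)^n)" "\<phi> y" "x n y - g y"] by (simp add: power_divide power_one_over)
        qed
        also have "\<dots> = (1/2)^n * (LINT y|lborel. (\<phi> y)\<^sup>2) + 2^n * (LINT y|lborel. (x n y - g y)\<^sup>2)"
          using ts sd by (simp add: sqint_def)
        also have "\<dots> \<le> (1/2)^n * (LINT y|lborel. (\<phi> y)\<^sup>2) + 2^n * (4 * (1/4)^n)"
          by (intro add_left_mono mult_left_mono gd) simp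
        also have "2^n * (4 * (1/4)^n) = 4 * (1/2::real)^n"
          by (simp add: mult.left_commute flip: power_mult_distrib)
        finally show "norm (I \<phi> (x n) - I \<phi> g) \<le> (1/2)^n * ((LINT y|lborel. (\<phi> y)\<^sup>2) + 4)"
          by (simp add: algebra_simps)
      qed
      show "(\<lambda>n. (1/2)^n * ((LINT y|lborel. (\<phi> y)\<^sup>2) + 4)) \<longlonglongrightarrow> 0"
        by (intro tendsto_mult_left_zero LIMSEQ_power_zero) simp
    qed
    then have "(\<lambda>n. I \<phi> (x n)) \<longlonglongrightarrow> I \<phi> g" by (simp add: LIM_zero_iff)
    from LIMSEQ_unique[OF this l1] show "(LINT x|lborel. partial b \<phi> x * f x) = - (LINT x|lborel. \<phi> x * g x)"
      by (simp add: I_def T_def)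
  qed
  with gc show ?thesis by blast
qed

subsection \<open>The Riesz kernel\<close>

lemma cball_borel [measurable]: "cball a r \<in> sets borel"
  by (simp add: borel_closed)

lemma riesz_potential_eq:
  "\<exists>c>0. \<forall>x::'a::euclidean_space. riesz_potential \<alpha> x = c / norm x powr (real DIM('a) - \<alpha>)"
  if "0 < \<alpha>" "\<alpha> < real DIM('a)"
proof (intro exI conjI allI)
  let ?c = "Gamma ((real DIM('a) - \<alpha>) / 2) / (Gamma (\<alpha> / 2) * pi powr (real DIM('a) / 2) * 2 powr \<alpha>)"
  show "?c > 0" using that by (auto intro!: divide_pos_pos mult_pos_pos Gamma_real_pos)
  show "riesz_potential \<alpha> x = ?c / norm x powr (real DIM('a) - \<alpha>)" for x :: 'a
    by (simp add: riesz_potential_def)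
qed

lemma riesz_potential_minus: "riesz_potential \<alpha> (x - y) = riesz_potential \<alpha> (y - x)"
  by (simp add: riesz_potential_def norm_minus_commute)

lemma riesz_potential_measurable [measurable]: "riesz_potential \<alpha> \<in> borel_measurable borel"
  unfolding riesz_potential_def[abs_def] by measurable

lemma ennreal_le_suminf: "f k \<le> (\<Sum>n. f n :: ennreal)"
  using sum_le_suminf[of f "{k}"] by simp

text \<open>Dyadic shells, each enlarged to the ball of radius \<open>2^(-k)\<close>: the
  \<open>k\<close>-th contributes a constant times \<open>2^((s - N) k)\<close>, and the geometric
  series converges since \<open>s < N\<close>.\<close>

lemma nn_integral_norm_powr_ball:
  assumes s: "s < real DIM('a::euclidean_space)" "s > 0"
  shows "(\<integral>\<^sup>+z. indicator (cball (0::'a) 1) z * ennreal (1 / norm z powr s) \<partial>lborel) < \<infinity>"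
proof -
  let ?N = "real DIM('a)"
  define V where "V = unit_ball_vol ?N"
  have V: "V \<ge> 0" by (simp add: V_def)
  define r where "r k = (1/2::real)^k" for k :: nat
  have r: "r k > 0" for k by (simp add: r_def)
  have rk: "r k = 2 powr (- real k)" for k
    by (simp add: r_def power_one_over powr_minus powr_realpow inverse_eq_divide)
  let ?u = "\<lambda>k z. indicator (cball (0::'a) (r k)) z * ennreal (1 / r (Suc k) powr s)"
  have "indicator (cball (0::'a) 1) z * ennreal (1 / norm z powr s) \<le> (\<Sum>k. ?u k z)" for z
  proof (cases "0 < norm z \<and> norm z \<le> 1")
    case True
    have "\<exists>k. r (Suc k) < norm z \<and> norm z \<le> r k"
    proof -
      have "\<exists>n. r n < norm z" using True real_arch_pow_inv[of "norm z" "1/2"] by (auto simp: r_def)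
      define n where "n = (LEAST n. r n < norm z)"
      have n: "r n < norm z" unfolding n_def using \<open>\<exists>n. r n < norm z\<close> by (rule LeastI_ex)
      have "n \<noteq> 0"
      proof
        assume "n = 0"
        then show False using n True by (simp add: r_def)
      qed
      then obtain k where k: "n = Suc k" by (cases n) auto
      have "\<not> r k < norm z" using not_less_Least[of k "\<lambda>n. r n < norm z"] k by (simp add: n_def)
      then show ?thesis using n k by auto
    qed
    then obtain k where k: "r (Suc k) < norm z" "norm z \<le> r k" by blast
    have "r (Suc k) powr s \<le> norm z powr s" using k r s by (intro powr_mono2) (auto intro: less_imp_le)
    moreover have "0 < r (Suc k) powr s" using r[of "Suc k"] by simp
    moreover have "0 < norm z powr s" using True by simp
    ultimately have "1 / norm z powr s \<le> 1 / r (Suc k) powr s" by (intro divide_left_mono) auto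
    then have "indicator (cball (0::'a) 1) z * ennreal (1 / norm z powr s) \<le> ?u k z"
      using True k by (auto intro!: ennreal_leI)
    also have "\<dots> \<le> (\<Sum>k. ?u k z)"
      by (rule ennreal_le_suminf)
    finally show ?thesis .
  next
    case False
    \<comment> \<open>This case includes \<open>z = 0\<close>, where division by zero gives the
      kernel the value 0.\<close>
    then show ?thesis by (auto simp: indicator_def)
  qed
  then have "(\<integral>\<^sup>+z. indicator (cball (0::'a) 1) z * ennreal (1 / norm z powr s) \<partial>lborel) \<le> (\<integral>\<^sup>+z. (\<Sum>k. ?u k z) \<partial>lborel)"
    by (rule nn_integral_mono)
  also have "\<dots> = (\<Sum>k. \<integral>\<^sup>+z. ?u k z \<partial>lborel)" by (rule nn_integral_suminf) measurable
  also have "\<dots> = (\<Sum>k. ennreal (V * 2 powr s * (2 powr (s - ?N))^k))"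
  proof (rule arg_cong[where f = suminf], rule ext)
    fix k
    have "(\<integral>\<^sup>+z. ?u k z \<partial>lborel) = emeasure lborel (cball (0::'a) (r k)) * ennreal (1 / r (Suc k) powr s)"
      by (subst nn_integral_multc) auto
    also have "\<dots> = ennreal (V * r k ^ DIM('a) * (1 / r (Suc k) powr s))"
      unfolding emeasure_cball[OF less_imp_le[OF r]] V_def[symmetric]
      using r[of k] V by (subst ennreal_mult[symmetric]) auto
    also have "r k ^ DIM('a) = 2 powr (- real k * ?N)"
      by (simp add: rk powr_power mult.commute)
    also have "r (Suc k) powr s = 2 powr (- real (Suc k) * s)"
      by (simp only: rk powr_powr)
    also have "V * 2 powr (- real k * ?N) * (1 / 2 powr (- real (Suc k) * s)) = V * 2 powr s * (2 powr (s - ?N))^k"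
    proof -
      have 1: "(2 powr (s - ?N))^k = 2 powr ((s - ?N) * real k)"
        by (simp add: powr_power mult.commute)
      have 2: "1 / 2 powr (- real (Suc k) * s) = 2 powr (real (Suc k) * s)"
        by (simp only: mult_minus_left powr_minus_divide div_by_1 divide_divide_eq_right mult_1)
      have 3: "- real k * ?N + real (Suc k) * s = s + (s - ?N) * real k"
        by (simp add: algebra_simps)
      show ?thesis unfolding 1 2 mult.assoc powr_add[symmetric] 3 ..
    qed
    finally show "(\<integral>\<^sup>+z. ?u k z \<partial>lborel) = ennreal (V * 2 powr s * (2 powr (s - ?N))^k)"
      by (simp only: rk powr_powr)
  qed
  also have "\<dots> = ennreal (\<Sum>k. V * 2 powr s * (2 powr (s - ?N))^k)"
  proof (rule suminf_ennreal2)
    have "2 powr (s - ?N) < (2::real) powr 0" using s by (intro powr_less_mono) auto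
    then show "summable (\<lambda>k. V * 2 powr s * (2 powr (s - ?N))^k)"
      by (intro summable_mult summable_geometric) simp
  qed (use V in auto)
  also have "\<dots> < \<infinity>" by simp
  finally show ?thesis .
qed

definition pot :: "real \<Rightarrow> ('a::euclidean_space \<Rightarrow> ennreal) \<Rightarrow> 'a \<Rightarrow> ennreal" where
  "pot \<alpha> \<rho> x = (\<integral>\<^sup>+y. ennreal (riesz_potential \<alpha> (x - y)) * \<rho> y \<partial>lborel)"

text \<open>The mutual Riesz energy of two densities; with both arguments equal to
  \<open>|u|^2\<close> it is the nonlocal term without its prefactor.\<close>

definition dbl :: "real \<Rightarrow> ('a::euclidean_space \<Rightarrow> ennreal) \<Rightarrow> ('a \<Rightarrow> ennreal) \<Rightarrow> ennreal" where
  "dbl \<alpha> \<rho> \<sigma> = (\<integral>\<^sup>+x. pot \<alpha> \<rho> x * \<sigma> x \<partial>lborel)"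

lemma pot_measurable [measurable]:
  assumes [measurable]: "\<rho> \<in> borel_measurable borel"
  shows "pot \<alpha> \<rho> \<in> borel_measurable borel"
  unfolding pot_def[abs_def] by measurable

text \<open>Within distance 1 of \<open>x\<close> the singularity is integrable, with a bound that
  translation makes independent of \<open>x\<close>; farther away the kernel is at most
  \<open>c\<close> and the ball has finite volume.\<close>

lemma pot_indicator_bounded:
  assumes \<alpha>: "0 < \<alpha>" "\<alpha> < real DIM('a::euclidean_space)"
  shows "\<exists>C\<ge>0. \<forall>x. pot \<alpha> (indicator (cball (0::'a) R)) x \<le> ennreal C"
proof -
  obtain c where c: "c > 0" "\<And>x::'a. riesz_potential \<alpha> x = c / norm x powr (real DIM('a) - \<alpha>)"
    using riesz_potential_eq[OF \<alpha>] by auto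
  let ?s = "real DIM('a) - \<alpha>"
  have s: "?s > 0" "?s < real DIM('a)" using \<alpha> by auto
  define I where "I = (\<integral>\<^sup>+z. indicator (cball (0::'a) 1) z * ennreal (1 / norm z powr ?s) \<partial>lborel)"
  have I: "I < \<infinity>" unfolding I_def by (rule nn_integral_norm_powr_ball) (use s in auto)
  define B where "B = ennreal c * I + ennreal c * emeasure lborel (cball (0::'a) R)"
  have B: "B < \<infinity>"
    using I emeasure_lborel_cball_finite[of "0::'a" R] by (auto simp: B_def ennreal_mult_less_top)
  have "pot \<alpha> (indicator (cball (0::'a) R)) x \<le> B" for x
  proof -
    have "ennreal (riesz_potential \<alpha> (x - y)) * indicator (cball (0::'a) R) y \<le>
        ennreal c * (indicator (cball (0::'a) 1) (y + (- x)) * ennreal (1 / norm (y + (- x)) powr ?s)) + ennreal c * indicator (cball (0::'a) R) y" for y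
    proof (cases "norm (y - x) \<le> 1")
      case True
      have e: "ennreal (riesz_potential \<alpha> (x - y)) = ennreal c * ennreal (1 / norm (y + (- x)) powr ?s)"
        using c by (simp add: norm_minus_commute flip: ennreal_mult)
      show ?thesis unfolding e using True by (cases "y \<in> cball 0 R") simp_all
    next
      case False
      have "1 powr ?s \<le> norm (x - y) powr ?s"
        using False s by (intro powr_mono2) (auto simp: norm_minus_commute)
      then have "riesz_potential \<alpha> (x - y) \<le> c" using c by (simp add: divide_le_eq)
      then show ?thesis using False by (auto simp: indicator_def intro!: ennreal_leI)
    qed
    then have "pot \<alpha> (indicator (cball (0::'a) R)) x \<le> (\<integral>\<^sup>+y. ennreal c * (indicator (cball (0::'a) 1) (y + (- x)) * ennreal (1 / norm (y + (- x)) powr ?s)) + ennreal c * indicator (cball (0::'a) R) y \<partial>lborel)"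
      unfolding pot_def by (rule nn_integral_mono)
    also have "\<dots> = ennreal c * (\<integral>\<^sup>+y. indicator (cball (0::'a) 1) (y + (- x)) * ennreal (1 / norm (y + (- x)) powr ?s) \<partial>lborel) + ennreal c * emeasure lborel (cball (0::'a) R)"
      by (subst nn_integral_add) (auto simp: nn_integral_cmult)
    also have "\<dots> = B"
      using nn_integral_lborel_translate[of "\<lambda>z. indicator (cball (0::'a) 1) z * ennreal (1 / norm z powr ?s)" "- x"]
      by (simp add: B_def I_def)
    finally show ?thesis .
  qed
  then show ?thesis using B by (intro exI[of _ "enn2real B"]) auto
qed

lemma dbl_commute:
  assumes [measurable]: "\<rho> \<in> borel_measurable borel" "\<sigma> \<in> borel_measurable borel"
  shows "dbl \<alpha> \<rho> \<sigma> = dbl \<alpha> \<sigma> \<rho>"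
proof -
  have "dbl \<alpha> \<rho> \<sigma> = (\<integral>\<^sup>+x. \<integral>\<^sup>+y. ennreal (riesz_potential \<alpha> (x - y)) * \<rho> y * \<sigma> x \<partial>lborel \<partial>lborel)"
    unfolding dbl_def pot_def by (subst nn_integral_multc) simp_all
  also have "\<dots> = (\<integral>\<^sup>+y. \<integral>\<^sup>+x. ennreal (riesz_potential \<alpha> (x - y)) * \<rho> y * \<sigma> x \<partial>lborel \<partial>lborel)"
    by (rule lborel_pair.Fubini') measurable
  also have "\<dots> = (\<integral>\<^sup>+y. \<integral>\<^sup>+x. ennreal (riesz_potential \<alpha> (y - x)) * \<sigma> x * \<rho> y \<partial>lborel \<partial>lborel)"
  proof (intro nn_integral_cong)
    fix x y :: 'a
    show "ennreal (riesz_potential \<alpha> (y - x)) * \<rho> x * \<sigma> y = ennreal (riesz_potential \<alpha> (x - y)) * \<sigma> y * \<rho> x"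
      unfolding riesz_potential_minus[of \<alpha> x y] by (simp only: mult_ac)
  qed
  also have "\<dots> = dbl \<alpha> \<sigma> \<rho>"
    unfolding dbl_def pot_def by (subst nn_integral_multc) simp_all
  finally show ?thesis .
qed

lemma dbl_add_left:
  assumes [measurable]: "\<rho> \<in> borel_measurable borel" "\<rho>' \<in> borel_measurable borel" "\<sigma> \<in> borel_measurable borel"
  shows "dbl \<alpha> (\<lambda>x. \<rho> x + \<rho>' x) \<sigma> = dbl \<alpha> \<rho> \<sigma> + dbl \<alpha> \<rho>' \<sigma>"
  unfolding dbl_def pot_def by (simp add: distrib_left distrib_right nn_integral_add)

lemma dbl_add_right:
  assumes [measurable]: "\<rho> \<in> borel_measurable borel" "\<sigma> \<in> borel_measurable borel" "\<sigma>' \<in> borel_measurable borel"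
  shows "dbl \<alpha> \<rho> (\<lambda>x. \<sigma> x + \<sigma>' x) = dbl \<alpha> \<rho> \<sigma> + dbl \<alpha> \<rho> \<sigma>'"
  unfolding dbl_def by (simp add: distrib_left nn_integral_add)

lemma dbl_cmult_right:
  assumes [measurable]: "\<rho> \<in> borel_measurable borel" "\<sigma> \<in> borel_measurable borel"
  shows "dbl \<alpha> \<rho> (\<lambda>x. c * \<sigma> x) = c * dbl \<alpha> \<rho> \<sigma>"
  unfolding dbl_def by (simp add: nn_integral_cmult mult.left_commute[of _ c])

lemma dbl_cmult_left:
  assumes [measurable]: "\<rho> \<in> borel_measurable borel" "\<sigma> \<in> borel_measurable borel"
  shows "dbl \<alpha> (\<lambda>x. c * \<rho> x) \<sigma> = c * dbl \<alpha> \<rho> \<sigma>"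
  unfolding dbl_def pot_def by (simp add: nn_integral_cmult mult.left_commute[of _ c] mult.assoc)

section \<open>The Riesz kernel as a superposition of Gaussians\<close>

lemma nn_integral_gauss_1_finite:
  assumes "a > 0"
  shows "(\<integral>\<^sup>+u. ennreal (exp (- (a * u\<^sup>2))) \<partial>lborel) < \<infinity>"
proof -
  define H where "H = (\<integral>\<^sup>+u. ennreal (exp (- (2 * a * u))) * indicator {0..} u \<partial>lborel)"
  have "H = ennreal (0 - - exp (- (2 * a * 0)) / (2 * a))"
    unfolding H_def
  proof (rule nn_integral_FTC_atLeast)
    show "((\<lambda>u. - exp (- (2 * a * u)) / (2 * a)) has_real_derivative exp (- (2 * a * u))) (at u)" for u
      using assms by (auto intro!: derivative_eq_intros)
    have "filterlim (\<lambda>u. (2 * a) * u) at_top at_top"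
      using assms by (intro filterlim_tendsto_pos_mult_at_top[OF tendsto_const _ filterlim_ident]) simp
    then have "((\<lambda>u. exp (- (2 * a * u))) \<longlongrightarrow> 0) at_top"
      unfolding filterlim_uminus_at_top by (rule filterlim_compose[OF exp_at_bot])
    from tendsto_divide[OF tendsto_minus[OF this] tendsto_const, of "2 * a"] assms
    show "((\<lambda>u. - exp (- (2 * a * u)) / (2 * a)) \<longlongrightarrow> 0) at_top" by simp
  qed auto
  then have H: "H < \<infinity>" by simp
  have "(\<integral>\<^sup>+u. ennreal (exp (- (a * u\<^sup>2))) \<partial>lborel) \<le>
      (\<integral>\<^sup>+u. ennreal (exp a) * (ennreal (exp (- (2 * a * u))) * indicator {0..} u) + ennreal (exp a) * (ennreal (exp (- (2 * a * (- u)))) * indicator {0..} (- u)) \<partial>lborel)"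
  proof (rule nn_integral_mono)
    fix u :: real
    \<comment> \<open>The tangent bound \<open>u^2 \<ge> 2 |u| - 1\<close> reduces the Gaussian to
      exponentials on two half-lines.\<close>
    have "a * (2 * \<bar>u\<bar>) \<le> a * (1 + u\<^sup>2)"
      using sum_squares_bound[of 1 "\<bar>u\<bar>"] assms by (intro mult_left_mono) auto
    then have "exp (- (a * u\<^sup>2)) \<le> exp a * exp (- (2 * a * \<bar>u\<bar>))"
      by (simp add: exp_add[symmetric] algebra_simps)
    then have "ennreal (exp (- (a * u\<^sup>2))) \<le> ennreal (exp a) * ennreal (exp (- (2 * a * \<bar>u\<bar>)))"
      by (simp add: ennreal_leI flip: ennreal_mult)
    then show "ennreal (exp (- (a * u\<^sup>2))) \<le> ennreal (exp a) * (ennreal (exp (- (2 * a * u))) * indicator {0..} u) + ennreal (exp a) * (ennreal (exp (- (2 * a * (- u)))) * indicator {0..} (- u))"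
      by (cases "u \<ge> 0") (auto simp: indicator_def add_increasing2)
  qed
  also have "\<dots> = ennreal (exp a) * H + ennreal (exp a) * (\<integral>\<^sup>+u. ennreal (exp (- (2 * a * (- u)))) * indicator {0..} (- u) \<partial>lborel)"
    by (subst nn_integral_add) (simp_all add: nn_integral_cmult H_def)
  also have "(\<integral>\<^sup>+u. ennreal (exp (- (2 * a * (- u)))) * indicator {0..} (- u) \<partial>lborel) = H"
    unfolding H_def using nn_integral_real_affine[of "\<lambda>u. ennreal (exp (- (2 * a * u))) * indicator {0..} u" "-1" 0] by simp
  also have "ennreal (exp a) * H + ennreal (exp a) * H < \<infinity>" using H by (simp add: ennreal_mult_less_top)
  finally show ?thesis .
qed

text \<open>The integral enters below as a normalizing factor that is divided out; finiteness and
  positivity permit this, and its value never has to be computed.\<close>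

lemma nn_integral_gauss:
  assumes "a > 0"
  shows "(\<integral>\<^sup>+z. ennreal (exp (- (a * (norm z)\<^sup>2))) \<partial>(lborel :: 'a::euclidean_space measure)) < \<infinity>"
    and "(\<integral>\<^sup>+z. ennreal (exp (- (a * (norm z)\<^sup>2))) \<partial>(lborel :: 'a measure)) > 0"
proof -
  have "ennreal (exp (- (a * (norm z)\<^sup>2))) = (\<Prod>b\<in>Basis. ennreal (exp (- (a * (z \<bullet> b)\<^sup>2))))" for z :: 'a
  proof -
    have "(norm z)\<^sup>2 = (\<Sum>b\<in>Basis. (z \<bullet> b)\<^sup>2)"
      by (subst power2_norm_eq_inner, subst euclidean_inner) (simp add: power2_eq_square)
    then show ?thesis
      by (simp add: prod_ennreal exp_sum[symmetric] sum_negf sum_distrib_left)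
  qed
  then have "(\<integral>\<^sup>+z. ennreal (exp (- (a * (norm z)\<^sup>2))) \<partial>(lborel :: 'a measure)) = (\<integral>\<^sup>+z. (\<Prod>b\<in>(Basis::'a set). ennreal (exp (- (a * (z \<bullet> b)\<^sup>2)))) \<partial>lborel)"
    by simp
  also have "\<dots> = (\<Prod>b\<in>(Basis::'a set). (\<integral>\<^sup>+u. ennreal (exp (- (a * u\<^sup>2))) \<partial>lborel))"
    by (rule nn_integral_lborel_prod) auto
  also have "\<dots> < \<infinity>" using nn_integral_gauss_1_finite[OF assms] by (simp add: power_less_top_ennreal)
  finally show "(\<integral>\<^sup>+z. ennreal (exp (- (a * (norm z)\<^sup>2))) \<partial>(lborel :: 'a measure)) < \<infinity>" .
  have "\<not> (AE z::'a in lborel. ennreal (exp (- (a * (norm z)\<^sup>2))) = 0)"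
  proof
    assume "AE z::'a in lborel. ennreal (exp (- (a * (norm z)\<^sup>2))) = 0"
    then have "AE z::'a in lborel. False" by (auto simp: ennreal_eq_0_iff)
    then show False by (simp add: eventually_False ae_filter_eq_bot_iff)
  qed
  then show "(\<integral>\<^sup>+z. ennreal (exp (- (a * (norm z)\<^sup>2))) \<partial>(lborel :: 'a measure)) > 0"
    by (simp add: nn_integral_0_iff_AE zero_less_iff_neq_zero)
qed

text \<open>The Gamma integral rescaled by \<open>a\<close>. With \<open>a\<close> a multiple of a
  squared distance it expresses a power of the distance through Gaussians.\<close>

lemma nn_integral_powr_exp:
  assumes "p > 0" "a > 0"
  shows "(\<integral>\<^sup>+t. ennreal (indicator {0..} t * t powr (p - 1) * exp (- (a * t))) \<partial>lborel) = ennreal (Gamma p * a powr (- p))"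
proof -
  have "ennreal (Gamma p) = (\<integral>\<^sup>+t. ennreal (indicator {0..} t * t powr (p - 1) / exp t) \<partial>lborel)"
    by (rule Gamma_conv_nn_integral_real[OF assms(1)])
  also have "\<dots> = ennreal \<bar>a\<bar> * (\<integral>\<^sup>+t. ennreal (indicator {0..} (0 + a * t) * (0 + a * t) powr (p - 1) / exp (0 + a * t)) \<partial>lborel)"
    by (rule nn_integral_real_affine) (use assms in auto)
  also have "\<dots> = ennreal a * (\<integral>\<^sup>+t. ennreal (a powr (p - 1)) * ennreal (indicator {0..} t * t powr (p - 1) * exp (- (a * t))) \<partial>lborel)"
    using assms
    by (auto intro!: arg_cong2[where f = "(*)"] nn_integral_cong simp: indicator_def zero_le_mult_iff powr_mult exp_minus field_simps simp flip: ennreal_mult)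
  also have "\<dots> = ennreal (a powr p) * (\<integral>\<^sup>+t. ennreal (indicator {0..} t * t powr (p - 1) * exp (- (a * t))) \<partial>lborel)"
    using assms by (subst nn_integral_cmult) (auto simp: mult.assoc[symmetric] powr_mult_base simp flip: ennreal_mult)
  finally have "ennreal (a powr (- p)) * ennreal (Gamma p) = ennreal (a powr (- p)) * ennreal (a powr p) * (\<integral>\<^sup>+t. ennreal (indicator {0..} t * t powr (p - 1) * exp (- (a * t))) \<partial>lborel)"
    by (simp add: mult.assoc)
  moreover have "ennreal (a powr (- p)) * ennreal (a powr p) = 1"
    using assms by (simp add: powr_minus flip: ennreal_mult)
  ultimately show ?thesis using assms Gamma_real_pos[OF assms(1)]
    by (simp add: ennreal_mult[symmetric] mult.commute)
qed

text \<open>The Riesz kernel is a superposition of convolutions of Gaussians with themselves, so the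
  double integral is one of a product; this makes it a positive semidefinite form.\<close>

lemma dbl_eq_nn_integral_prod:
  assumes \<alpha>: "0 < \<alpha>" "\<alpha> < real DIM('a::euclidean_space)"
  shows "\<exists>(w :: real \<times> 'a \<Rightarrow> ennreal) (A :: ('a \<Rightarrow> ennreal) \<Rightarrow> real \<times> 'a \<Rightarrow> ennreal).
    w \<in> borel_measurable borel \<and> (\<forall>\<rho>\<in>borel_measurable borel. A \<rho> \<in> borel_measurable borel) \<and>
    (\<forall>\<rho>\<in>borel_measurable borel. \<forall>\<sigma>\<in>borel_measurable borel. dbl \<alpha> \<rho> \<sigma> = (\<integral>\<^sup>+q. w q * (A \<rho> q * A \<sigma> q) \<partial>lborel))"
proof -
  obtain c where c: "c > 0" "\<And>x::'a. riesz_potential \<alpha> x = c / norm x powr (real DIM('a) - \<alpha>)"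
    using riesz_potential_eq[OF \<alpha>] by auto
  \<comment> \<open>The kernel is the power \<open>- p\<close> of the squared distance, the variable
    in which Gaussians are exponentials.\<close>
  define p where "p = (real DIM('a) - \<alpha>) / 2"
  have p: "p > 0" using \<alpha> by (simp add: p_def)
  \<comment> \<open>\<open>Gamma p\<close> comes from the integral over \<open>t\<close>, and
    \<open>2 powr p\<close> from the exponent rate \<open>|x - y|^2 / 2\<close> of a product of two
    Gaussians.\<close>
  define C1 where "C1 = c / (Gamma p * 2 powr p)"
  have C1: "C1 > 0" using c p by (simp add: C1_def Gamma_real_pos)
  define c2 where "c2 t = (\<integral>\<^sup>+z. ennreal (exp (- (2 * t * (norm z)\<^sup>2))) \<partial>(lborel :: 'a measure))" for t
  have [measurable]: "c2 \<in> borel_measurable borel" unfolding c2_def[abs_def] by measurable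
  have c2: "inverse (c2 t) * c2 t = 1" if "t > 0" for t
  proof -
    have "0 < c2 t" "c2 t < \<infinity>"
      unfolding c2_def using nn_integral_gauss[of "2 * t", where 'a = 'a] that by simp_all
    then show ?thesis by (cases "c2 t") (auto simp: inverse_ennreal simp flip: ennreal_mult)
  qed
  define w :: "real \<times> 'a \<Rightarrow> ennreal" where
    "w q = ennreal C1 * (ennreal (indicator {0<..} (fst q) * fst q powr (p - 1)) * inverse (c2 (fst q)))" for q
  define e :: "'a \<Rightarrow> real \<times> 'a \<Rightarrow> ennreal" where "e x q = ennreal (exp (- (fst q * (norm (x - snd q))\<^sup>2)))" for x q
  define A :: "('a \<Rightarrow> ennreal) \<Rightarrow> real \<times> 'a \<Rightarrow> ennreal" where "A \<rho> q = (\<integral>\<^sup>+y. e y q * \<rho> y \<partial>lborel)" for \<rho> q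
  have [measurable]: "w \<in> borel_measurable borel"
    unfolding w_def[abs_def] borel_prod[symmetric] by measurable
  have [measurable]: "(\<lambda>(x, q). e x q) \<in> borel_measurable (borel \<Otimes>\<^sub>M borel)"
    unfolding e_def borel_prod[symmetric] by measurable
  have A [measurable]: "A \<rho> \<in> borel_measurable borel" if [measurable]: "\<rho> \<in> borel_measurable borel" for \<rho>
    unfolding A_def[abs_def] by measurable
  have K: "ennreal (riesz_potential \<alpha> (x - y)) = (\<integral>\<^sup>+q. w q * (e x q * e y q) \<partial>lborel)" if xy: "x \<noteq> y" for x y
  proof -
    let ?a = "(norm (x - y))\<^sup>2 / 2"
    have inner: "(\<integral>\<^sup>+z. e x (t, z) * e y (t, z) \<partial>lborel) = ennreal (exp (- (?a * t))) * c2 t" for t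
    proof -
      \<comment> \<open>The square is completed about the midpoint of \<open>x\<close> and
        \<open>y\<close>, so the product of the two Gaussians becomes one in \<open>x - y\<close>
        times one in the translated variable \<open>z\<close>.\<close>
      have id: "(norm (x - z))\<^sup>2 + (norm (y - z))\<^sup>2 = ?a + 2 * (norm (z + - ((1/2) *\<^sub>R (x + y))))\<^sup>2" for z
        by (simp add: power2_norm_eq_inner inner_diff_left inner_diff_right inner_add_left inner_add_right inner_commute field_simps)
      have "e x (t, z) * e y (t, z) = ennreal (exp (- (?a * t))) * ennreal (exp (- (2 * t * (norm (z + - ((1/2) *\<^sub>R (x + y))))\<^sup>2)))" for z
      proof -
        have "- (t * (norm (x - z))\<^sup>2) + - (t * (norm (y - z))\<^sup>2) = - t * ((norm (x - z))\<^sup>2 + (norm (y - z))\<^sup>2)" by (simp add: algebra_simps)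
        also have "\<dots> = - (?a * t) + - (2 * t * (norm (z + - ((1/2) *\<^sub>R (x + y))))\<^sup>2)" unfolding id by (simp add: algebra_simps)
        finally show ?thesis unfolding e_def by (simp only: ennreal_mult[symmetric] exp_add[symmetric] exp_ge_zero fst_conv snd_conv)
      qed
      then have "(\<integral>\<^sup>+z. e x (t, z) * e y (t, z) \<partial>lborel) = ennreal (exp (- (?a * t))) * (\<integral>\<^sup>+z. ennreal (exp (- (2 * t * (norm (z + - ((1/2) *\<^sub>R (x + y))))\<^sup>2))) \<partial>lborel)"
        by (simp add: nn_integral_cmult)
      also have "(\<integral>\<^sup>+z. ennreal (exp (- (2 * t * (norm (z + - ((1/2) *\<^sub>R (x + y))))\<^sup>2))) \<partial>lborel) = c2 t"
        unfolding c2_def by (rule nn_integral_lborel_translate[of "\<lambda>z. ennreal (exp (- (2 * t * (norm z)\<^sup>2)))"]) simp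
      finally show ?thesis .
    qed
    have "(\<integral>\<^sup>+q. w q * (e x q * e y q) \<partial>lborel) = (\<integral>\<^sup>+t. \<integral>\<^sup>+z. w (t, z) * (e x (t, z) * e y (t, z)) \<partial>lborel \<partial>lborel)"
      unfolding lborel_prod[symmetric] by (rule lborel.nn_integral_fst[symmetric]) (simp add: lborel_prod)
    also have "\<dots> = (\<integral>\<^sup>+t. ennreal C1 * ennreal (indicator {0..} t * t powr (p - 1) * exp (- (?a * t))) \<partial>lborel)"
    proof (rule nn_integral_cong)
      fix t :: real
      let ?k = "ennreal C1 * (ennreal (indicator {0<..} t * t powr (p - 1)) * inverse (c2 t))"
      have "(\<integral>\<^sup>+z. w (t, z) * (e x (t, z) * e y (t, z)) \<partial>lborel) = (\<integral>\<^sup>+z. ?k * (e x (t, z) * e y (t, z)) \<partial>lborel)"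
        by (simp add: w_def)
      also have "\<dots> = ?k * (ennreal (exp (- (?a * t))) * c2 t)"
        by (subst nn_integral_cmult) (simp_all add: inner)
      also have "\<dots> = ennreal C1 * ennreal (indicator {0..} t * t powr (p - 1) * exp (- (?a * t)))"
      proof (cases "t > 0")
        case True
        have "?k * (ennreal (exp (- (?a * t))) * c2 t) = ennreal C1 * (ennreal (t powr (p - 1)) * ennreal (exp (- (?a * t)))) * (inverse (c2 t) * c2 t)"
          using True by (simp add: mult_ac)
        then show ?thesis using True c2[OF True] by (simp add: ennreal_mult)
      next
        case False
        then show ?thesis by (cases "t = 0") auto
      qed
      finally show "(\<integral>\<^sup>+z. w (t, z) * (e x (t, z) * e y (t, z)) \<partial>lborel) = ennreal C1 * ennreal (indicator {0..} t * t powr (p - 1) * exp (- (?a * t)))" .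
    qed
    also have "\<dots> = ennreal C1 * (\<integral>\<^sup>+t. ennreal (indicator {0..} t * t powr (p - 1) * exp (- (?a * t))) \<partial>lborel)"
      by (rule nn_integral_cmult) measurable
    also have "\<dots> = ennreal C1 * ennreal (Gamma p * ?a powr (- p))"
      using xy p by (subst nn_integral_powr_exp) auto
    also have "\<dots> = ennreal (riesz_potential \<alpha> (x - y))"
    proof -
      have "?a powr (- p) = 2 powr p / norm (x - y) powr (real DIM('a) - \<alpha>)"
      proof -
        have "(norm (x - y))\<^sup>2 = norm (x - y) powr 2" using xy by simp
        then have "((norm (x - y))\<^sup>2) powr (- p) = norm (x - y) powr (2 * (- p))" by (simp only: powr_powr)
        also have "2 * (- p) = - (real DIM('a) - \<alpha>)" by (simp add: p_def field_simps)
        finally have "((norm (x - y))\<^sup>2) powr (- p) = 1 / norm (x - y) powr (real DIM('a) - \<alpha>)"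
          by (simp only: powr_minus_divide)
        then show ?thesis by (simp add: powr_divide powr_minus_divide)
      qed
      then have "C1 * (Gamma p * ?a powr (- p)) = riesz_potential \<alpha> (x - y)"
        using Gamma_real_pos[OF p] unfolding c(2) C1_def by simp
      then show ?thesis using C1 p by (simp add: Gamma_real_pos less_imp_le flip: ennreal_mult)
    qed
    finally show ?thesis ..
  qed
  have "dbl \<alpha> \<rho> \<sigma> = (\<integral>\<^sup>+q. w q * (A \<rho> q * A \<sigma> q) \<partial>lborel)"
    if [measurable]: "\<rho> \<in> borel_measurable borel" "\<sigma> \<in> borel_measurable borel" for \<rho> \<sigma>
  proof -
    have "pot \<alpha> \<rho> x = (\<integral>\<^sup>+q. w q * (e x q * A \<rho> q) \<partial>lborel)" for x
    proof -
      \<comment> \<open>On the diagonal the kernel has the default value 0 and \<open>K\<close> does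
        not apply, but a single point is a null set.\<close>
      have "AE y in lborel. y \<noteq> x" by (rule AE_lborel_singleton)
      then have "pot \<alpha> \<rho> x = (\<integral>\<^sup>+y. (\<integral>\<^sup>+q. w q * (e x q * e y q) \<partial>lborel) * \<rho> y \<partial>lborel)"
        unfolding pot_def by (intro nn_integral_cong_AE) (auto simp: K elim!: eventually_mono)
      also have "\<dots> = (\<integral>\<^sup>+y. \<integral>\<^sup>+q. w q * (e x q * e y q) * \<rho> y \<partial>lborel \<partial>lborel)"
        by (subst nn_integral_multc) simp_all
      also have "\<dots> = (\<integral>\<^sup>+q. \<integral>\<^sup>+y. w q * (e x q * e y q) * \<rho> y \<partial>lborel \<partial>lborel)"
        by (rule lborel_pair.Fubini') measurable
      also have "\<dots> = (\<integral>\<^sup>+q. w q * (e x q * A \<rho> q) \<partial>lborel)"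
        unfolding A_def by (simp add: nn_integral_cmult mult.assoc)
      finally show ?thesis .
    qed
    then have "dbl \<alpha> \<rho> \<sigma> = (\<integral>\<^sup>+x. (\<integral>\<^sup>+q. w q * (e x q * A \<rho> q) \<partial>lborel) * \<sigma> x \<partial>lborel)"
      by (simp add: dbl_def)
    also have "\<dots> = (\<integral>\<^sup>+x. \<integral>\<^sup>+q. w q * (e x q * A \<rho> q) * \<sigma> x \<partial>lborel \<partial>lborel)"
      by (subst nn_integral_multc) simp_all
    also have "\<dots> = (\<integral>\<^sup>+q. \<integral>\<^sup>+x. w q * (e x q * A \<rho> q) * \<sigma> x \<partial>lborel \<partial>lborel)"
      by (rule lborel_pair.Fubini') measurable
    also have "\<dots> = (\<integral>\<^sup>+q. \<integral>\<^sup>+x. w q * A \<rho> q * (e x q * \<sigma> x) \<partial>lborel \<partial>lborel)"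
      by (simp add: mult_ac)
    also have "\<dots> = (\<integral>\<^sup>+q. w q * (A \<rho> q * A \<sigma> q) \<partial>lborel)"
      unfolding A_def[of \<sigma>] by (simp add: nn_integral_cmult mult.assoc)
    finally show ?thesis .
  qed
  then show ?thesis by (intro exI[of _ w] exI[of _ A]) simp
qed

text \<open>\<open>2 a b \<le> a^2 + b^2\<close> under the integral of the product representation:
  positive semidefiniteness of the kernel in a form free of subtraction, hence meaningful for
  infinite energies.\<close>

lemma dbl_cross_le:
  assumes \<alpha>: "0 < \<alpha>" "\<alpha> < real DIM('a::euclidean_space)"
    and [measurable]: "\<rho> \<in> borel_measurable borel" "\<sigma> \<in> borel_measurable (borel :: 'a measure)"
  shows "2 * dbl \<alpha> \<rho> \<sigma> \<le> dbl \<alpha> \<rho> \<rho> + dbl \<alpha> \<sigma> \<sigma>"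
proof -
  obtain w A where w [measurable]: "w \<in> borel_measurable borel" and A: "\<And>\<rho>. \<rho> \<in> borel_measurable borel \<Longrightarrow> A \<rho> \<in> borel_measurable borel"
    and d: "\<And>\<rho> \<sigma>. \<rho> \<in> borel_measurable borel \<Longrightarrow> \<sigma> \<in> borel_measurable (borel :: 'a measure) \<Longrightarrow>
      dbl \<alpha> \<rho> \<sigma> = (\<integral>\<^sup>+q. w q * (A \<rho> q * A \<sigma> q) \<partial>(lborel :: (real \<times> 'a) measure))"
    using dbl_eq_nn_integral_prod[OF \<alpha>] by blast
  note [measurable] = A[OF assms(3)] A[OF assms(4)]
  have "2 * dbl \<alpha> \<rho> \<sigma> = (\<integral>\<^sup>+q. w q * (2 * A \<rho> q * A \<sigma> q) \<partial>lborel)"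
    by (simp add: d nn_integral_cmult[symmetric] mult_ac)
  also have "\<dots> \<le> (\<integral>\<^sup>+q. w q * ((A \<rho> q)\<^sup>2 + (A \<sigma> q)\<^sup>2) \<partial>lborel)"
    by (intro nn_integral_mono mult_left_mono sum_of_squares_ge_ennreal) simp
  also have "\<dots> = dbl \<alpha> \<rho> \<rho> + dbl \<alpha> \<sigma> \<sigma>"
    by (simp add: d distrib_left nn_integral_add power2_eq_square)
  finally show ?thesis .
qed

subsection \<open>The energy in terms of difference quotients\<close>

text \<open>Defined for every function without reference to a weak derivative, which suits Fatou's
  lemma and pointwise inequalities. Steps \<open>(1/2)^k\<close> tend to 0, which is enough to
  recover the squared norm of the derivative.\<close>

definition gradE :: "'a::euclidean_space \<Rightarrow> ('a \<Rightarrow> real) \<Rightarrow> ennreal" where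
  "gradE b f = (SUP k. dq b ((1/2)^k) f)"

definition harm :: "('a::euclidean_space \<Rightarrow> real) \<Rightarrow> ennreal" where
  "harm f = (\<integral>\<^sup>+x. ennreal ((norm x)\<^sup>2 * (f x)\<^sup>2) \<partial>lborel)"

definition sq :: "('a \<Rightarrow> real) \<Rightarrow> 'a \<Rightarrow> ennreal" where
  "sq f x = ennreal ((f x)\<^sup>2)"

text \<open>Four times the energy of a real function; the normalization keeps divisions out of the
  \<open>ennreal\<close> computations.\<close>

definition renergy :: "real \<Rightarrow> ('a::euclidean_space \<Rightarrow> real) \<Rightarrow> ennreal" where
  "renergy \<alpha> f = 2 * ((\<Sum>b\<in>Basis. gradE b f) + harm f) + dbl \<alpha> (sq f) (sq f)"

lemma sq_measurable [measurable]: "f \<in> borel_measurable M \<Longrightarrow> sq f \<in> borel_measurable M"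
  unfolding sq_def[abs_def] by measurable

lemma dq_le_gradE_dyadic: "dq b ((1/2)^k) f \<le> gradE b f"
  unfolding gradE_def by (rule SUP_upper) simp

lemma gradE_finite_imp_wpd:
  assumes "sqint f" "b \<in> Basis" "gradE b f < \<infinity>"
  shows "\<exists>g. wpd f b g"
proof -
  have "\<exists>g. wpd f b g \<and> (\<integral>\<^sup>+x. ennreal ((g x)\<^sup>2) \<partial>lborel) \<le> ennreal (enn2real (gradE b f))"
  proof (rule dq_bounded_imp_wpd[OF assms(1,2), where h = "\<lambda>k. (1/2)^k"])
    show "dq b ((1/2)^k) f \<le> ennreal (enn2real (gradE b f))" for k
      using dq_le_gradE_dyadic[of b k f] assms(3) by simp
  qed (auto intro: LIMSEQ_power_zero)
  then show ?thesis by blast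
qed

text \<open>For the lower bound, bounded difference quotients produce some weak derivative whose
  norm obeys the same bound, and uniqueness identifies it with \<open>g\<close>.\<close>

lemma wpd_imp_gradE_eq:
  assumes w: "wpd f b g" and b: "b \<in> Basis"
  shows "gradE b f = (\<integral>\<^sup>+x. ennreal ((g x)\<^sup>2) \<partial>lborel)"
proof (rule antisym)
  note s = wpd_sqint[OF w]
  show le: "gradE b f \<le> (\<integral>\<^sup>+x. ennreal ((g x)\<^sup>2) \<partial>lborel)"
    unfolding gradE_def by (intro SUP_least wpd_imp_dq_le[OF w b]) simp
  have fin: "gradE b f < \<infinity>" using le s(2) by (auto simp: sqint_iff intro: le_less_trans)
  have "\<exists>g'. wpd f b g' \<and> (\<integral>\<^sup>+x. ennreal ((g' x)\<^sup>2) \<partial>lborel) \<le> ennreal (enn2real (gradE b f))"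
  proof (rule dq_bounded_imp_wpd[OF s(1) b, where h = "\<lambda>k. (1/2)^k"])
    show "dq b ((1/2)^k) f \<le> ennreal (enn2real (gradE b f))" for k
      using dq_le_gradE_dyadic[of b k f] fin by simp
  qed (auto intro: LIMSEQ_power_zero)
  then obtain g' where g': "wpd f b g'" "(\<integral>\<^sup>+x. ennreal ((g' x)\<^sup>2) \<partial>lborel) \<le> gradE b f"
    using fin by auto
  have "(\<integral>\<^sup>+x. ennreal ((g x)\<^sup>2) \<partial>lborel) = (\<integral>\<^sup>+x. ennreal ((g' x)\<^sup>2) \<partial>lborel)"
    by (rule nn_integral_cong_AE) (use wpd_unique[OF w g'(1)] in eventually_elim, simp)
  with g'(2) show "(\<integral>\<^sup>+x. ennreal ((g x)\<^sup>2) \<partial>lborel) \<le> gradE b f" by simp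
qed

text \<open>Control on dyadic steps yields a weak derivative, and this in turn controls every
  step.\<close>

lemma dq_le_gradE:
  assumes "sqint f" "b \<in> Basis" "h > 0"
  shows "dq b h f \<le> gradE b f"
proof (cases "gradE b f < \<infinity>")
  case True
  obtain g where "wpd f b g" using gradE_finite_imp_wpd[OF assms(1,2) True] by blast
  then show ?thesis using wpd_imp_dq_le wpd_imp_gradE_eq assms by metis
next
  case False
  then show ?thesis by (simp add: not_less top_unique)
qed

text \<open>Any null sequence of steps determines the gradient energy. The positivity proof needs
  the steps \<open>H / 2^k\<close>, which subdivide a given shift \<open>H\<close> evenly.\<close>

lemma gradE_leI:
  assumes "sqint f" "b \<in> Basis" "\<And>k. h k > 0" "h \<longlonglongrightarrow> 0" "\<And>k. dq b (h k) f \<le> c"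
  shows "gradE b f \<le> c"
proof (cases c)
  case (real r)
  obtain g where "wpd f b g" "(\<integral>\<^sup>+x. ennreal ((g x)\<^sup>2) \<partial>lborel) \<le> ennreal r"
    using dq_bounded_imp_wpd[OF assms(1-4), of r] assms(5) real by auto
  then show ?thesis using wpd_imp_gradE_eq[OF _ assms(2)] real by auto
qed simp

section \<open>Convexity along curves that are affine in the density\<close>

definition mix :: "real \<Rightarrow> ('a \<Rightarrow> real) \<Rightarrow> ('a \<Rightarrow> real) \<Rightarrow> 'a \<Rightarrow> real" where
  "mix t f g x = sqrt ((1 - t) * (f x)\<^sup>2 + t * (g x)\<^sup>2)"

lemma mix_measurable [measurable]:
  assumes [measurable]: "f \<in> borel_measurable M" "g \<in> borel_measurable M"
  shows "mix t f g \<in> borel_measurable M"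
  unfolding mix_def[abs_def] by measurable

lemma mix_nonneg: "0 \<le> mix t f g x" if "0 \<le> t" "t \<le> 1"
  using that by (simp add: mix_def)

lemma mix_sq: "(mix t f g x)\<^sup>2 = (1 - t) * (f x)\<^sup>2 + t * (g x)\<^sup>2" if "0 \<le> t" "t \<le> 1"
  using that by (simp add: mix_def)

lemma sq_mix: "sq (mix t f g) x = ennreal (1 - t) * sq f x + ennreal t * sq g x" if "0 \<le> t" "t \<le> 1"
  using that by (simp add: sq_def mix_sq ennreal_mult ennreal_plus)

text \<open>The deficit in the reverse triangle inequality for the vectors
  \<open>(sqrt p a, sqrt q b)\<close> and \<open>(sqrt p a', sqrt q b')\<close>, computed from Lagrange's identity.\<close>

lemma sqrt_mix_deficit:
  fixes a a' b b' p q :: real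
  assumes "p \<ge> 0" "q \<ge> 0"
  defines "r \<equiv> sqrt (p * a\<^sup>2 + q * b\<^sup>2)" and "r' \<equiv> sqrt (p * a'\<^sup>2 + q * b'\<^sup>2)"
  shows "(r' - r)\<^sup>2 + p * q * (a * b' - a' * b)\<^sup>2 / (r * r') \<le> p * (a' - a)\<^sup>2 + q * (b' - b)\<^sup>2"
proof -
  have r: "r \<ge> 0" "r' \<ge> 0" "r\<^sup>2 = p * a\<^sup>2 + q * b\<^sup>2" "r'\<^sup>2 = p * a'\<^sup>2 + q * b'\<^sup>2"
    using assms(1,2) by (auto simp: r_def r'_def)
  define s where "s = p * a * a' + q * b * b'"
  define c where "c = p * q * (a * b' - a' * b)\<^sup>2"
  have c: "c \<ge> 0" using assms by (simp add: c_def)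
  have L: "(r * r')\<^sup>2 = s\<^sup>2 + c"
    unfolding power_mult_distrib r(3,4) s_def c_def by (simp add: power2_eq_square algebra_simps)
  have rr: "r * r' \<ge> 0" using r by simp
  have sle: "s \<le> r * r'" using L c by (intro power2_le_imp_le[OF _ rr]) linarith
  \<comment> \<open>From \<open>c = (r r' - s) (r r' + s)\<close> and \<open>s \<le> r r'\<close>.
    If \<open>r r' = 0\<close>, the quotient is 0 by convention and the claim reduces to
    \<open>s \<le> 0\<close>.\<close>
  have "c / (r * r') \<le> 2 * (r * r' - s)"
  proof (cases "r * r' = 0")
    case False
    then have pos: "r * r' > 0" using rr by linarith
    have "(r * r' - s) * (r * r' + s) = (r * r')\<^sup>2 - s\<^sup>2" by (simp add: power2_eq_square algebra_simps)
    then have "c = (r * r' - s) * (r * r' + s)" using L by linarith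
    also have "\<dots> \<le> (r * r' - s) * (2 * (r * r'))" using sle by (intro mult_left_mono) auto
    also have "\<dots> = 2 * (r * r' - s) * (r * r')" by (simp only: mult_ac)
    finally show ?thesis using pos by (simp only: pos_divide_le_eq)
  qed (use sle in auto)
  moreover have "p * (a' - a)\<^sup>2 + q * (b' - b)\<^sup>2 = r\<^sup>2 + r'\<^sup>2 - 2 * s"
    unfolding r(3,4) s_def by (simp add: power2_eq_square algebra_simps)
  moreover have "(r' - r)\<^sup>2 = r\<^sup>2 + r'\<^sup>2 - 2 * (r * r')" by (simp add: power2_eq_square algebra_simps)
  moreover have "X \<le> 2 * (Y - s) \<Longrightarrow> P = R + R' - 2 * s \<Longrightarrow> D = R + R' - 2 * Y \<Longrightarrow> D + X \<le> P"
    for X Y P R R' D :: real by simp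
  ultimately have "(r' - r)\<^sup>2 + c / (r * r') \<le> p * (a' - a)\<^sup>2 + q * (b' - b)\<^sup>2" by blast
  then show ?thesis by (simp only: c_def)
qed

text \<open>The deficit is added on the left because differences of \<open>ennreal\<close> values
  are unreliable at infinity. Convexity alone gives existence; positivity of the minimizer rests on
  keeping this extra term.\<close>

lemma mix_dq_deficit:
  assumes [measurable]: "f \<in> borel_measurable borel" "g \<in> borel_measurable borel" and t: "0 \<le> t" "t \<le> 1"
  shows "dq b h (mix t f g) + (\<integral>\<^sup>+x. ennreal ((1 - t) * t *
      ((f x * g (x + h *\<^sub>R b) - f (x + h *\<^sub>R b) * g x)\<^sup>2 / (mix t f g x * mix t f g (x + h *\<^sub>R b))) / h\<^sup>2) \<partial>lborel)
    \<le> ennreal (1 - t) * dq b h f + ennreal t * dq b h g"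
proof -
  let ?d = "\<lambda>x. (1 - t) * t * ((f x * g (x + h *\<^sub>R b) - f (x + h *\<^sub>R b) * g x)\<^sup>2 / (mix t f g x * mix t f g (x + h *\<^sub>R b))) / h\<^sup>2"
  have "dq b h (mix t f g) + (\<integral>\<^sup>+x. ennreal (?d x) \<partial>lborel) = (\<integral>\<^sup>+x. ennreal (((mix t f g (x + h *\<^sub>R b) - mix t f g x) / h)\<^sup>2) + ennreal (?d x) \<partial>lborel)"
    unfolding dq_def by (rule nn_integral_add[symmetric]) measurable
  also have "\<dots> \<le> (\<integral>\<^sup>+x. ennreal (1 - t) * ennreal (((f (x + h *\<^sub>R b) - f x) / h)\<^sup>2) + ennreal t * ennreal (((g (x + h *\<^sub>R b) - g x) / h)\<^sup>2) \<partial>lborel)"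
  proof (rule nn_integral_mono)
    fix x
    have d0: "?d x \<ge> 0" using t mix_nonneg[OF t, of f g] by simp
    have "((mix t f g (x + h *\<^sub>R b) - mix t f g x))\<^sup>2 / h\<^sup>2 + ?d x
      \<le> ((1 - t) * (f (x + h *\<^sub>R b) - f x)\<^sup>2 + t * (g (x + h *\<^sub>R b) - g x)\<^sup>2) / h\<^sup>2"
      unfolding add_divide_distrib[symmetric]
      using sqrt_mix_deficit[where p = "1 - t" and q = t and a = "f x" and b = "g x" and a' = "f (x + h *\<^sub>R b)" and b' = "g (x + h *\<^sub>R b)"] t
      by (intro divide_right_mono) (simp_all only: mix_def times_divide_eq_right diff_ge_0_iff_ge zero_le_power2)
    then have "((mix t f g (x + h *\<^sub>R b) - mix t f g x) / h)\<^sup>2 + ?d x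
      \<le> (1 - t) * ((f (x + h *\<^sub>R b) - f x) / h)\<^sup>2 + t * ((g (x + h *\<^sub>R b) - g x) / h)\<^sup>2"
      by (simp add: power_divide add_divide_distrib)
    then show "ennreal (((mix t f g (x + h *\<^sub>R b) - mix t f g x) / h)\<^sup>2) + ennreal (?d x) \<le>
      ennreal (1 - t) * ennreal (((f (x + h *\<^sub>R b) - f x) / h)\<^sup>2) + ennreal t * ennreal (((g (x + h *\<^sub>R b) - g x) / h)\<^sup>2)"
      using t d0 by (simp add: ennreal_mult[symmetric] ennreal_plus[symmetric] ennreal_leI del: ennreal_plus)
  qed
  also have "\<dots> = ennreal (1 - t) * dq b h f + ennreal t * dq b h g"
    unfolding dq_def by (simp add: nn_integral_add nn_integral_cmult)
  finally show ?thesis .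
qed

lemma dq_mix_le:
  assumes "f \<in> borel_measurable borel" "g \<in> borel_measurable borel" "0 \<le> t" "t \<le> 1"
  shows "dq b h (mix t f g) \<le> ennreal (1 - t) * dq b h f + ennreal t * dq b h g"
  by (rule order_trans[OF _ mix_dq_deficit[OF assms, of b h]]) simp

lemma gradE_mix_le:
  assumes "f \<in> borel_measurable borel" "g \<in> borel_measurable borel" "0 \<le> t" "t \<le> 1"
  shows "gradE b (mix t f g) \<le> ennreal (1 - t) * gradE b f + ennreal t * gradE b g"
  unfolding gradE_def[of b "mix t f g"]
  by (intro SUP_least order_trans[OF dq_mix_le[OF assms]] add_mono mult_left_mono dq_le_gradE_dyadic) auto

lemma harm_mix:
  assumes [measurable]: "f \<in> borel_measurable borel" "g \<in> borel_measurable borel" and t: "0 \<le> t" "t \<le> 1"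
  shows "harm (mix t f g) = ennreal (1 - t) * harm f + ennreal t * harm g"
proof -
  have "harm (mix t f g) = (\<integral>\<^sup>+x. ennreal (1 - t) * ennreal ((norm x)\<^sup>2 * (f x)\<^sup>2) + ennreal t * ennreal ((norm x)\<^sup>2 * (g x)\<^sup>2) \<partial>lborel)"
    unfolding harm_def
  proof (rule nn_integral_cong)
    fix x :: 'a
    have "(norm x)\<^sup>2 * (mix t f g x)\<^sup>2 = (1 - t) * ((norm x)\<^sup>2 * (f x)\<^sup>2) + t * ((norm x)\<^sup>2 * (g x)\<^sup>2)"
      unfolding mix_sq[OF t] by (simp add: algebra_simps)
    then show "ennreal ((norm x)\<^sup>2 * (mix t f g x)\<^sup>2) = ennreal (1 - t) * ennreal ((norm x)\<^sup>2 * (f x)\<^sup>2) + ennreal t * ennreal ((norm x)\<^sup>2 * (g x)\<^sup>2)"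
      using t by (simp add: ennreal_mult ennreal_plus)
  qed
  then show ?thesis unfolding harm_def by (simp add: nn_integral_add nn_integral_cmult)
qed

lemma mass_mix:
  assumes [measurable]: "f \<in> borel_measurable borel" "g \<in> borel_measurable borel" and t: "0 \<le> t" "t \<le> 1"
  shows "(\<integral>\<^sup>+x. sq (mix t f g) x \<partial>lborel) = ennreal (1 - t) * (\<integral>\<^sup>+x. sq f x \<partial>lborel) + ennreal t * (\<integral>\<^sup>+x. sq g x \<partial>lborel)"
  by (simp add: sq_mix[OF t] nn_integral_add nn_integral_cmult)

lemma dbl_mix:
  assumes [measurable]: "f \<in> borel_measurable borel" "g \<in> borel_measurable borel" and t: "0 \<le> t" "t \<le> 1"
  shows "dbl \<alpha> (sq (mix t f g)) (sq (mix t f g)) =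
    ennreal ((1 - t)\<^sup>2) * dbl \<alpha> (sq f) (sq f) + ennreal (2 * (t * (1 - t))) * dbl \<alpha> (sq f) (sq g) + ennreal (t\<^sup>2) * dbl \<alpha> (sq g) (sq g)"
proof -
  define p q where "p = ennreal (1 - t)" and "q = ennreal t"
  have e: "sq (mix t f g) = (\<lambda>x. p * sq f x + q * sq g x)" by (simp add: fun_eq_iff sq_mix[OF t] p_def q_def)
  have "dbl \<alpha> (sq (mix t f g)) (sq (mix t f g)) = p * p * dbl \<alpha> (sq f) (sq f) + q * p * dbl \<alpha> (sq g) (sq f) + (p * q * dbl \<alpha> (sq f) (sq g) + q * q * dbl \<alpha> (sq g) (sq g))"
    unfolding e by (simp add: dbl_add_left dbl_add_right dbl_cmult_left dbl_cmult_right distrib_left mult.assoc mult.left_commute)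
  also have "dbl \<alpha> (sq g) (sq f) = dbl \<alpha> (sq f) (sq g)" by (rule dbl_commute) measurable
  also have "p * p = ennreal ((1 - t)\<^sup>2)"
    using t by (simp add: p_def power2_eq_square ennreal_mult)
  also have "q * q = ennreal (t\<^sup>2)"
    using t by (simp add: q_def power2_eq_square ennreal_mult)
  finally have "dbl \<alpha> (sq (mix t f g)) (sq (mix t f g)) = ennreal ((1 - t)\<^sup>2) * dbl \<alpha> (sq f) (sq f) + (p * q + p * q) * dbl \<alpha> (sq f) (sq g) + ennreal (t\<^sup>2) * dbl \<alpha> (sq g) (sq g)"
    by (simp add: distrib_right mult.commute[of q p] add_ac)
  moreover have "p * q + p * q = ennreal (2 * (t * (1 - t)))"
    using t by (simp add: p_def q_def ennreal_mult[symmetric] ennreal_plus[symmetric] mult.commute del: ennreal_plus)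
  ultimately show ?thesis by simp
qed

section \<open>Test functions as competitors of finite energy\<close>

lemma pot_test_bounded:
  fixes \<phi> :: "'a::euclidean_space \<Rightarrow> real"
  assumes \<alpha>: "0 < \<alpha>" "\<alpha> < real DIM('a)" and t: "\<phi> \<in> test_functions"
  shows "\<exists>C\<ge>0. \<forall>x. pot \<alpha> (sq \<phi>) x \<le> ennreal C"
proof -
  obtain R where R: "R > 0" "\<And>x. norm x > R \<Longrightarrow> \<phi> x = 0" using test_bounded_support[OF t] by auto
  obtain M where M: "M > 0" "\<And>x. \<bar>\<phi> x\<bar> \<le> M" using test_bounded[OF t] by auto
  obtain C where C: "C \<ge> 0" "\<And>x. pot \<alpha> (indicator (cball (0::'a) R)) x \<le> ennreal C"
    using pot_indicator_bounded[OF \<alpha>, of R] by auto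
  have "sq \<phi> y \<le> ennreal (M\<^sup>2) * indicator (cball 0 R) y" for y
  proof (cases "norm y > R")
    case False
    have "(\<phi> y)\<^sup>2 \<le> M\<^sup>2" using M(2)[of y] M(1) by (metis abs_of_pos power2_abs power2_le_iff_abs_le less_imp_le)
    then show ?thesis using False by (simp add: sq_def ennreal_leI)
  qed (simp add: sq_def R)
  then have "pot \<alpha> (sq \<phi>) x \<le> ennreal (M\<^sup>2) * pot \<alpha> (indicator (cball 0 R)) x" for x
    unfolding pot_def
    by (subst nn_integral_cmult[symmetric])
       (auto intro!: nn_integral_mono mult_left_mono simp: mult.left_commute[of "ennreal (M\<^sup>2)"])
  then have "pot \<alpha> (sq \<phi>) x \<le> ennreal (M\<^sup>2) * ennreal C" for x
    using C(2)[of x] by (meson mult_left_mono order_trans zero_le)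
  then show ?thesis using C(1) by (intro exI[of _ "M\<^sup>2 * C"]) (simp add: ennreal_mult)
qed

lemma dbl_le_of_pot_le:
  assumes [measurable]: "\<rho> \<in> borel_measurable borel" "\<sigma> \<in> borel_measurable borel" and "\<And>x. pot \<alpha> \<rho> x \<le> C"
  shows "dbl \<alpha> \<rho> \<sigma> \<le> C * (\<integral>\<^sup>+x. \<sigma> x \<partial>lborel)"
  unfolding dbl_def
  by (subst nn_integral_cmult[symmetric]) (auto intro!: nn_integral_mono mult_right_mono assms)

text \<open>The potential of a test function is bounded, so its mutual energy with every square
  integrable density is finite, even if the self-energy of that density is infinite.\<close>

lemma dbl_test_finite:
  fixes \<phi> :: "'a::euclidean_space \<Rightarrow> real"
  assumes \<alpha>: "0 < \<alpha>" "\<alpha> < real DIM('a)" and t: "\<phi> \<in> test_functions" and f: "sqint f"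
  shows "dbl \<alpha> (sq \<phi>) (sq f) < \<infinity>"
proof -
  note [measurable] = test_measurable[OF t] sqint_measurable[OF f]
  obtain C where C: "C \<ge> 0" "\<And>x. pot \<alpha> (sq \<phi>) x \<le> ennreal C" using pot_test_bounded[OF \<alpha> t] by auto
  have "dbl \<alpha> (sq \<phi>) (sq f) \<le> ennreal C * (\<integral>\<^sup>+x. sq f x \<partial>lborel)"
    by (rule dbl_le_of_pot_le[OF _ _ C(2)]) measurable
  also have "\<dots> < \<infinity>" using f by (simp add: sqint_iff sq_def ennreal_mult_less_top)
  finally show ?thesis .
qed

lemma test_harm_finite:
  assumes t: "\<phi> \<in> test_functions" shows "harm \<phi> < \<infinity>"
proof -
  note [measurable] = test_measurable[OF t]
  obtain R where R: "R > 0" "\<And>x. norm x > R \<Longrightarrow> \<phi> x = 0" using test_bounded_support[OF t] by auto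
  have "harm \<phi> \<le> (\<integral>\<^sup>+x. ennreal (R\<^sup>2) * ennreal ((\<phi> x)\<^sup>2) \<partial>lborel)"
    unfolding harm_def
  proof (rule nn_integral_mono)
    fix x
    show "ennreal ((norm x)\<^sup>2 * (\<phi> x)\<^sup>2) \<le> ennreal (R\<^sup>2) * ennreal ((\<phi> x)\<^sup>2)"
    proof (cases "norm x > R")
      case False
      then have "(norm x)\<^sup>2 \<le> R\<^sup>2" by (intro power_mono) auto
      then show ?thesis by (simp add: mult_right_mono ennreal_leI flip: ennreal_mult)
    qed (simp add: R)
  qed
  also have "\<dots> = ennreal (R\<^sup>2) * (\<integral>\<^sup>+x. ennreal ((\<phi> x)\<^sup>2) \<partial>lborel)" by (rule nn_integral_cmult) measurable
  also have "\<dots> < \<infinity>" using test_sqint[OF t] by (simp add: sqint_iff ennreal_mult_less_top)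
  finally show ?thesis .
qed

lemma test_gradE_finite:
  assumes "\<phi> \<in> test_functions" "b \<in> Basis" shows "gradE b \<phi> < \<infinity>"
  using wpd_imp_gradE_eq[OF wpd_test[OF assms] assms(2)] test_sqint[OF test_partial[OF assms]]
  by (simp add: sqint_iff)

lemma test_cmult: assumes "\<phi> \<in> test_functions" shows "(\<lambda>x. c * \<phi> x) \<in> test_functions"
  using test_mult[OF assms smooth_const, of c] by (simp only: mult.commute[of c])

text \<open>A normalized box bump. It shows that the infimum of the energy is finite and supplies
  comparison functions that are positive on arbitrarily large boxes.\<close>

lemma exists_test_mass:
  fixes p q :: "'a::euclidean_space"
  assumes "m > 0" "box p q \<noteq> {}"
  shows "\<exists>\<phi>\<in>test_functions. (\<forall>x. \<phi> x \<ge> 0) \<and> (\<forall>x. \<phi> x > 0 \<longleftrightarrow> x \<in> box p q) \<and> (\<integral>\<^sup>+x. sq \<phi> x \<partial>lborel) = ennreal m"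
proof -
  let ?\<eta> = "box_bump 1 p q"
  have t: "?\<eta> \<in> test_functions" by (rule box_bump_test) simp
  note [measurable] = test_measurable[OF t]
  define I where "I = (LINT x|lborel. (?\<eta> x)\<^sup>2)"
  have pos: "?\<eta> x > 0 \<longleftrightarrow> x \<in> box p q" for x by (rule box_bump_pos_iff) simp
  have I: "(\<integral>\<^sup>+x. ennreal ((?\<eta> x)\<^sup>2) \<partial>lborel) = ennreal I" unfolding I_def by (rule sqint_nn_integral[OF test_sqint[OF t]])
  have "I \<noteq> 0"
  proof
    assume "I = 0"
    then have "AE x in lborel. ennreal ((?\<eta> x)\<^sup>2) = 0" using I by (simp add: nn_integral_0_iff_AE)
    then have "AE x in lborel. x \<notin> box p q"
    proof eventually_elim
      case (elim x)
      then show ?case using pos[of x] by (auto simp: ennreal_eq_0_iff)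
    qed
    then have "emeasure lborel (box p q) = 0" by (subst (asm) AE_iff_measurable[of "box p q"]) auto
    moreover have "(\<Prod>b\<in>Basis. (q - p) \<bullet> b) > 0"
      using assms(2) by (intro prod_pos) (auto simp: box_ne_empty inner_diff_left)
    moreover have "\<forall>b\<in>Basis. p \<bullet> b \<le> q \<bullet> b"
      using assms(2) by (auto simp: box_ne_empty intro: less_imp_le)
    then have "emeasure lborel (box p q) = ennreal (\<Prod>b\<in>Basis. (q - p) \<bullet> b)"
      by (simp add: emeasure_lborel_box_eq)
    ultimately show False by (metis ennreal_eq_0_iff not_le)
  qed
  moreover have "I \<ge> 0" unfolding I_def by (rule Bochner_Integration.integral_nonneg) simp
  ultimately have Ip: "I > 0" by simp
  let ?\<phi> = "\<lambda>x. sqrt (m / I) * ?\<eta> x"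
  have "(\<integral>\<^sup>+x. sq ?\<phi> x \<partial>lborel) = (\<integral>\<^sup>+x. ennreal (m / I) * ennreal ((?\<eta> x)\<^sup>2) \<partial>lborel)"
    using assms(1) Ip by (intro nn_integral_cong) (simp add: sq_def power_mult_distrib flip: ennreal_mult)
  also have "\<dots> = ennreal (m / I) * ennreal I" by (subst nn_integral_cmult) (simp_all add: I)
  also have "\<dots> = ennreal m" using Ip assms(1) by (simp flip: ennreal_mult)
  finally have m1: "(\<integral>\<^sup>+x. sq ?\<phi> x \<partial>lborel) = ennreal m" .
  have m2: "?\<phi> x \<ge> 0" "?\<phi> x > 0 \<longleftrightarrow> x \<in> box p q" for x
    using assms(1) Ip box_bump_bounds(1)[of 1 p q x] pos[of x] by (auto simp: zero_less_mult_iff)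
  show ?thesis by (rule bexI[of _ ?\<phi>], intro conjI allI m1 m2) (rule test_cmult[OF t])
qed

lemma test_renergy_finite:
  fixes \<phi> :: "'a::euclidean_space \<Rightarrow> real"
  assumes \<alpha>: "0 < \<alpha>" "\<alpha> < real DIM('a)" and t: "\<phi> \<in> test_functions"
  shows "renergy \<alpha> \<phi> < \<infinity>"
  using test_gradE_finite[OF t] test_harm_finite[OF t] dbl_test_finite[OF \<alpha> t test_sqint[OF t]]
  by (simp add: renergy_def ennreal_mult_less_top)

subsection \<open>Existence of a minimizer\<close>

text \<open>Nonnegativity lets the density determine the function, so convexity in the density makes
  sense on this class; \<open>mix\<close> stays inside it.\<close>

definition adm :: "real \<Rightarrow> ('a::euclidean_space \<Rightarrow> real) \<Rightarrow> bool" where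
  "adm m f \<longleftrightarrow> f \<in> borel_measurable borel \<and> (\<forall>x. 0 \<le> f x) \<and> (\<integral>\<^sup>+x. sq f x \<partial>lborel) = ennreal m"

lemma adm_measurable [measurable_dest]: "adm m f \<Longrightarrow> f \<in> borel_measurable borel"
  by (simp add: adm_def)

lemma adm_sqint: "adm m f \<Longrightarrow> sqint f"
  by (simp add: adm_def sqint_iff sq_def)

lemma adm_nonneg: "adm m f \<Longrightarrow> 0 \<le> f x"
  by (simp add: adm_def)

lemma adm_mix:
  assumes "adm m f" "adm m g" "0 \<le> t" "t \<le> 1" "m \<ge> 0"
  shows "adm m (mix t f g)"
proof -
  note [measurable] = assms(1,2)[THEN adm_measurable]
  have "(\<integral>\<^sup>+x. sq (mix t f g) x \<partial>lborel) = ennreal (1 - t) * ennreal m + ennreal t * ennreal m"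
    using mass_mix[OF assms(1,2)[THEN adm_measurable] assms(3,4)] assms(1,2) by (simp add: adm_def)
  also have "\<dots> = ennreal ((1 - t) * m + t * m)"
    using assms by (simp add: ennreal_mult ennreal_plus)
  also have "(1 - t) * m + t * m = m" by (simp add: algebra_simps)
  finally show ?thesis by (simp add: adm_def mix_nonneg[OF assms(3,4)])
qed

text \<open>Supplies the midpoint closure of the sets of near-minimizers. Expanding the nonlocal
  term leaves a cross term of weight 1/2, which \<open>dbl_cross_le\<close> replaces by the two
  self-energies.\<close>

lemma renergy_mid_le:
  fixes f g :: "'a::euclidean_space \<Rightarrow> real"
  assumes \<alpha>: "0 < \<alpha>" "\<alpha> < real DIM('a)"
    and [measurable]: "f \<in> borel_measurable borel" "g \<in> borel_measurable borel"
    and "renergy \<alpha> f \<le> c" "renergy \<alpha> g \<le> c"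
  shows "renergy \<alpha> (mix (1/2) f g) \<le> c"
proof -
  let ?h = "ennreal (1/2)"
  have h2: "?h * (x + x) = x" for x
  proof -
    have "?h * (x + x) = (?h + ?h) * x" by (simp only: distrib_left distrib_right)
    also have "?h + ?h = ennreal (1/2 + 1/2)" by (rule ennreal_plus[symmetric]) simp_all
    finally show ?thesis by simp
  qed
  have q: "ennreal (1/4) = ?h * ?h" by (subst ennreal_mult[symmetric]) simp_all
  have g: "(\<Sum>b\<in>Basis. gradE b (mix (1/2) f g)) \<le> ?h * (\<Sum>b\<in>Basis. gradE b f) + ?h * (\<Sum>b\<in>Basis. gradE b g)"
    unfolding sum_distrib_left sum.distrib[symmetric]
    using gradE_mix_le[of f g "1/2"] by (intro sum_mono) simp
  have H: "harm (mix (1/2) f g) = ?h * harm f + ?h * harm g"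
    using harm_mix[of f g "1/2"] by simp
  have D: "dbl \<alpha> (sq (mix (1/2) f g)) (sq (mix (1/2) f g)) \<le> ?h * dbl \<alpha> (sq f) (sq f) + ?h * dbl \<alpha> (sq g) (sq g)"
  proof -
    let ?F = "dbl \<alpha> (sq f) (sq f)" and ?G = "dbl \<alpha> (sq g) (sq g)"
    have "dbl \<alpha> (sq (mix (1/2) f g)) (sq (mix (1/2) f g)) = ?h * ?h * ?F + ?h * dbl \<alpha> (sq f) (sq g) + ?h * ?h * ?G"
      using dbl_mix[of f g "1/2" \<alpha>] by (simp add: q power2_eq_square)
    also have "?h * dbl \<alpha> (sq f) (sq g) = ?h * ?h * (2 * dbl \<alpha> (sq f) (sq g))"
      using h2[of "dbl \<alpha> (sq f) (sq g)"] by (simp only: mult.assoc mult_2)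
    also have "?h * ?h * ?F + ?h * ?h * (2 * dbl \<alpha> (sq f) (sq g)) + ?h * ?h * ?G \<le> ?h * ?h * ?F + ?h * ?h * (?F + ?G) + ?h * ?h * ?G"
      by (intro add_mono mult_left_mono dbl_cross_le[OF \<alpha>]) simp_all
    also have "\<dots> = ?h * (?h * (?F + ?F)) + ?h * (?h * (?G + ?G))"
      by (simp only: distrib_left add_ac mult.assoc)
    finally show ?thesis by (simp only: h2)
  qed
  have "renergy \<alpha> (mix (1/2) f g) \<le> 2 * ((?h * (\<Sum>b\<in>Basis. gradE b f) + ?h * (\<Sum>b\<in>Basis. gradE b g)) + (?h * harm f + ?h * harm g)) + (?h * dbl \<alpha> (sq f) (sq f) + ?h * dbl \<alpha> (sq g) (sq g))"
    unfolding renergy_def H by (intro add_mono mult_left_mono g D order_refl) simp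
  also have "\<dots> = ?h * (renergy \<alpha> f + renergy \<alpha> g)"
    unfolding renergy_def by (simp only: distrib_left add_ac mult.left_commute[of "2"])
  also have "\<dots> \<le> ?h * (c + c)" by (intro mult_left_mono add_mono assms) simp
  finally show ?thesis by (simp only: h2)
qed

section \<open>Lower semicontinuity and preservation of mass\<close>

lemma liminf_add_ennreal_le:
  fixes a b :: "nat \<Rightarrow> ennreal"
  shows "liminf a + liminf b \<le> liminf (\<lambda>n. a n + b n)"
proof -
  have "liminf a + liminf b = (SUP n. (INF m\<in>{n..}. a m) + (INF m\<in>{n..}. b m))"
    unfolding liminf_SUP_INF
    by (intro ennreal_SUP_add[symmetric] incseq_SucI INF_superset_mono) auto
  also have "\<dots> \<le> liminf (\<lambda>n. a n + b n)"
    unfolding liminf_SUP_INF by (intro SUP_mono' INF_greatest add_mono INF_lower)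
  finally show ?thesis .
qed

lemma liminf_sum_ennreal_le:
  fixes a :: "'i \<Rightarrow> nat \<Rightarrow> ennreal"
  assumes "finite I"
  shows "(\<Sum>i\<in>I. liminf (a i)) \<le> liminf (\<lambda>n. \<Sum>i\<in>I. a i n)"
  using assms
proof (induction I rule: finite_induct)
  case (insert i I)
  have "(\<Sum>i\<in>insert i I. liminf (a i)) \<le> liminf (a i) + liminf (\<lambda>n. \<Sum>i\<in>I. a i n)"
    using insert by (simp add: add_left_mono)
  also have "\<dots> \<le> liminf (\<lambda>n. a i n + (\<Sum>i\<in>I. a i n))" by (rule liminf_add_ennreal_le)
  finally show ?case using insert by simp
qed simp

lemma fatou_liminf:
  fixes u :: "nat \<Rightarrow> 'b \<Rightarrow> ennreal"
  assumes [measurable]: "\<And>n. u n \<in> borel_measurable M"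
    and lim: "AE x in M. (\<lambda>n. u n x) \<longlonglongrightarrow> u' x"
  shows "(\<integral>\<^sup>+x. u' x \<partial>M) \<le> liminf (\<lambda>n. \<integral>\<^sup>+x. u n x \<partial>M)"
proof -
  have "(\<integral>\<^sup>+x. u' x \<partial>M) = (\<integral>\<^sup>+x. liminf (\<lambda>n. u n x) \<partial>M)"
    by (rule nn_integral_cong_AE) (use lim in \<open>eventually_elim, simp add: lim_imp_Liminf\<close>)
  also have "\<dots> \<le> liminf (\<lambda>n. \<integral>\<^sup>+x. u n x \<partial>M)"
    by (rule nn_integral_liminf) simp
  finally show ?thesis .
qed

text \<open>Finite differences converge pointwise along with the functions, so Fatou's lemma applies
  to each quotient without any convergence of derivatives, and the supremum over steps preserves the
  inequality. In the nonlocal term Fatou's lemma is used in \<open>y\<close> for fixed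
  \<open>x\<close> and then in \<open>x\<close>.\<close>

lemma renergy_lsc:
  fixes f :: "'a::euclidean_space \<Rightarrow> real"
  assumes [measurable]: "\<And>n. F n \<in> borel_measurable borel" "f \<in> borel_measurable borel"
    and lim: "AE x in lborel. (\<lambda>n. F n x) \<longlonglongrightarrow> f x"
  shows "renergy \<alpha> f \<le> liminf (\<lambda>n. renergy \<alpha> (F n))"
proof -
  have dq: "dq b h f \<le> liminf (\<lambda>n. dq b h (F n))" for b h
    unfolding dq_def
  proof (rule fatou_liminf)
    show "AE x in lborel. (\<lambda>n. ennreal (((F n (x + h *\<^sub>R b) - F n x) / h)\<^sup>2)) \<longlonglongrightarrow> ennreal (((f (x + h *\<^sub>R b) - f x) / h)\<^sup>2)"
      using lim AE_lborel_translate[OF lim, of "h *\<^sub>R b"]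
      by eventually_elim (auto intro!: tendsto_ennrealI tendsto_power tendsto_diff simp: divide_inverse intro: tendsto_mult_right)
  qed measurable
  have g: "gradE b f \<le> liminf (\<lambda>n. gradE b (F n))" for b
    unfolding gradE_def[of b f]
    by (intro SUP_least order_trans[OF dq] Liminf_mono always_eventually allI dq_le_gradE_dyadic)
  have H: "harm f \<le> liminf (\<lambda>n. harm (F n))"
    unfolding harm_def
  proof (rule fatou_liminf)
    show "AE x in lborel. (\<lambda>n. ennreal ((norm x)\<^sup>2 * (F n x)\<^sup>2)) \<longlonglongrightarrow> ennreal ((norm x)\<^sup>2 * (f x)\<^sup>2)"
      using lim by eventually_elim (intro tendsto_ennrealI tendsto_power tendsto_mult tendsto_const)
  qed measurable
  have D: "dbl \<alpha> (sq f) (sq f) \<le> liminf (\<lambda>n. dbl \<alpha> (sq (F n)) (sq (F n)))"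
  proof -
    have e: "dbl \<alpha> (sq u) (sq u) = (\<integral>\<^sup>+x. \<integral>\<^sup>+y. ennreal (riesz_potential \<alpha> (x - y) * (u y)\<^sup>2 * (u x)\<^sup>2) \<partial>lborel \<partial>lborel)"
      if [measurable]: "u \<in> borel_measurable borel" for u :: "'a \<Rightarrow> real"
    proof -
      have "ennreal (riesz_potential \<alpha> (x - y) * (u y)\<^sup>2 * (u x)\<^sup>2) = ennreal (riesz_potential \<alpha> (x - y)) * sq u y * sq u x" for x y
        by (simp add: sq_def ennreal_mult'')
      then show ?thesis unfolding dbl_def pot_def by (simp add: nn_integral_multc)
    qed
    have "dbl \<alpha> (sq f) (sq f) \<le> (\<integral>\<^sup>+x. liminf (\<lambda>n. \<integral>\<^sup>+y. ennreal (riesz_potential \<alpha> (x - y) * (F n y)\<^sup>2 * (F n x)\<^sup>2) \<partial>lborel) \<partial>lborel)"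
      unfolding e[OF assms(2)]
    proof (rule nn_integral_mono_AE)
      show "AE x in lborel. (\<integral>\<^sup>+y. ennreal (riesz_potential \<alpha> (x - y) * (f y)\<^sup>2 * (f x)\<^sup>2) \<partial>lborel) \<le>
        liminf (\<lambda>n. \<integral>\<^sup>+y. ennreal (riesz_potential \<alpha> (x - y) * (F n y)\<^sup>2 * (F n x)\<^sup>2) \<partial>lborel)"
        using lim
      proof eventually_elim
        case (elim x)
        show ?case
        proof (rule fatou_liminf)
          show "AE y in lborel. (\<lambda>n. ennreal (riesz_potential \<alpha> (x - y) * (F n y)\<^sup>2 * (F n x)\<^sup>2)) \<longlonglongrightarrow> ennreal (riesz_potential \<alpha> (x - y) * (f y)\<^sup>2 * (f x)\<^sup>2)"
            using lim by eventually_elim (intro tendsto_ennrealI tendsto_power tendsto_mult tendsto_const elim)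
        qed measurable
      qed
    qed
    also have "\<dots> \<le> liminf (\<lambda>n. \<integral>\<^sup>+x. \<integral>\<^sup>+y. ennreal (riesz_potential \<alpha> (x - y) * (F n y)\<^sup>2 * (F n x)\<^sup>2) \<partial>lborel \<partial>lborel)"
      by (rule nn_integral_liminf) measurable
    finally show ?thesis by (simp add: e)
  qed
  let ?A = "\<lambda>n. (\<Sum>b\<in>Basis. gradE b (F n)) + harm (F n)"
  have A: "(\<Sum>b\<in>Basis. gradE b f) + harm f \<le> liminf ?A"
  proof -
    have "(\<Sum>b\<in>Basis. gradE b f) + harm f \<le> (\<Sum>b\<in>Basis. liminf (\<lambda>n. gradE b (F n))) + liminf (\<lambda>n. harm (F n))"
      by (intro add_mono sum_mono g H)
    also have "\<dots> \<le> liminf (\<lambda>n. \<Sum>b\<in>Basis. gradE b (F n)) + liminf (\<lambda>n. harm (F n))"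
      by (intro add_mono liminf_sum_ennreal_le finite_Basis order_refl)
    also have "\<dots> \<le> liminf ?A" by (rule liminf_add_ennreal_le)
    finally show ?thesis .
  qed
  have "renergy \<alpha> f \<le> (liminf ?A + liminf ?A) + liminf (\<lambda>n. dbl \<alpha> (sq (F n)) (sq (F n)))"
    unfolding renergy_def mult_2 by (intro add_mono A D)
  also have "\<dots> \<le> liminf (\<lambda>n. ?A n + ?A n) + liminf (\<lambda>n. dbl \<alpha> (sq (F n)) (sq (F n)))"
    by (intro add_mono liminf_add_ennreal_le order_refl)
  also have "\<dots> \<le> liminf (\<lambda>n. renergy \<alpha> (F n))"
    unfolding renergy_def mult_2 by (rule liminf_add_ennreal_le)
  finally show ?thesis .
qed

text \<open>The shift is made one coordinate at a time. Each coordinate costs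
  \<open>(a + b)^2 \<le> 2 a^2 + 2 b^2\<close>, and \<open>2 + 2 * 4^k \<le> 4^(k+1)\<close>
  explains the factor 4.\<close>

lemma shift_sq_le:
  fixes f :: "'a::euclidean_space \<Rightarrow> real"
  assumes f: "sqint f" and M: "\<And>b. b \<in> Basis \<Longrightarrow> gradE b f \<le> ennreal M" "M \<ge> 0"
    and h: "\<And>b. b \<in> Basis \<Longrightarrow> 0 \<le> h \<bullet> b \<and> h \<bullet> b \<le> \<delta>" and S: "S \<subseteq> Basis"
  shows "(\<integral>\<^sup>+x. ennreal ((f (x + (\<Sum>b\<in>S. (h \<bullet> b) *\<^sub>R b)) - f x)\<^sup>2) \<partial>lborel) \<le> ennreal (4 ^ card S * (\<delta>\<^sup>2 * M))"
proof -
  note [measurable] = sqint_measurable[OF f]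
  have "finite S" using S finite_Basis finite_subset by blast
  then show ?thesis using S
  proof (induction S rule: finite_induct)
    case empty
    then show ?case using M by simp
  next
    case (insert b S)
    let ?v = "\<Sum>b\<in>S. (h \<bullet> b) *\<^sub>R b" and ?t = "h \<bullet> b"
    have b: "b \<in> Basis" using insert by simp
    have 1: "(\<integral>\<^sup>+x. ennreal ((f (x + ?t *\<^sub>R b) - f x)\<^sup>2) \<partial>lborel) \<le> ennreal (\<delta>\<^sup>2 * M)"
    proof (cases "?t = 0")
      case False
      then have t: "?t > 0" "?t \<le> \<delta>" using h[OF b] by auto
      have "(\<integral>\<^sup>+x. ennreal ((f (x + ?t *\<^sub>R b) - f x)\<^sup>2) \<partial>lborel) = (\<integral>\<^sup>+x. ennreal (?t\<^sup>2) * ennreal (((f (x + ?t *\<^sub>R b) - f x) / ?t)\<^sup>2) \<partial>lborel)"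
        using t by (intro nn_integral_cong) (simp add: power_divide flip: ennreal_mult)
      also have "\<dots> = ennreal (?t\<^sup>2) * dq b ?t f" unfolding dq_def by (rule nn_integral_cmult) measurable
      also have "\<dots> \<le> ennreal (\<delta>\<^sup>2) * ennreal M"
        using t by (intro mult_mono order_trans[OF dq_le_gradE[OF f b t(1)] M(1)[OF b]] ennreal_leI power_mono) auto
      finally show ?thesis using M by (simp add: ennreal_mult)
    qed (use M in simp)
    have "(\<integral>\<^sup>+x. ennreal ((f (x + (\<Sum>b\<in>insert b S. (h \<bullet> b) *\<^sub>R b)) - f x)\<^sup>2) \<partial>lborel) \<le>
      (\<integral>\<^sup>+x. 2 * ennreal ((f (x + ?v + ?t *\<^sub>R b) - f (x + ?v))\<^sup>2) + 2 * ennreal ((f (x + ?v) - f x)\<^sup>2) \<partial>lborel)"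
    proof (rule nn_integral_mono)
      fix x
      have e: "x + (\<Sum>b\<in>insert b S. (h \<bullet> b) *\<^sub>R b) = x + ?v + ?t *\<^sub>R b"
        using insert by (simp add: add_ac)
      have "(f (x + ?v + ?t *\<^sub>R b) - f x)\<^sup>2 \<le> 2 * (f (x + ?v + ?t *\<^sub>R b) - f (x + ?v))\<^sup>2 + 2 * (f (x + ?v) - f x)\<^sup>2"
        using sum_sq_bound[of "f (x + ?v + ?t *\<^sub>R b) - f (x + ?v)" "f (x + ?v) - f x"] by simp
      then have "ennreal ((f (x + ?v + ?t *\<^sub>R b) - f x)\<^sup>2) \<le> ennreal (2 * (f (x + ?v + ?t *\<^sub>R b) - f (x + ?v))\<^sup>2 + 2 * (f (x + ?v) - f x)\<^sup>2)"
        by (rule ennreal_leI)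
      then show "ennreal ((f (x + (\<Sum>b\<in>insert b S. (h \<bullet> b) *\<^sub>R b)) - f x)\<^sup>2) \<le> 2 * ennreal ((f (x + ?v + ?t *\<^sub>R b) - f (x + ?v))\<^sup>2) + 2 * ennreal ((f (x + ?v) - f x)\<^sup>2)"
        unfolding e by (simp add: ennreal_plus ennreal_mult)
    qed
    also have "\<dots> = 2 * (\<integral>\<^sup>+x. ennreal ((f (x + ?v + ?t *\<^sub>R b) - f (x + ?v))\<^sup>2) \<partial>lborel) + 2 * (\<integral>\<^sup>+x. ennreal ((f (x + ?v) - f x)\<^sup>2) \<partial>lborel)"
      by (simp add: nn_integral_add nn_integral_cmult)
    also have "(\<integral>\<^sup>+x. ennreal ((f (x + ?v + ?t *\<^sub>R b) - f (x + ?v))\<^sup>2) \<partial>lborel) = (\<integral>\<^sup>+x. ennreal ((f (x + ?t *\<^sub>R b) - f x)\<^sup>2) \<partial>lborel)"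
      by (rule nn_integral_lborel_translate[of "\<lambda>x. ennreal ((f (x + ?t *\<^sub>R b) - f x)\<^sup>2)" ?v]) measurable
    also have "2 * (\<integral>\<^sup>+x. ennreal ((f (x + ?t *\<^sub>R b) - f x)\<^sup>2) \<partial>lborel) + 2 * (\<integral>\<^sup>+x. ennreal ((f (x + ?v) - f x)\<^sup>2) \<partial>lborel)
      \<le> 2 * ennreal (\<delta>\<^sup>2 * M) + 2 * ennreal (4 ^ card S * (\<delta>\<^sup>2 * M))"
      using insert by (intro add_mono mult_left_mono 1 insert.IH) auto
    also have "\<dots> = ennreal (2 * (\<delta>\<^sup>2 * M) + 2 * (4 ^ card S * (\<delta>\<^sup>2 * M)))"
      using M by (simp add: ennreal_plus ennreal_mult)
    also have "\<dots> \<le> ennreal (4 ^ card (insert b S) * (\<delta>\<^sup>2 * M))"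
    proof (rule ennreal_leI)
      have "(1::real) \<le> 4 ^ card S" by simp
      then have "1 * (\<delta>\<^sup>2 * M) \<le> 4 ^ card S * (\<delta>\<^sup>2 * M)" using M by (intro mult_right_mono) auto
      then show "2 * (\<delta>\<^sup>2 * M) + 2 * (4 ^ card S * (\<delta>\<^sup>2 * M)) \<le> 4 ^ card (insert b S) * (\<delta>\<^sup>2 * M)"
        unfolding card_insert_disjoint[OF insert.hyps] power_Suc mult.assoc by linarith
    qed
    finally show ?case .
  qed
qed

text \<open>Where \<open>f\<^sup>2\<close> exceeds four times its average over a cube of side \<open>\<delta>\<close> based at the point, it is
  controlled by the translation differences.\<close>

lemma mass_concentration_le:
  fixes f :: "'a::euclidean_space \<Rightarrow> real"
  assumes f: "sqint f" and m: "(\<integral>\<^sup>+x. sq f x \<partial>lborel) = ennreal m" "m \<ge> 0"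
    and M: "\<And>b. b \<in> Basis \<Longrightarrow> gradE b f \<le> ennreal M" "M \<ge> 0" and \<delta>: "\<delta> > 0"
  shows "(\<integral>\<^sup>+x. sq f x * indicator {x. (f x)\<^sup>2 \<ge> 4 * m / \<delta> ^ DIM('a)} x \<partial>lborel) \<le> ennreal (4 * (4 ^ DIM('a) * (\<delta>\<^sup>2 * M)))"
proof -
  note [measurable] = sqint_measurable[OF f]
  let ?V = "\<delta> ^ DIM('a)"
  have V: "?V > 0" using \<delta> by simp
  define Q :: "'a set" where "Q = cbox 0 (\<delta> *\<^sub>R One)"
  have [measurable]: "Q \<in> sets borel" by (simp add: Q_def)
  have Q: "emeasure lborel Q = ennreal ?V"
    using \<delta> by (simp add: Q_def emeasure_lborel_cbox_eq)
  have inQ: "0 \<le> h \<bullet> b \<and> h \<bullet> b \<le> \<delta>" if "h \<in> Q" "b \<in> Basis" for h b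
    using that by (auto simp: Q_def mem_box)
  let ?I = "\<lambda>x. \<integral>\<^sup>+h. indicator Q h * ennreal ((f (x + h) - f x)\<^sup>2) \<partial>lborel"
  have pt: "sq f x * indicator {x. (f x)\<^sup>2 \<ge> 4 * m / ?V} x \<le> ennreal (4 / ?V) * ?I x" for x
  proof (cases "(f x)\<^sup>2 \<ge> 4 * m / ?V")
    case True
    \<comment> \<open>Integrate \<open>f(x)^2 \<le> 2 (f(x+h) - f(x))^2 + 2 f(x+h)^2\<close> over
      the cube. Above the threshold the term \<open>2 m\<close> is at most half of the left side and
      can be absorbed, which explains the constant 4.\<close>
    have "ennreal ((f x)\<^sup>2 * ?V) = (\<integral>\<^sup>+h. indicator Q h * ennreal ((f x)\<^sup>2) \<partial>lborel)"
      using V by (subst nn_integral_multc) (auto simp: Q ennreal_mult mult.commute)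
    also have "\<dots> \<le> (\<integral>\<^sup>+h. 2 * (indicator Q h * ennreal ((f (x + h) - f x)\<^sup>2)) + 2 * sq f (h + x) \<partial>lborel)"
    proof (rule nn_integral_mono)
      fix h
      have "(f x)\<^sup>2 \<le> 2 * (f (x + h) - f x)\<^sup>2 + 2 * (f (x + h))\<^sup>2"
        using sum_sq_bound[of "f x - f (x + h)" "f (x + h)"] by (simp add: power2_commute[of "f x"])
      from ennreal_leI[OF this] have "ennreal ((f x)\<^sup>2) \<le> 2 * ennreal ((f (x + h) - f x)\<^sup>2) + 2 * sq f (h + x)"
        by (simp add: sq_def ennreal_mult ennreal_plus add.commute[of h])
      then show "indicator Q h * ennreal ((f x)\<^sup>2) \<le> 2 * (indicator Q h * ennreal ((f (x + h) - f x)\<^sup>2)) + 2 * sq f (h + x)"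
        by (cases "h \<in> Q") auto
    qed
    also have "\<dots> = 2 * ?I x + 2 * ennreal m"
      using nn_integral_lborel_translate[of "sq f" x] m by (simp add: nn_integral_add nn_integral_cmult)
    finally have le: "ennreal ((f x)\<^sup>2 * ?V) \<le> 2 * ?I x + 2 * ennreal m" .
    show ?thesis
    proof (cases "?I x")
      case (real i)
      have "ennreal ((f x)\<^sup>2 * ?V) \<le> ennreal (2 * i + 2 * m)"
        using le real m(2) by (simp add: ennreal_plus ennreal_mult)
      then have "(f x)\<^sup>2 * ?V \<le> 2 * i + 2 * m" using real m(2) by (subst (asm) ennreal_le_iff) auto
      moreover have "4 * m \<le> (f x)\<^sup>2 * ?V" using True V by (simp add: divide_le_eq)
      ultimately have "(f x)\<^sup>2 * ?V \<le> 4 * i" by linarith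
      then have "(f x)\<^sup>2 \<le> 4 / ?V * i" using V by (simp add: field_simps)
      then have "ennreal ((f x)\<^sup>2) \<le> ennreal (4 / ?V) * ennreal i"
        using real V by (simp add: ennreal_leI flip: ennreal_mult)
      then show ?thesis using True real by (simp add: sq_def)
    next
      case top
      then show ?thesis using V \<delta> by (simp add: ennreal_mult_top)
    qed
  qed simp
  have "(\<integral>\<^sup>+x. sq f x * indicator {x. (f x)\<^sup>2 \<ge> 4 * m / ?V} x \<partial>lborel) \<le> (\<integral>\<^sup>+x. ennreal (4 / ?V) * ?I x \<partial>lborel)"
    by (rule nn_integral_mono) (rule pt)
  also have "\<dots> = ennreal (4 / ?V) * (\<integral>\<^sup>+x. ?I x \<partial>lborel)" by (rule nn_integral_cmult) measurable
  also have "(\<integral>\<^sup>+x. ?I x \<partial>lborel) = (\<integral>\<^sup>+h. \<integral>\<^sup>+x. indicator Q h * ennreal ((f (x + h) - f x)\<^sup>2) \<partial>lborel \<partial>lborel)"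
    by (rule lborel_pair.Fubini') measurable
  also have "\<dots> \<le> (\<integral>\<^sup>+h. ennreal (4 ^ DIM('a) * (\<delta>\<^sup>2 * M)) * indicator Q h \<partial>lborel)"
  proof (rule nn_integral_mono)
    fix h :: 'a
    show "(\<integral>\<^sup>+x. indicator Q h * ennreal ((f (x + h) - f x)\<^sup>2) \<partial>lborel) \<le> ennreal (4 ^ DIM('a) * (\<delta>\<^sup>2 * M)) * indicator Q h"
    proof (cases "h \<in> Q")
      case True
      show ?thesis using shift_sq_le[OF f M inQ[OF True] order_refl] True by (simp add: euclidean_representation)
    qed simp
  qed
  also have "\<dots> = ennreal (4 ^ DIM('a) * (\<delta>\<^sup>2 * M)) * ennreal ?V"
    by (subst nn_integral_cmult) (simp_all add: Q)
  also have "ennreal (4 / ?V) * (ennreal (4 ^ DIM('a) * (\<delta>\<^sup>2 * M)) * ennreal ?V) = ennreal (4 * (4 ^ DIM('a) * (\<delta>\<^sup>2 * M)))"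
    using V M by (simp flip: ennreal_mult)
  finally show ?thesis by (simp add: mult_left_mono)
qed

text \<open>Logarithms can be taken unless the exponentials tend to 0, that is unless
  \<open>a\<close> tends to infinity, which a finite lower limit excludes.\<close>

lemma convergent_exp_imp_convergent:
  fixes a :: "nat \<Rightarrow> real"
  assumes conv: "convergent (\<lambda>n. exp (- (a n + c) / 2))" and a: "\<And>n. a n \<ge> 0"
    and fin: "liminf (\<lambda>n. ennreal (a n)) < \<infinity>"
  shows "convergent a"
proof -
  obtain l where l: "(\<lambda>n. exp (- (a n + c) / 2)) \<longlonglongrightarrow> l" using conv by (auto simp: convergent_def)
  have "l > 0"
  proof (rule ccontr)
    assume "\<not> l > 0"
    obtain r where r: "r \<ge> 0" "liminf (\<lambda>n. ennreal (a n)) = ennreal r"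
      using fin by (cases "liminf (\<lambda>n. ennreal (a n))") auto
    have "exp (- (r + 1 + c) / 2) > l" using \<open>\<not> l > 0\<close> exp_gt_zero[of "- (r + 1 + c) / 2"] by linarith
    then have "\<forall>\<^sub>F n in sequentially. exp (- (a n + c) / 2) < exp (- (r + 1 + c) / 2)"
      by (rule order_tendstoD(2)[OF l])
    then have "\<forall>\<^sub>F n in sequentially. ennreal (r + 1) \<le> ennreal (a n)"
      by eventually_elim (auto intro!: ennreal_leI)
    then have "ennreal (r + 1) \<le> liminf (\<lambda>n. ennreal (a n))" by (rule Liminf_bounded)
    then show False using r by simp
  qed
  have "(\<lambda>n. - 2 * ln (exp (- (a n + c) / 2)) - c) \<longlonglongrightarrow> - 2 * ln l - c"
    using \<open>l > 0\<close> by (intro tendsto_intros l) auto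
  moreover have "- 2 * ln (exp (- (a n + c) / 2)) - c = a n" for n by (simp add: field_simps)
  ultimately show ?thesis by (auto simp: convergent_def)
qed

lemma exists_minimizer:
  fixes \<alpha> m :: real
  assumes \<alpha>: "0 < \<alpha>" "\<alpha> < real DIM('a::euclidean_space)" and m: "m > 0"
  shows "\<exists>f :: 'a \<Rightarrow> real. adm m f \<and> renergy \<alpha> f < \<infinity> \<and> (\<forall>g :: 'a \<Rightarrow> real. adm m g \<longrightarrow> renergy \<alpha> f \<le> renergy \<alpha> g)"
proof -
  define d where "d = (INF f\<in>{f :: 'a \<Rightarrow> real. adm m f}. renergy \<alpha> f)"
  have "\<exists>\<phi>. adm m (\<phi> :: 'a \<Rightarrow> real) \<and> renergy \<alpha> \<phi> < \<infinity>"
  proof -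
    have "box (0::'a) One \<noteq> {}" by (simp add: box_ne_empty)
    from exists_test_mass[OF m this] obtain \<phi> :: "'a \<Rightarrow> real" where
      "\<phi> \<in> test_functions" "\<forall>x. \<phi> x \<ge> 0" "(\<integral>\<^sup>+x. sq \<phi> x \<partial>lborel) = ennreal m" by blast
    then show ?thesis using test_renergy_finite[OF \<alpha>, of \<phi>] test_measurable[of \<phi>]
      by (intro exI[of _ \<phi>]) (simp add: adm_def)
  qed
  then obtain \<phi> :: "'a \<Rightarrow> real" where \<phi>: "adm m \<phi>" "renergy \<alpha> \<phi> < \<infinity>" by blast
  have d_le: "d \<le> renergy \<alpha> g" if "adm m g" for g :: "'a \<Rightarrow> real"
    unfolding d_def by (rule INF_lower) (use that in simp)
  have d: "d < \<infinity>" using d_le[OF \<phi>(1)] \<phi>(2) by (rule le_less_trans)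
  define C where "C n = {f :: 'a \<Rightarrow> real. adm m f \<and> renergy \<alpha> f \<le> d + ennreal (1 / Suc n)}" for n
  \<comment> \<open>The square root of the strictly convex integrand. It is \<open>v\<close>, not
    \<open>f\<close>, whose values will form an L2 Cauchy sequence; the Gaussian factor keeps
    \<open>v\<close> square integrable where \<open>f\<close> vanishes.\<close>
  define v where "v f x = exp (- ((f x)\<^sup>2 + (norm x)\<^sup>2) / 2)" for f and x :: 'a
  have [measurable]: "v f \<in> borel_measurable borel" if [measurable]: "f \<in> borel_measurable borel" for f
    unfolding v_def[abs_def] by measurable
  have v0: "0 < v f x" for f x by (simp add: v_def)
  define G where "G = (LINT x|lborel. exp (- (norm (x::'a))\<^sup>2))"
  have Gi: "integrable lborel (\<lambda>x::'a. exp (- (norm x)\<^sup>2))"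
    using nn_integral_gauss(1)[of 1, where 'a = 'a] by (simp add: integrable_iff_bounded)
  have vsq: "(v f x)\<^sup>2 = exp (- ((f x)\<^sup>2 + (norm x)\<^sup>2))" for f x
    by (simp add: v_def flip: exp_double)
  have vs: "sqint (v f)" if [measurable]: "f \<in> borel_measurable borel" for f
    by (rule sqintI[OF _ Gi]) (simp_all add: vsq)
  define J where "J f = (LINT x|lborel. (v f x)\<^sup>2)" for f
  have CA: "adm m f" if "f \<in> C n" for f n using that by (simp add: C_def)
  have "\<exists>x. (\<forall>n. x n \<in> C n) \<and> (\<forall>n k. n \<le> k \<longrightarrow> (\<integral>\<^sup>+y. ennreal (((v (x n) y - v (x k) y) / 2)\<^sup>2) \<partial>lborel) \<le> ennreal ((1/4)^n))"
  proof (rule nested_near_minimizers[where J = J and B = G and mid = "mix (1/2)"])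
    show "C n \<noteq> {}" for n
    proof -
      have "d < d + ennreal (1 / Suc n)" using d by (cases d) (auto simp: ennreal_less_iff simp flip: ennreal_plus)
      then obtain f :: "'a \<Rightarrow> real" where "adm m f" "renergy \<alpha> f < d + ennreal (1 / Suc n)"
        unfolding d_def INF_less_iff by auto
      then have "f \<in> C n" by (simp add: C_def less_imp_le)
      then show ?thesis by blast
    qed
    show "C k \<subseteq> C n" if "n \<le> k" for n k
    proof
      fix f assume f: "f \<in> C k"
      have "ennreal (1 / Suc k) \<le> ennreal (1 / Suc n)" using that by (intro ennreal_leI) (simp add: frac_le)
      then have "d + ennreal (1 / Suc k) \<le> d + ennreal (1 / Suc n)" by (rule add_left_mono)
      with f show "f \<in> C n" unfolding C_def by (auto intro: order_trans)
    qed
    show "mix (1/2) f g \<in> C n" if "f \<in> C n" "g \<in> C n" for n f g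
      using that adm_mix[of m f g "1/2"] m renergy_mid_le[OF \<alpha> adm_measurable adm_measurable, of m f m g "d + ennreal (1 / Suc n)"]
      by (simp add: C_def)
    show "0 \<le> J f \<and> J f \<le> G" if "f \<in> C n" for n f
    proof -
      note [measurable] = adm_measurable[OF CA[OF that]]
      have "J f \<le> G" unfolding J_def G_def
        by (rule integral_mono[OF sqint_integrable[OF vs] Gi]) (simp_all add: vsq)
      moreover have "0 \<le> J f" unfolding J_def by (rule Bochner_Integration.integral_nonneg) simp
      ultimately show ?thesis by simp
    qed
    show "(\<integral>\<^sup>+y. ennreal (((v f y - v g y) / 2)\<^sup>2) \<partial>lborel) \<le> ennreal ((J f + J g) / 2 - J (mix (1/2) f g))"
      if fg: "f \<in> C n" "g \<in> C n" for n f g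
    proof -
      note [measurable] = adm_measurable[OF CA[OF fg(1)]] adm_measurable[OF CA[OF fg(2)]]
      have mid: "(v (mix (1/2) f g) y)\<^sup>2 = v f y * v g y" for y
        unfolding vsq by (simp add: mix_sq v_def exp_add[symmetric] field_simps)
      note i = sqint_integrable[OF vs[of f]] sqint_integrable[OF vs[of g]] sqint_mult_integrable[OF vs[of f] vs[of g]]
      have s: "sqint (\<lambda>y. (v f y - v g y) / 2)"
        using sqint_cmult[OF sqint_diff[OF vs[of f] vs[of g]], of "1/2"] by simp
      have "(LINT y|lborel. ((v f y - v g y) / 2)\<^sup>2) \<le> (LINT y|lborel. ((v f y)\<^sup>2 + (v g y)\<^sup>2) / 2 - v f y * v g y)"
      proof (rule integral_mono[OF sqint_integrable[OF s]])
        show "integrable lborel (\<lambda>y. ((v f y)\<^sup>2 + (v g y)\<^sup>2) / 2 - v f y * v g y)" using i by simp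
        have "((a - b) / 2)\<^sup>2 \<le> (a\<^sup>2 + b\<^sup>2) / 2 - a * b" for a b :: real
          using zero_le_power2[of "a - b"] by (simp add: power2_eq_square field_simps)
        then show "((v f y - v g y) / 2)\<^sup>2 \<le> ((v f y)\<^sup>2 + (v g y)\<^sup>2) / 2 - v f y * v g y" for y .
      qed
      also have "\<dots> = (J f + J g) / 2 - J (mix (1/2) f g)"
        unfolding J_def mid using i by simp
      finally show ?thesis unfolding sqint_nn_integral[OF s] by (rule ennreal_leI)
    qed
  qed
  then obtain F where F: "\<And>n. F n \<in> C n"
    and Fd: "\<And>n k. n \<le> k \<Longrightarrow> (\<integral>\<^sup>+y. ennreal (((v (F n) y - v (F k) y) / 2)\<^sup>2) \<partial>lborel) \<le> ennreal ((1/4)^n)" by blast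
  note A = CA[OF F]
  note [measurable] = adm_measurable[OF A]
  have mF: "(\<integral>\<^sup>+x. sq (F n) x \<partial>lborel) = ennreal m" for n using A by (simp add: adm_def)
  have "AE y in lborel. convergent (\<lambda>n. v (F n) y / 2)"
  proof (rule fast_Cauchy_AE_convergent)
    show "(\<integral>\<^sup>+y. ennreal ((v (F (Suc n)) y / 2 - v (F n) y / 2)\<^sup>2) \<partial>lborel) \<le> ennreal ((1/4)^n)" for n
      using Fd[of n "Suc n"] by (simp add: power2_commute[of "v (F (Suc n)) _ / 2"] diff_divide_distrib)
  qed measurable
  \<comment> \<open>Convergence of \<open>v\<close> alone leaves open that \<open>F n y\<close>
    tends to infinity; the common mass excludes this through Fatou's lemma.\<close>
  moreover have "AE y in lborel. liminf (\<lambda>n. ennreal ((F n y)\<^sup>2)) \<noteq> \<infinity>"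
  proof (rule nn_integral_noteq_infinite)
    have "(\<integral>\<^sup>+y. liminf (\<lambda>n. ennreal ((F n y)\<^sup>2)) \<partial>lborel) \<le> liminf (\<lambda>n. \<integral>\<^sup>+y. ennreal ((F n y)\<^sup>2) \<partial>lborel)"
      by (rule nn_integral_liminf) measurable
    also have "\<dots> = ennreal m" using mF by (simp add: sq_def Liminf_const)
    finally show "(\<integral>\<^sup>+y. liminf (\<lambda>n. ennreal ((F n y)\<^sup>2)) \<partial>lborel) \<noteq> \<infinity>" by (auto simp: top_unique)
  qed measurable
  ultimately have conv: "AE y in lborel. convergent (\<lambda>n. F n y)"
  proof eventually_elim
    case (elim y)
    then obtain l where "(\<lambda>n. v (F n) y / 2) \<longlonglongrightarrow> l" by (auto simp: convergent_def)
    from tendsto_mult_left[OF this, of 2] have "convergent (\<lambda>n. exp (- ((F n y)\<^sup>2 + (norm y)\<^sup>2) / 2))"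
      by (auto simp: convergent_def v_def)
    then have "convergent (\<lambda>n. (F n y)\<^sup>2)"
    proof (rule convergent_exp_imp_convergent)
      show "liminf (\<lambda>n. ennreal ((F n y)\<^sup>2)) < \<infinity>" using elim(2) by (simp add: top.not_eq_extremum)
    qed simp
    then obtain L where "(\<lambda>n. (F n y)\<^sup>2) \<longlonglongrightarrow> L" by (auto simp: convergent_def)
    then have "(\<lambda>n. sqrt ((F n y)\<^sup>2)) \<longlonglongrightarrow> sqrt L" by (rule tendsto_real_sqrt)
    then show ?case using adm_nonneg[OF A] by (auto simp: convergent_def)
  qed
  \<comment> \<open>The absolute value makes \<open>f\<close> nonnegative at every point, including
    the null set where \<open>lim\<close> is arbitrary.\<close>
  define f where "f y = \<bar>lim (\<lambda>n. F n y)\<bar>" for y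
  have [measurable]: "f \<in> borel_measurable borel" unfolding f_def[abs_def] by measurable
  have lim: "AE y in lborel. (\<lambda>n. F n y) \<longlonglongrightarrow> f y"
    using conv
  proof eventually_elim
    case (elim y)
    then have l: "(\<lambda>n. F n y) \<longlonglongrightarrow> lim (\<lambda>n. F n y)" by (simp add: convergent_LIMSEQ_iff)
    have "0 \<le> lim (\<lambda>n. F n y)" by (rule LIMSEQ_le_const[OF l]) (use adm_nonneg[OF A] in auto)
    then show ?case using l by (simp add: f_def)
  qed
  have Ef: "renergy \<alpha> f \<le> d"
  proof -
    have "renergy \<alpha> f \<le> liminf (\<lambda>n. renergy \<alpha> (F n))"
      by (rule renergy_lsc[OF _ _ lim]) measurable
    also have "\<dots> \<le> liminf (\<lambda>n. d + ennreal (1 / Suc n))"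
    proof (intro Liminf_mono always_eventually allI)
      show "renergy \<alpha> (F n) \<le> d + ennreal (1 / Suc n)" for n using F[of n] by (simp add: C_def)
    qed
    also have "\<dots> = d"
    proof (rule lim_imp_Liminf)
      have "(\<lambda>n. 1 / real (Suc n)) \<longlonglongrightarrow> 0" using LIMSEQ_inverse_real_of_nat by (simp add: inverse_eq_divide)
      then have "(\<lambda>n. d + ennreal (1 / Suc n)) \<longlonglongrightarrow> d + ennreal 0"
        by (intro tendsto_add tendsto_const tendsto_ennrealI)
      then show "(\<lambda>n. d + ennreal (1 / Suc n)) \<longlonglongrightarrow> d" by simp
    qed simp
    finally show ?thesis .
  qed
  obtain M where M: "M \<ge> 0" "\<And>n. renergy \<alpha> (F n) \<le> ennreal M"
  proof -
    obtain r where r: "r \<ge> 0" "d = ennreal r" using d by (cases d) auto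
    have "renergy \<alpha> (F n) \<le> ennreal (r + 1)" for n
    proof -
      have "renergy \<alpha> (F n) \<le> d + ennreal (1 / Suc n)" using F[of n] by (simp add: C_def)
      also have "\<dots> \<le> ennreal r + ennreal 1" unfolding r by (intro add_left_mono ennreal_leI) simp
      finally show ?thesis using r by (simp add: ennreal_plus)
    qed
    then show ?thesis using that[of "r + 1"] r by simp
  qed
  have twice: "x \<le> 2 * x" for x :: ennreal by (simp add: mult_2)
  have gM: "gradE b (F n) \<le> ennreal M" if "b \<in> Basis" for b n
  proof -
    have "gradE b (F n) \<le> (\<Sum>b\<in>Basis. gradE b (F n))" using that by (intro member_le_sum) auto
    also have "\<dots> \<le> (\<Sum>b\<in>Basis. gradE b (F n)) + harm (F n)" by simp
    also have "\<dots> \<le> renergy \<alpha> (F n)" unfolding renergy_def by (rule order_trans[OF twice]) simp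
    finally show ?thesis using M(2) by (rule order_trans)
  qed
  have hM: "harm (F n) \<le> ennreal M" for n
  proof -
    have "harm (F n) \<le> (\<Sum>b\<in>Basis. gradE b (F n)) + harm (F n)" by simp
    also have "\<dots> \<le> renergy \<alpha> (F n)" unfolding renergy_def by (rule order_trans[OF twice]) simp
    finally show ?thesis using M(2) by (rule order_trans)
  qed
  have mf_le: "(\<integral>\<^sup>+x. sq f x \<partial>lborel) \<le> ennreal m"
  proof (rule fatou_le[where u = "\<lambda>n. sq (F n)"])
    show "AE x in lborel. (\<lambda>n. sq (F n) x) \<longlonglongrightarrow> sq f x"
      using lim unfolding sq_def by eventually_elim (intro tendsto_ennrealI tendsto_power)
  qed (use mF in auto)
  define \<mu> where "\<mu> = enn2real (\<integral>\<^sup>+x. sq f x \<partial>lborel)"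
  have \<mu>: "(\<integral>\<^sup>+x. sq f x \<partial>lborel) = ennreal \<mu>" "\<mu> \<ge> 0"
    using le_less_trans[OF mf_le] by (simp_all add: \<mu>_def)
  \<comment> \<open>The mass of \<open>F n\<close> is split into the density truncated at
    \<open>\<Lambda>\<close> on the ball of radius \<open>1 / \<delta>\<close>, the part above the
    threshold, and the part outside the ball, where \<open>1 \<le> (\<delta> |x|)^2\<close> brings
    in the harmonic term. The last two are of order \<open>\<delta>^2\<close> uniformly in
    \<open>n\<close>; the first passes to the limit by dominated convergence.\<close>
  have key: "m \<le> \<mu> + 4 * (4 ^ DIM('a) * (\<delta>\<^sup>2 * M)) + \<delta>\<^sup>2 * M" if \<delta>: "\<delta> > 0" for \<delta>
  proof -
    define \<Lambda> where "\<Lambda> = 4 * m / \<delta> ^ DIM('a)"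
    have \<Lambda>: "\<Lambda> > 0" using m \<delta> by (simp add: \<Lambda>_def)
    define B where "B = cball (0::'a) (1 / \<delta>)"
    have [measurable]: "B \<in> sets borel" by (simp add: B_def)
    let ?g = "\<lambda>n x. indicator B x * ennreal (min ((F n x)\<^sup>2) \<Lambda>)"
    have "ennreal m \<le> (\<integral>\<^sup>+x. ?g n x \<partial>lborel) + (ennreal (4 * (4 ^ DIM('a) * (\<delta>\<^sup>2 * M))) + ennreal (\<delta>\<^sup>2 * M))" for n
    proof -
      have "ennreal m \<le> (\<integral>\<^sup>+x. ?g n x + (sq (F n) x * indicator {x. (F n x)\<^sup>2 \<ge> \<Lambda>} x + ennreal (\<delta>\<^sup>2) * ennreal ((norm x)\<^sup>2 * (F n x)\<^sup>2)) \<partial>lborel)"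
        unfolding mF[symmetric, of n]
      proof (rule nn_integral_mono)
        fix x
        consider "(F n x)\<^sup>2 \<ge> \<Lambda>" | "(F n x)\<^sup>2 < \<Lambda>" "x \<in> B" | "x \<notin> B" by linarith
        then show "sq (F n) x \<le> ?g n x + (sq (F n) x * indicator {x. (F n x)\<^sup>2 \<ge> \<Lambda>} x + ennreal (\<delta>\<^sup>2) * ennreal ((norm x)\<^sup>2 * (F n x)\<^sup>2))"
        proof cases
          case 1
          then show ?thesis by (simp add: add_increasing add_increasing2)
        next
          case 2
          then show ?thesis by (simp add: sq_def min_def)
        next
          case 3
          then have "1 / \<delta> \<le> norm x" by (simp add: B_def)
          then have "1 \<le> \<delta> * norm x" using \<delta> by (simp add: field_simps)
          then have "1 \<le> (\<delta> * norm x)\<^sup>2" by (simp add: one_le_power)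
          then have "1 * (F n x)\<^sup>2 \<le> (\<delta> * norm x)\<^sup>2 * (F n x)\<^sup>2" by (rule mult_right_mono) simp
          then have "sq (F n) x \<le> ennreal (\<delta>\<^sup>2) * ennreal ((norm x)\<^sup>2 * (F n x)\<^sup>2)"
            by (simp add: sq_def power_mult_distrib mult.assoc ennreal_leI flip: ennreal_mult)
          then show ?thesis by (simp add: add_increasing)
        qed
      qed
      also have "\<dots> = (\<integral>\<^sup>+x. ?g n x \<partial>lborel) + ((\<integral>\<^sup>+x. sq (F n) x * indicator {x. (F n x)\<^sup>2 \<ge> \<Lambda>} x \<partial>lborel) + ennreal (\<delta>\<^sup>2) * harm (F n))"
        unfolding harm_def by (subst nn_integral_add; (subst nn_integral_add)?) (simp_all add: nn_integral_cmult)
      also have "\<dots> \<le> (\<integral>\<^sup>+x. ?g n x \<partial>lborel) + (ennreal (4 * (4 ^ DIM('a) * (\<delta>\<^sup>2 * M))) + ennreal (\<delta>\<^sup>2) * ennreal M)"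
        unfolding \<Lambda>_def using m
        by (intro add_left_mono add_mono mult_left_mono hM mass_concentration_le[OF adm_sqint[OF A] mF _ gM M(1) \<delta>]) auto
      finally show ?thesis using M by (simp add: ennreal_mult)
    qed
    moreover have "(\<lambda>n. (\<integral>\<^sup>+x. ?g n x \<partial>lborel)) \<longlonglongrightarrow> (\<integral>\<^sup>+x. indicator B x * ennreal (min ((f x)\<^sup>2) \<Lambda>) \<partial>lborel)"
    proof (rule nn_integral_dominated_convergence[where w = "\<lambda>x. ennreal \<Lambda> * indicator B x"])
      show "(\<integral>\<^sup>+x. ennreal \<Lambda> * indicator B x \<partial>lborel) < \<infinity>"
        using emeasure_lborel_cball_finite[of "0::'a" "1 / \<delta>"] by (subst nn_integral_cmult) (auto simp: B_def ennreal_mult_less_top)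
      show "AE x in lborel. (\<lambda>n. ?g n x) \<longlonglongrightarrow> indicator B x * ennreal (min ((f x)\<^sup>2) \<Lambda>)"
        using lim
      proof eventually_elim
        case (elim x)
        have "(\<lambda>n. ennreal (min ((F n x)\<^sup>2) \<Lambda>)) \<longlonglongrightarrow> ennreal (min ((f x)\<^sup>2) \<Lambda>)"
          by (intro tendsto_ennrealI tendsto_min tendsto_power tendsto_const elim)
        then show ?case by (cases "x \<in> B") auto
      qed
      show "AE x in lborel. ?g n x \<le> ennreal \<Lambda> * indicator B x" for n
        by (intro AE_I2) (auto simp: indicator_def intro!: ennreal_leI)
    qed measurable
    ultimately have "ennreal m \<le> (\<integral>\<^sup>+x. indicator B x * ennreal (min ((f x)\<^sup>2) \<Lambda>) \<partial>lborel) + (ennreal (4 * (4 ^ DIM('a) * (\<delta>\<^sup>2 * M))) + ennreal (\<delta>\<^sup>2 * M))"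
      by (intro LIMSEQ_le_const[OF tendsto_add[OF _ tendsto_const]]) auto
    also have "\<dots> \<le> (\<integral>\<^sup>+x. sq f x \<partial>lborel) + (ennreal (4 * (4 ^ DIM('a) * (\<delta>\<^sup>2 * M))) + ennreal (\<delta>\<^sup>2 * M))"
      by (intro add_right_mono nn_integral_mono) (auto simp: sq_def indicator_def intro!: ennreal_leI)
    also have "\<dots> = ennreal (\<mu> + 4 * (4 ^ DIM('a) * (\<delta>\<^sup>2 * M)) + \<delta>\<^sup>2 * M)"
      using \<mu> M by (simp add: ennreal_plus[symmetric] add.assoc del: ennreal_plus)
    finally show ?thesis using \<mu>(2) M by (subst (asm) ennreal_le_iff) auto
  qed
  have "m \<le> \<mu>"
  proof (rule LIMSEQ_le_const)
    have z: "(\<lambda>n. (inverse (real (Suc n)))\<^sup>2) \<longlonglongrightarrow> 0\<^sup>2" by (intro tendsto_power LIMSEQ_inverse_real_of_nat)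
    have "(\<lambda>n. \<mu> + 4 * (4 ^ DIM('a) * ((inverse (real (Suc n)))\<^sup>2 * M)) + (inverse (real (Suc n)))\<^sup>2 * M) \<longlonglongrightarrow> \<mu> + 4 * (4 ^ DIM('a) * (0\<^sup>2 * M)) + 0\<^sup>2 * M"
      by (intro tendsto_add tendsto_mult tendsto_const z)
    then show "(\<lambda>n. \<mu> + 4 * (4 ^ DIM('a) * ((inverse (real (Suc n)))\<^sup>2 * M)) + (inverse (real (Suc n)))\<^sup>2 * M) \<longlonglongrightarrow> \<mu>" by simp
    show "\<exists>N. \<forall>n\<ge>N. m \<le> \<mu> + 4 * (4 ^ DIM('a) * ((inverse (real (Suc n)))\<^sup>2 * M)) + (inverse (real (Suc n)))\<^sup>2 * M"
      by (intro exI[of _ 0] allI impI key) simp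
  qed
  then have "(\<integral>\<^sup>+x. sq f x \<partial>lborel) = ennreal m"
    using mf_le \<mu> by (intro antisym) (auto intro: ennreal_leI)
  then have "adm m f" by (simp add: adm_def f_def)
  show ?thesis
  proof (intro exI[of _ f] conjI allI impI \<open>adm m f\<close>)
    show "renergy \<alpha> f < \<infinity>" using Ef d by (rule le_less_trans)
    show "renergy \<alpha> f \<le> renergy \<alpha> g" if "adm m g" for g :: "'a \<Rightarrow> real"
      using Ef d_le[OF that] by (rule order_trans)
  qed
qed

subsection \<open>Positivity of the minimizer\<close>

text \<open>Up to the factor \<open>(1 - t) * t / h^2\<close> this is the integrand of the deficit
  in \<open>mix_dq_deficit\<close>. Its numerator vanishes when the ratio of \<open>f\<close> to
  \<open>g\<close> agrees at both points, so it measures the variation of that ratio.\<close>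

definition mix_deficit :: "real \<Rightarrow> 'a::euclidean_space \<Rightarrow> real \<Rightarrow> ('a \<Rightarrow> real) \<Rightarrow> ('a \<Rightarrow> real) \<Rightarrow> 'a \<Rightarrow> real" where
  "mix_deficit t b h f g x = (f x * g (x + h *\<^sub>R b) - f (x + h *\<^sub>R b) * g x)\<^sup>2 /
     (mix t f g x * mix t f g (x + h *\<^sub>R b))"

lemma mix_deficit_measurable [measurable]:
  assumes [measurable]: "f \<in> borel_measurable borel" "g \<in> borel_measurable borel"
  shows "mix_deficit t b h f g \<in> borel_measurable borel"
  unfolding mix_deficit_def[abs_def] by measurable

text \<open>Minimality of \<open>f\<close> against \<open>mix t f \<phi>\<close>, whose energy is at most
  \<open>(1 - t) E f + t const\<close> minus the deficit, bounds the deficit by a constant times \<open>t\<close>.\<close>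

lemma minimizer_deficit_bounded:
  fixes f \<phi> :: "'a::euclidean_space \<Rightarrow> real"
  assumes \<alpha>: "0 < \<alpha>" "\<alpha> < real DIM('a)" and m: "m > 0"
    and f: "adm m f" "renergy \<alpha> f < \<infinity>" and min: "\<And>g :: 'a \<Rightarrow> real. adm m g \<Longrightarrow> renergy \<alpha> f \<le> renergy \<alpha> g"
    and \<phi>: "\<phi> \<in> test_functions" "adm m \<phi>"
  shows "\<exists>K\<ge>0. \<forall>t b H. 0 < t \<and> t \<le> 1/2 \<and> b \<in> Basis \<and> H > 0 \<longrightarrow>
    (\<exists>k. (\<integral>\<^sup>+x. ennreal (mix_deficit t b (H / 2^k) f \<phi> x / (H / 2^k)\<^sup>2) \<partial>lborel) \<le> ennreal K)"
proof -
  note [measurable] = adm_measurable[OF f(1)] adm_measurable[OF \<phi>(2)]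
  let ?Df = "dbl \<alpha> (sq f) (sq f)" and ?Dc = "dbl \<alpha> (sq f) (sq \<phi>)" and ?D\<phi> = "dbl \<alpha> (sq \<phi>) (sq \<phi>)"
  let ?G = "\<lambda>b. gradE b f" and ?P = "\<lambda>b. gradE b \<phi>"
  \<comment> \<open>Everything that enters the energy comparison with a factor \<open>t\<close>: the
    terms of \<open>\<phi>\<close>, the cross term, and 2 for the slack \<open>t\<close> in the
    choice of the step size. Nothing in it depends on \<open>t\<close>, \<open>b\<close> or
    \<open>H\<close>.\<close>
  define K where "K = 2 * (\<Sum>b\<in>Basis. ?P b) + 2 + 2 * harm \<phi> + (2 * ?Dc + ?D\<phi>)"
  have "?Dc = dbl \<alpha> (sq \<phi>) (sq f)" by (rule dbl_commute) measurable
  then have K: "K < \<infinity>"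
    using test_gradE_finite[OF \<phi>(1)] test_harm_finite[OF \<phi>(1)] dbl_test_finite[OF \<alpha> \<phi>(1) adm_sqint[OF f(1)]]
      dbl_test_finite[OF \<alpha> \<phi>(1) adm_sqint[OF \<phi>(2)]]
    by (simp add: K_def ennreal_mult_less_top)
  have "\<exists>k. (\<integral>\<^sup>+x. ennreal (mix_deficit t b (H / 2^k) f \<phi> x / (H / 2^k)\<^sup>2) \<partial>lborel) \<le> K"
    if t: "0 < t" "t \<le> 1/2" and b: "b \<in> Basis" and H: "H > 0" for t b H
  proof -
    have t01: "0 \<le> t" "t \<le> 1" using t by auto
    let ?M = "mix t f \<phi>" and ?p = "ennreal (1 - t)" and ?q = "ennreal t"
    define h where "h k = H / 2^k" for k :: nat
    have h: "h k > 0" for k using H by (simp add: h_def)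
    have h0: "h \<longlonglongrightarrow> 0"
    proof -
      have "(\<lambda>k. H * (1/2)^k) \<longlonglongrightarrow> H * 0" by (intro tendsto_mult tendsto_const LIMSEQ_power_zero) simp
      then show ?thesis by (simp add: h_def[abs_def] power_one_over)
    qed
    have aM: "adm m ?M" using adm_mix[OF f(1) \<phi>(2) t01] m by simp
    have Tle: "gradE c ?M \<le> ?p * ?G c + ?q * ?P c" for c by (rule gradE_mix_le[OF _ _ t01]) measurable
    have Gfin: "?G c < \<infinity>" if "c \<in> Basis" for c
    proof -
      have "?G c \<le> (\<Sum>b\<in>Basis. ?G b)" using that by (intro member_le_sum) auto
      also have "\<dots> < \<infinity>" using f(2) by (auto simp: renergy_def ennreal_mult_less_top)
      finally show ?thesis .
    qed
    have Tfin: "gradE b ?M < \<infinity>"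
      using Tle[of b] Gfin[OF b] test_gradE_finite[OF \<phi>(1) b] by (auto intro: le_less_trans simp: ennreal_mult_less_top)
    \<comment> \<open>The deficit belongs to one step size, minimality to the supremum
      \<open>gradE\<close>. By \<open>gradE_leI\<close> some \<open>h k\<close> attains the supremum
      up to \<open>t\<close>, and an error of this order is harmless because the bound aimed at is
      itself of order \<open>t\<close>.\<close>
    have "\<exists>k. gradE b ?M \<le> dq b (h k) ?M + ?q"
    proof (rule ccontr)
      assume "\<not> ?thesis"
      then have lt: "dq b (h k) ?M + ?q < gradE b ?M" for k by (auto simp: not_le)
      obtain r where r: "r \<ge> 0" "gradE b ?M = ennreal r" using Tfin by (cases "gradE b ?M") auto
      have dqr: "dq b (h k) ?M \<le> ennreal (r - t)" for k
      proof (cases "dq b (h k) ?M")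
        case (real s)
        have "ennreal (s + t) < ennreal r" using lt[of k] real r t by (simp add: ennreal_plus)
        then have "s + t < r" by (subst (asm) ennreal_less_iff) (use real t in auto)
        then show ?thesis using real by (simp add: ennreal_leI)
      next
        case top
        then show ?thesis using lt[of k] by simp
      qed
      have "gradE b ?M \<le> ennreal (r - t)" by (rule gradE_leI[OF adm_sqint[OF aM] b h h0 dqr])
      moreover have "t < r" using lt[of 0] r t by (metis add_increasing ennreal_less_iff le_less_trans order_refl zero_le less_imp_le)
      ultimately show False using r t by simp
    qed
    then obtain k where k: "gradE b ?M \<le> dq b (h k) ?M + ?q" by blast
    define R where "R = (\<integral>\<^sup>+x. ennreal (mix_deficit t b (h k) f \<phi> x / (h k)\<^sup>2) \<partial>lborel)"
    have R': "(\<integral>\<^sup>+x. ennreal ((1 - t) * t * ((f x * \<phi> (x + h k *\<^sub>R b) - f (x + h k *\<^sub>R b) * \<phi> x)\<^sup>2 / (?M x * ?M (x + h k *\<^sub>R b))) / (h k)\<^sup>2) \<partial>lborel) = ?p * ?q * R"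
    proof -
      have "ennreal ((1 - t) * t * ((f x * \<phi> (x + h k *\<^sub>R b) - f (x + h k *\<^sub>R b) * \<phi> x)\<^sup>2 / (?M x * ?M (x + h k *\<^sub>R b))) / (h k)\<^sup>2)
        = ?p * ?q * ennreal (mix_deficit t b (h k) f \<phi> x / (h k)\<^sup>2)" for x
      proof -
        have "0 \<le> mix_deficit t b (h k) f \<phi> x / (h k)\<^sup>2"
          unfolding mix_deficit_def by (intro divide_nonneg_nonneg mult_nonneg_nonneg mix_nonneg t01) simp_all
        moreover have "0 \<le> p \<Longrightarrow> 0 \<le> q \<Longrightarrow> 0 \<le> y \<Longrightarrow> ennreal p * ennreal q * ennreal y = ennreal (p * q * y)" for p q y
          by (simp add: ennreal_mult)
        ultimately have "?p * ?q * ennreal (mix_deficit t b (h k) f \<phi> x / (h k)\<^sup>2) = ennreal ((1 - t) * t * (mix_deficit t b (h k) f \<phi> x / (h k)\<^sup>2))"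
          using t01 by simp
        then show ?thesis by (simp add: mix_deficit_def)
      qed
      then show ?thesis unfolding R_def by (subst nn_integral_cmult[symmetric]) simp_all
    qed
    have "dq b (h k) ?M + ?p * ?q * R \<le> ?p * dq b (h k) f + ?q * dq b (h k) \<phi>"
      using mix_dq_deficit[OF adm_measurable[OF f(1)] adm_measurable[OF \<phi>(2)] t01, of b "h k"] unfolding R' .
    also have "\<dots> \<le> ?p * ?G b + ?q * ?P b"
      by (intro add_mono mult_left_mono dq_le_gradE adm_sqint[OF f(1)] adm_sqint[OF \<phi>(2)] b h) simp_all
    finally have 1: "dq b (h k) ?M + ?p * ?q * R \<le> ?p * ?G b + ?q * ?P b" .
    have 2: "gradE b ?M + ?p * ?q * R \<le> ?p * ?G b + ?q * ?P b + ?q"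
    proof -
      have "gradE b ?M + ?p * ?q * R \<le> (dq b (h k) ?M + ?q) + ?p * ?q * R" by (intro add_right_mono k)
      also have "\<dots> = (dq b (h k) ?M + ?p * ?q * R) + ?q" by (simp only: add_ac)
      also have "\<dots> \<le> ?p * ?G b + ?q * ?P b + ?q" by (intro add_right_mono 1)
      finally show ?thesis .
    qed
    have 3: "(\<Sum>c\<in>Basis. gradE c ?M) + ?p * ?q * R \<le> ?p * (\<Sum>c\<in>Basis. ?G c) + ?q * (\<Sum>c\<in>Basis. ?P c) + ?q"
    proof -
      have "(\<Sum>c\<in>Basis. gradE c ?M) + ?p * ?q * R = (gradE b ?M + ?p * ?q * R) + (\<Sum>c\<in>Basis - {b}. gradE c ?M)"
        using b by (subst sum.remove[OF finite_Basis b]) (simp add: add_ac)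
      also have "\<dots> \<le> (?p * ?G b + ?q * ?P b + ?q) + (\<Sum>c\<in>Basis - {b}. ?p * ?G c + ?q * ?P c)"
        by (intro add_mono sum_mono 2 Tle)
      also have "\<dots> = (\<Sum>c\<in>Basis. ?p * ?G c + ?q * ?P c) + ?q"
        unfolding sum.remove[OF finite_Basis b, of "\<lambda>c. ?p * ?G c + ?q * ?P c"] by (simp only: add_ac)
      finally show ?thesis by (simp add: sum.distrib sum_distrib_left)
    qed
    have D: "dbl \<alpha> (sq ?M) (sq ?M) \<le> ?p * ?Df + ?q * (2 * ?Dc + ?D\<phi>)"
    proof -
      have "(1 - t)\<^sup>2 \<le> 1 - t" "t\<^sup>2 \<le> t" "2 * (t * (1 - t)) \<le> t * 2"
        using t mult_left_le[of "1 - t" "1 - t"] mult_left_le[of t t] mult_left_le[of "1 - t" t] by (simp_all add: power2_eq_square)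
      then have "ennreal ((1 - t)\<^sup>2) \<le> ?p" "ennreal (t\<^sup>2) \<le> ?q" "ennreal (2 * (t * (1 - t))) \<le> ennreal (t * 2)"
        by (simp_all only: ennreal_leI)
      moreover have "ennreal (t * 2) = ?q * 2" using t by (simp add: ennreal_mult)
      ultimately have "ennreal ((1 - t)\<^sup>2) \<le> ?p" "ennreal (t\<^sup>2) \<le> ?q" "ennreal (2 * (t * (1 - t))) \<le> ?q * 2" by simp_all
      then have "dbl \<alpha> (sq ?M) (sq ?M) \<le> ?p * ?Df + ?q * 2 * ?Dc + ?q * ?D\<phi>"
        unfolding dbl_mix[OF adm_measurable[OF f(1)] adm_measurable[OF \<phi>(2)] t01]
        by (intro add_mono mult_right_mono) simp_all
      then show ?thesis by (simp add: distrib_left add.assoc mult.assoc)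
    qed
    let ?W = "2 * (?p * ?q * R)"
    have "renergy \<alpha> f + ?W \<le> renergy \<alpha> ?M + ?W" by (intro add_right_mono min aM)
    also have "\<dots> = 2 * (((\<Sum>c\<in>Basis. gradE c ?M) + ?p * ?q * R) + harm ?M) + dbl \<alpha> (sq ?M) (sq ?M)"
      unfolding renergy_def by (simp only: distrib_left add_ac)
    also have "\<dots> \<le> 2 * ((?p * (\<Sum>c\<in>Basis. ?G c) + ?q * (\<Sum>c\<in>Basis. ?P c) + ?q) + (?p * harm f + ?q * harm \<phi>)) + (?p * ?Df + ?q * (2 * ?Dc + ?D\<phi>))"
      by (intro add_mono mult_left_mono 3 D order_refl eq_refl[OF harm_mix[OF _ _ t01]]) simp_all
    also have "\<dots> = ?p * renergy \<alpha> f + ?q * K"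
    proof -
      have "2 * ((p * S + q * T + q) + (p * x + q * y)) + (p * u + q * w) = p * (2 * (S + x) + u) + q * (2 * T + 2 + 2 * y + w)"
        for p q S T x y u w :: ennreal by (simp add: algebra_simps)
      then show ?thesis unfolding renergy_def K_def .
    qed
    also have "\<dots> \<le> 1 * renergy \<alpha> f + ?q * K"
      using t by (intro add_right_mono mult_right_mono) (simp_all add: ennreal_le_1)
    finally have "renergy \<alpha> f + ?W \<le> renergy \<alpha> f + ?q * K" by simp
    then have W: "?W \<le> ?q * K" using f(2) by (auto simp: ennreal_add_left_cancel_le)
    have "?q * R \<le> (2 * ?p) * (?q * R)"
    proof -
      have "1 \<le> 2 * ?p"
      proof -
        have "1 = ennreal 1" by simp
        also have "\<dots> \<le> ennreal (2 * (1 - t))" using t by (intro ennreal_leI) simp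
        also have "\<dots> = 2 * ?p" using t by (subst ennreal_mult) simp_all
        finally show ?thesis .
      qed
      then have "1 * (?q * R) \<le> (2 * ?p) * (?q * R)" by (rule mult_right_mono) simp
      then show ?thesis by simp
    qed
    also have "\<dots> = ?W" by (simp only: mult_ac)
    finally have "?q * R \<le> ?q * K" using W by (rule order_trans)
    then have "R \<le> K" using t by (subst (asm) ennreal_mult_le_mult_iff) (auto simp: ennreal_eq_0_iff)
    then show ?thesis unfolding R_def h_def by blast
  qed
  then show ?thesis using K by (intro exI[of _ "enn2real K"]) auto
qed

text \<open>With \<open>s = sqrt (u / v) \<ge> 1\<close> the right side is
  \<open>4 (s - 1/s)^2\<close>, and
  \<open>ln u - ln v = 2 ln s \<le> 2 (s - 1) \<le> 2 (s - 1/s)\<close>.\<close>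

lemma ln_diff_sq_le:
  fixes u v :: real
  assumes "u > 0" "v > 0"
  shows "(ln u - ln v)\<^sup>2 \<le> 4 * ((u - v)\<^sup>2 / (u * v))"
proof -
  have *: "(ln u - ln v)\<^sup>2 \<le> 4 * ((u - v)\<^sup>2 / (u * v))" if uv: "v > 0" "u \<ge> v" for u v :: real
  proof -
    define s where "s = sqrt (u / v)"
    have u: "u > 0" using uv by simp
    have s: "s \<ge> 1" using uv by (simp add: s_def)
    have s2: "s\<^sup>2 = u / v" using uv u by (simp add: s_def)
    have "ln u - ln v = ln (s\<^sup>2)" using uv u by (simp add: s2 ln_div)
    also have "\<dots> = 2 * ln s" using s by (simp add: ln_realpow)
    also have "\<dots> \<le> 2 * (s - 1)" using ln_le_minus_one[of s] s by simp
    also have "s - 1 \<le> s - 1 / s" using s by (simp add: divide_le_eq)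
    finally have "ln u - ln v \<le> 2 * (s - 1 / s)" by simp
    moreover have "0 \<le> ln u - ln v" using uv u by simp
    ultimately have "(ln u - ln v)\<^sup>2 \<le> (2 * (s - 1 / s))\<^sup>2" by (intro power_mono)
    also have "\<dots> = 4 * (s\<^sup>2 + 1 / s\<^sup>2 - 2)" using s by (simp add: power2_eq_square field_simps)
    also have "s\<^sup>2 + 1 / s\<^sup>2 - 2 = (u - v)\<^sup>2 / (u * v)"
      unfolding s2 using uv u by (simp add: power2_eq_square field_simps)
    finally show ?thesis .
  qed
  show ?thesis
  proof (cases "u \<ge> v")
    case True
    then show ?thesis using *[of v u] assms by simp
  next
    case False
    then show ?thesis using *[of u v] assms by (simp add: power2_commute[of "ln u"] power2_commute[of u] mult.commute)
  qed
qed

text \<open>The shift \<open>sqrt t\<close> inside the logarithm is matched to the mixture: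
  \<open>sqrt ((1 - t) a^2 + t b^2) \<le> a + sqrt t * b = b * (a / b + sqrt t)\<close>. Hence the
  constant \<open>4 / c^2\<close> is independent of \<open>t\<close>.\<close>

lemma ln_ratio_diff_sq_le_deficit:
  fixes a a' b b' c t :: real
  assumes a: "a \<ge> 0" "a' \<ge> 0" and b: "b \<ge> c" "b' \<ge> c" and c: "c > 0" and t: "0 < t" "t \<le> 1"
  shows "(ln (a / b + sqrt t) - ln (a' / b' + sqrt t))\<^sup>2 \<le>
    4 / c\<^sup>2 * ((a * b' - a' * b)\<^sup>2 / (sqrt ((1 - t) * a\<^sup>2 + t * b\<^sup>2) * sqrt ((1 - t) * a'\<^sup>2 + t * b'\<^sup>2)))"
proof -
  define e where "e = sqrt t"
  have e: "e > 0" "e\<^sup>2 = t" using t by (auto simp: e_def)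
  have bp: "b > 0" "b' > 0" using b c by auto
  have rho: "sqrt ((1 - t) * a\<^sup>2 + t * b\<^sup>2) \<le> a + e * b" if "a \<ge> 0" "b > 0" for a b
  proof (rule real_le_lsqrt)
    have "(1 - t) * a\<^sup>2 \<le> 1 * a\<^sup>2" using t by (intro mult_right_mono) auto
    moreover have "(a + e * b)\<^sup>2 = a\<^sup>2 + t * b\<^sup>2 + 2 * (a * (e * b))" unfolding e(2)[symmetric] by (simp add: power2_eq_square algebra_simps)
    moreover have "0 \<le> a * (e * b)" using that e by simp
    ultimately show "(1 - t) * a\<^sup>2 + t * b\<^sup>2 \<le> (a + e * b)\<^sup>2" by linarith
  qed (use that e in auto)
  have rpos: "0 < sqrt ((1 - t) * a\<^sup>2 + t * b\<^sup>2)" if "b > 0" for a b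
    using that t by (intro real_sqrt_gt_zero add_nonneg_pos) auto
  let ?r = "sqrt ((1 - t) * a\<^sup>2 + t * b\<^sup>2)" and ?r' = "sqrt ((1 - t) * a'\<^sup>2 + t * b'\<^sup>2)"
  let ?u = "a / b + e" and ?v = "a' / b' + e"
  have uv: "?u > 0" "?v > 0" using a bp e by (auto intro!: add_nonneg_pos)
  have "(ln ?u - ln ?v)\<^sup>2 \<le> 4 * ((?u - ?v)\<^sup>2 / (?u * ?v))" by (rule ln_diff_sq_le[OF uv])
  also have "(?u - ?v)\<^sup>2 / (?u * ?v) = (a * b' - a' * b)\<^sup>2 / ((b * b') * ((a + e * b) * (a' + e * b')))"
  proof -
    have "?u - ?v = (a * b' - a' * b) / (b * b')" using bp by (simp add: field_simps)
    moreover have "?u = (a + e * b) / b" "?v = (a' + e * b') / b'" using bp by (auto simp: field_simps)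
    ultimately show ?thesis using bp by (simp add: power_divide power2_eq_square)
  qed
  also have "\<dots> \<le> (a * b' - a' * b)\<^sup>2 / (c\<^sup>2 * (?r * ?r'))"
  proof (rule divide_left_mono)
    have f1: "c\<^sup>2 \<le> b * b'" using b c bp by (simp add: power2_eq_square mult_mono)
    have f2: "?r * ?r' \<le> (a + e * b) * (a' + e * b')"
      using rho[OF a(1) bp(1)] rho[OF a(2) bp(2)] rpos[OF bp(1), of a] rpos[OF bp(2), of a'] by (intro mult_mono) linarith+
    show "c\<^sup>2 * (?r * ?r') \<le> (b * b') * ((a + e * b) * (a' + e * b'))"
      by (rule mult_mono[OF f1 f2]) (use rpos[OF bp(1), of a] rpos[OF bp(2), of a'] bp in auto)
    have "0 < a + e * b" "0 < a' + e * b'" using a bp e by (auto intro!: add_nonneg_pos)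
    then show "0 < (b * b') * ((a + e * b) * (a' + e * b')) * (c\<^sup>2 * (?r * ?r'))"
      using rpos[OF bp(1), of a] rpos[OF bp(2), of a'] bp c by (intro mult_pos_pos) auto
  qed simp
  finally show ?thesis by (simp add: e_def)
qed

text \<open>Telescoping over \<open>2\<^sup>k\<close> steps; the bound is uniform in \<open>t\<close>, while \<open>ln (f / \<phi> + sqrt t)\<close> tends to
  \<open>-\<infinity>\<close> on the zero set of \<open>f\<close>.\<close>

lemma minimizer_zero_set_null:
  fixes f \<phi> :: "'a::euclidean_space \<Rightarrow> real"
  assumes f: "adm m f" and \<phi>: "\<phi> \<in> test_functions" "\<And>x. 0 \<le> \<phi> x"
    and K: "K \<ge> 0" "\<And>t. 0 < t \<Longrightarrow> t \<le> 1/2 \<Longrightarrow>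
      \<exists>k. (\<integral>\<^sup>+x. ennreal (mix_deficit t b (H / 2^k) f \<phi> x / (H / 2^k)\<^sup>2) \<partial>lborel) \<le> ennreal K"
    and H: "H > 0" and c: "c > 0" and B [measurable]: "B \<in> sets borel"
    and cB: "\<And>x s. x \<in> B \<Longrightarrow> 0 \<le> s \<Longrightarrow> s \<le> H \<Longrightarrow> c \<le> \<phi> (x + s *\<^sub>R b)" and \<eta>: "\<eta> > 0"
  shows "AE x in lborel. x \<in> B \<longrightarrow> \<not> (f x = 0 \<and> f (x + H *\<^sub>R b) \<ge> \<eta> * \<phi> (x + H *\<^sub>R b) \<or>
    f (x + H *\<^sub>R b) = 0 \<and> f x \<ge> \<eta> * \<phi> x)"
proof -
  note [measurable] = adm_measurable[OF f] test_measurable[OF \<phi>(1)]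
  define A where "A = {x. x \<in> B \<and> (f x = 0 \<and> f (x + H *\<^sub>R b) \<ge> \<eta> * \<phi> (x + H *\<^sub>R b) \<or> f (x + H *\<^sub>R b) = 0 \<and> f x \<ge> \<eta> * \<phi> x)}"
  have [measurable]: "A \<in> sets borel" unfolding A_def by measurable
  \<comment> \<open>With \<open>n = 2^k\<close> steps of length \<open>h = H / n\<close>,
    Cauchy-Schwarz over the increments costs a factor \<open>n\<close>, summing \<open>n\<close>
    translates of one integral costs another, and \<open>h^2\<close> cancels both. This matters
    because \<open>k\<close> depends on \<open>t\<close> in an uncontrolled way.\<close>
  define C where "C = H\<^sup>2 * (4 / c\<^sup>2) * K"
  have bound: "ennreal ((ln (\<eta> / sqrt t))\<^sup>2) * emeasure lborel A \<le> ennreal C"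
    if t: "0 < t" "t \<le> 1/2" "sqrt t < \<eta>" for t
  proof -
    obtain k where k: "(\<integral>\<^sup>+x. ennreal (mix_deficit t b (H / 2^k) f \<phi> x / (H / 2^k)\<^sup>2) \<partial>lborel) \<le> ennreal K"
      using K(2)[OF t(1,2)] by blast
    define n :: nat where "n = 2^k"
    have n: "n > 0" by (simp add: n_def)
    define h where "h = H / n"
    have h: "h > 0" using H n by (simp add: h_def)
    have k: "(\<integral>\<^sup>+x. ennreal (mix_deficit t b h f \<phi> x / h\<^sup>2) \<partial>lborel) \<le> ennreal K"
      using k by (simp add: h_def n_def)
    let ?X = "mix_deficit t b h f \<phi>"
    have X0: "0 \<le> ?X x" for x
      unfolding mix_deficit_def using t by (intro divide_nonneg_nonneg mult_nonneg_nonneg mix_nonneg) auto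
    define L where "L x = ln (f x / \<phi> x + sqrt t)" for x
    have pt: "ennreal ((ln (\<eta> / sqrt t))\<^sup>2) * indicator A x \<le> (\<Sum>j<n. ennreal (n * (4 / c\<^sup>2)) * ennreal (?X (x + (j * h) *\<^sub>R b)))" for x
    proof (cases "x \<in> A")
      case True
      then have xB: "x \<in> B" by (simp add: A_def)
      have s: "c \<le> \<phi> (x + (real j * h) *\<^sub>R b)" if "j \<le> n" for j
      proof (rule cB[OF xB])
        have "real j * h \<le> real n * h" using that h by (intro mult_right_mono) auto
        then show "real j * h \<le> H" using n by (simp add: h_def)
      qed (use h in simp)
      have nh: "real n * h = H" using n by (simp add: h_def)
      have step: "(L (x + (real (Suc j) * h) *\<^sub>R b) - L (x + (real j * h) *\<^sub>R b))\<^sup>2 \<le> 4 / c\<^sup>2 * ?X (x + (j * h) *\<^sub>R b)" if "j < n" for j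
      proof -
        have e: "x + (real (Suc j) * h) *\<^sub>R b = x + (j * h) *\<^sub>R b + h *\<^sub>R b" by (simp add: algebra_simps)
        show ?thesis
          using ln_ratio_diff_sq_le_deficit[OF adm_nonneg[OF f] adm_nonneg[OF f] s[of j] s[of "Suc j"] c t(1), of "x + (j * h) *\<^sub>R b" "x + (real (Suc j) * h) *\<^sub>R b"] that t
          unfolding L_def mix_deficit_def mix_def e by (simp add: power2_commute[of "ln (f (x + (j * h) *\<^sub>R b + h *\<^sub>R b) / _ + _)"])
      qed
      have end1: "\<phi> x \<ge> c" "\<phi> (x + H *\<^sub>R b) \<ge> c" using cB[OF xB, of 0] cB[OF xB, of H] H by auto
      \<comment> \<open>On \<open>A\<close> the function \<open>L\<close> equals
        \<open>ln (sqrt t)\<close> at the end where \<open>f\<close> vanishes and is at least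
        \<open>ln \<eta>\<close> at the other end.\<close>
      have "(ln (\<eta> / sqrt t))\<^sup>2 \<le> (L (x + H *\<^sub>R b) - L x)\<^sup>2"
      proof -
        have l: "0 \<le> ln (\<eta> / sqrt t)" using t by simp
        have aux: "ln (\<eta> / sqrt t) \<le> ln (u / v + sqrt t) - ln (0 / w + sqrt t)" if "u \<ge> \<eta> * v" "v \<ge> c" for u v w
        proof -
          have "\<eta> \<le> u / v" using that c by (simp add: le_divide_eq)
          then have "ln \<eta> \<le> ln (u / v + sqrt t)" using \<eta> t by (intro ln_mono) (auto intro: add_increasing2 add_pos_nonneg)
          then show ?thesis using t \<eta> by (simp add: ln_div)
        qed
        from True consider "f x = 0" "f (x + H *\<^sub>R b) \<ge> \<eta> * \<phi> (x + H *\<^sub>R b)" | "f (x + H *\<^sub>R b) = 0" "f x \<ge> \<eta> * \<phi> x"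
          by (auto simp: A_def)
        then show ?thesis
        proof cases
          case 1
          then show ?thesis using aux[OF 1(2) end1(2), of "\<phi> x"] l unfolding L_def by (intro power_mono) auto
        next
          case 2
          then show ?thesis using aux[OF 2(2) end1(1), of "\<phi> (x + H *\<^sub>R b)"] l unfolding L_def
            by (subst power2_commute, intro power_mono) auto
        qed
      qed
      also have "L (x + H *\<^sub>R b) - L x = (\<Sum>j<n. L (x + (real (Suc j) * h) *\<^sub>R b) - L (x + (real j * h) *\<^sub>R b))"
        using sum_lessThan_telescope[of "\<lambda>j. L (x + (real j * h) *\<^sub>R b)" n] nh by simp
      also have "\<dots>\<^sup>2 \<le> (\<Sum>j<n. (L (x + (real (Suc j) * h) *\<^sub>R b) - L (x + (real j * h) *\<^sub>R b))\<^sup>2) * card {..<n}"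
        by (rule sum_squared_le_sum_of_squares)
      also have "\<dots> \<le> (\<Sum>j<n. 4 / c\<^sup>2 * ?X (x + (j * h) *\<^sub>R b)) * card {..<n}"
        by (intro mult_right_mono sum_mono step) auto
      also have "\<dots> = (\<Sum>j<n. (n * (4 / c\<^sup>2)) * ?X (x + (j * h) *\<^sub>R b))"
        by (simp add: sum_distrib_left sum_distrib_right mult_ac)
      finally have "(ln (\<eta> / sqrt t))\<^sup>2 \<le> (\<Sum>j<n. (n * (4 / c\<^sup>2)) * ?X (x + (j * h) *\<^sub>R b))" .
      then have "ennreal ((ln (\<eta> / sqrt t))\<^sup>2) \<le> ennreal (\<Sum>j<n. (n * (4 / c\<^sup>2)) * ?X (x + (j * h) *\<^sub>R b))"
        by (rule ennreal_leI)
      also have "\<dots> = (\<Sum>j<n. ennreal ((n * (4 / c\<^sup>2)) * ?X (x + (j * h) *\<^sub>R b)))"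
        by (rule sum_ennreal[symmetric]) (intro mult_nonneg_nonneg X0, simp_all)
      also have "\<dots> = (\<Sum>j<n. ennreal (n * (4 / c\<^sup>2)) * ennreal (?X (x + (j * h) *\<^sub>R b)))"
        by (intro sum.cong refl ennreal_mult X0) simp
      finally show ?thesis using True by simp
    qed simp
    have "ennreal ((ln (\<eta> / sqrt t))\<^sup>2) * emeasure lborel A = (\<integral>\<^sup>+x. ennreal ((ln (\<eta> / sqrt t))\<^sup>2) * indicator A x \<partial>lborel)"
      by (subst nn_integral_cmult_indicator) auto
    also have "\<dots> \<le> (\<integral>\<^sup>+x. (\<Sum>j<n. ennreal (n * (4 / c\<^sup>2)) * ennreal (?X (x + (j * h) *\<^sub>R b))) \<partial>lborel)"
      by (intro nn_integral_mono pt)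
    also have "\<dots> = (\<Sum>j<n. ennreal (n * (4 / c\<^sup>2)) * (\<integral>\<^sup>+x. ennreal (?X (x + (j * h) *\<^sub>R b)) \<partial>lborel))"
      by (subst nn_integral_sum) (simp_all add: nn_integral_cmult)
    also have "\<dots> = (\<Sum>j<n. ennreal (n * (4 / c\<^sup>2)) * (\<integral>\<^sup>+x. ennreal (?X x) \<partial>lborel))"
      by (subst nn_integral_lborel_translate[of "\<lambda>x. ennreal (?X x)"]) simp_all
    also have "(\<integral>\<^sup>+x. ennreal (?X x) \<partial>lborel) = ennreal (h\<^sup>2) * (\<integral>\<^sup>+x. ennreal (?X x / h\<^sup>2) \<partial>lborel)"
      using h X0 by (subst nn_integral_cmult[symmetric]) (auto simp flip: ennreal_mult)
    also have "(\<Sum>j<n. ennreal (n * (4 / c\<^sup>2)) * (ennreal (h\<^sup>2) * (\<integral>\<^sup>+x. ennreal (?X x / h\<^sup>2) \<partial>lborel))) \<le> (\<Sum>j<n. ennreal (n * (4 / c\<^sup>2)) * (ennreal (h\<^sup>2) * ennreal K))"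
      by (intro sum_mono mult_left_mono k) simp_all
    also have "\<dots> = ennreal (real n * (n * (4 / c\<^sup>2) * (h\<^sup>2 * K)))"
      using K(1) by (simp add: ennreal_of_nat_eq_real_of_nat flip: ennreal_mult)
    also have "real n * (n * (4 / c\<^sup>2) * (h\<^sup>2 * K)) = C"
      using n by (simp add: C_def h_def power2_eq_square field_simps)
    finally show ?thesis .
  qed
  have "emeasure lborel A = 0"
  proof (rule ccontr)
    assume "emeasure lborel A \<noteq> 0"
    have C0: "C \<ge> 0" using K(1) by (simp add: C_def)
    obtain a where a: "a > 0" "ennreal a \<le> emeasure lborel A"
      using \<open>emeasure lborel A \<noteq> 0\<close>
    proof (cases "emeasure lborel A")
      case (real r)
      then show ?thesis using that[of r] \<open>emeasure lborel A \<noteq> 0\<close> by auto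
    next
      case top
      then show ?thesis using that[of 1] by simp
    qed
    \<comment> \<open>Then \<open>s^2 * a = C + 1\<close> exceeds \<open>C\<close>, and the
      \<open>t\<close> chosen next is small enough for \<open>ln (\<eta> / sqrt t) \<ge> s\<close>,
      contradicting \<open>bound\<close>.\<close>
    define s where "s = sqrt ((C + 1) / a)"
    have s: "s > 0" "s\<^sup>2 = (C + 1) / a" using C0 a by (auto simp: s_def)
    define t where "t = min (1/2) ((\<eta> * exp (- s))\<^sup>2)"
    have t: "0 < t" "t \<le> 1/2" using \<eta> by (auto simp: t_def)
    have "t \<le> (\<eta> * exp (- s))\<^sup>2" by (simp add: t_def)
    then have "sqrt t \<le> \<eta> * exp (- s)" using \<eta> by (intro real_le_lsqrt) auto
    then have le: "exp s \<le> \<eta> / sqrt t" using t by (simp add: exp_minus field_simps)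
    then have "s \<le> ln (\<eta> / sqrt t)" using t \<eta> by (subst ln_ge_iff) auto
    then have "s\<^sup>2 \<le> (ln (\<eta> / sqrt t))\<^sup>2" using s by (intro power_mono) auto
    moreover have "sqrt t < \<eta>"
    proof -
      have "1 < exp s" using s by simp
      then have "1 < \<eta> / sqrt t" using le by linarith
      then show ?thesis using t by (simp add: less_divide_eq)
    qed
    ultimately have "ennreal (s\<^sup>2) * ennreal a \<le> ennreal C"
      using bound[OF t] a(2) by (meson ennreal_leI mult_mono order_trans zero_le)
    then have "s\<^sup>2 * a \<le> C" using C0 a by (simp add: flip: ennreal_mult)
    then show False using s a by simp
  qed
  then have "AE x in lborel. x \<notin> A" by (subst AE_iff_measurable[of A]) auto
  then show ?thesis by eventually_elim (auto simp: A_def)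
qed

text \<open>A compactly supported \<open>\<phi>\<close> handles only bounded \<open>x\<close>, and
  only points where \<open>f\<close> is at least \<open>\<eta> \<phi>\<close> at the nonzero end.
  Both restrictions disappear by countable intersections, over balls of radius \<open>N\<close> and
  over \<open>\<eta> = 1 / Suc j\<close>.\<close>

lemma minimizer_zero_set_invariant:
  fixes f :: "'a::euclidean_space \<Rightarrow> real"
  assumes \<alpha>: "0 < \<alpha>" "\<alpha> < real DIM('a)" and m: "m > 0"
    and f: "adm m f" "renergy \<alpha> f < \<infinity>" and min: "\<And>g :: 'a \<Rightarrow> real. adm m g \<Longrightarrow> renergy \<alpha> f \<le> renergy \<alpha> g"
    and b: "b \<in> Basis" and H: "H > 0"
  shows "AE x in lborel. f x = 0 \<longleftrightarrow> f (x + H *\<^sub>R b) = 0"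
proof -
  have "AE x in lborel. norm x \<le> real N \<longrightarrow> \<not> (f x = 0 \<and> f (x + H *\<^sub>R b) > 0 \<or> f (x + H *\<^sub>R b) = 0 \<and> f x > 0)" for N :: nat
  proof -
    define R where "R = real N + H + 1"
    have R: "R > 0" using H by (simp add: R_def)
    let ?box = "box (- R *\<^sub>R One) (R *\<^sub>R One) :: 'a set"
    have inbox: "y \<in> ?box" if "norm y \<le> real N + H" for y :: 'a
    proof -
      have "\<bar>y \<bullet> i\<bar> < R" if "i \<in> Basis" for i
        using Basis_le_norm[OF that, of y] \<open>norm y \<le> real N + H\<close> by (simp add: R_def)
      then show ?thesis by (force simp: mem_box abs_less_iff)
    qed
    have "(0::'a) \<in> ?box" using H by (intro inbox) simp
    then have "?box \<noteq> {}" by blast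
    from exists_test_mass[OF m this] obtain \<phi> where \<phi>: "\<phi> \<in> test_functions" "\<And>x. \<phi> x \<ge> 0" "\<And>x. \<phi> x > 0 \<longleftrightarrow> x \<in> ?box"
      and m\<phi>: "(\<integral>\<^sup>+x. sq \<phi> x \<partial>lborel) = ennreal m" by blast
    have a\<phi>: "adm m \<phi>" using \<phi> m\<phi> test_measurable by (auto simp: adm_def)
    obtain K where K: "K \<ge> 0" "\<And>t b H. 0 < t \<Longrightarrow> t \<le> 1/2 \<Longrightarrow> b \<in> Basis \<Longrightarrow> H > 0 \<Longrightarrow>
      \<exists>k. (\<integral>\<^sup>+x. ennreal (mix_deficit t b (H / 2^k) f \<phi> x / (H / 2^k)\<^sup>2) \<partial>lborel) \<le> ennreal K"
      using minimizer_deficit_bounded[OF \<alpha> m f min \<phi>(1) a\<phi>] by blast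
    obtain y where y: "y \<in> cball (0::'a) (real N + H)" "\<And>x. x \<in> cball 0 (real N + H) \<Longrightarrow> \<phi> y \<le> \<phi> x"
      using continuous_attains_inf[of "cball (0::'a) (real N + H)" \<phi>] H test_continuous[OF \<phi>(1)] by auto
    have c: "\<phi> y > 0" using y(1) inbox \<phi>(3) by simp
    have nullj: "AE x in lborel. x \<in> cball 0 (real N) \<longrightarrow> \<not> (f x = 0 \<and> f (x + H *\<^sub>R b) \<ge> (1 / Suc j) * \<phi> (x + H *\<^sub>R b) \<or>
      f (x + H *\<^sub>R b) = 0 \<and> f x \<ge> (1 / Suc j) * \<phi> x)" for j
    proof (rule minimizer_zero_set_null[OF f(1) \<phi>(1,2) K(1) K(2)[OF _ _ b H] H c])
      show "\<phi> y \<le> \<phi> (x + s *\<^sub>R b)" if "x \<in> cball 0 (real N)" "0 \<le> s" "s \<le> H" for x s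
      proof (rule y(2))
        have "norm (x + s *\<^sub>R b) \<le> norm x + norm (s *\<^sub>R b)" by (rule norm_triangle_ineq)
        then show "x + s *\<^sub>R b \<in> cball 0 (real N + H)" using that b by simp
      qed
    qed simp_all
    then have "AE x in lborel. \<forall>j. x \<in> cball 0 (real N) \<longrightarrow> \<not> (f x = 0 \<and> f (x + H *\<^sub>R b) \<ge> (1 / Suc j) * \<phi> (x + H *\<^sub>R b) \<or>
      f (x + H *\<^sub>R b) = 0 \<and> f x \<ge> (1 / Suc j) * \<phi> x)"
      unfolding AE_all_countable by blast
    then show ?thesis
    proof eventually_elim
      case (elim x)
      have arch: "\<exists>j. (1 / real (Suc j)) * v \<le> u" if "u > 0" for u v :: real
      proof -
        obtain j where "v / u < real j" using reals_Archimedean2 by blast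
        then have "v \<le> real (Suc j) * u" using that by (simp add: divide_less_eq algebra_simps)
        then show ?thesis by (intro exI[of _ j]) (simp add: divide_le_eq mult.commute)
      qed
      show ?case
      proof (intro impI notI)
        assume x: "norm x \<le> real N" and "f x = 0 \<and> f (x + H *\<^sub>R b) > 0 \<or> f (x + H *\<^sub>R b) = 0 \<and> f x > 0"
        then show False
          using elim arch[of "f (x + H *\<^sub>R b)" "\<phi> (x + H *\<^sub>R b)"] arch[of "f x" "\<phi> x"] by (auto simp del: of_nat_Suc)
      qed
    qed
  qed
  then have "AE x in lborel. \<forall>N::nat. norm x \<le> real N \<longrightarrow> \<not> (f x = 0 \<and> f (x + H *\<^sub>R b) > 0 \<or> f (x + H *\<^sub>R b) = 0 \<and> f x > 0)"
    unfolding AE_all_countable by blast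
  then show ?thesis
  proof eventually_elim
    case (elim x)
    obtain N where "norm x \<le> real N" using real_arch_simple by blast
    with elim show ?case using adm_nonneg[OF f(1), of x] adm_nonneg[OF f(1), of "x + H *\<^sub>R b"] by fastforce
  qed
qed

text \<open>By Tonelli's theorem the product of the measures of \<open>Z\<close> and its complement
  is the integral over \<open>v\<close> of the measure of the points of \<open>Z\<close> that
  \<open>v\<close> carries into the complement, and this is 0 for each \<open>v\<close>. Infinite
  measures cause no difficulty in \<open>ennreal\<close>.\<close>

lemma translation_invariant_null_or_full:
  fixes Z :: "'a::euclidean_space set"
  assumes Z [measurable]: "Z \<in> sets borel"
    and inv: "\<And>b H. b \<in> Basis \<Longrightarrow> H > 0 \<Longrightarrow> AE x in lborel. x \<in> Z \<longleftrightarrow> x + H *\<^sub>R b \<in> Z"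
  shows "emeasure lborel Z = 0 \<or> emeasure lborel (- Z) = 0"
proof -
  have P1: "AE x in lborel. x \<in> Z \<longleftrightarrow> x + H *\<^sub>R b \<in> Z" if b: "b \<in> Basis" for b H
  proof -
    consider "H > 0" | "H = 0" | "H < 0" by linarith
    then show ?thesis
    proof cases
      case 3
      have "AE x in lborel. x + H *\<^sub>R b \<in> Z \<longleftrightarrow> x + H *\<^sub>R b + (- H) *\<^sub>R b \<in> Z"
        using AE_lborel_translate[OF inv[OF b, of "- H"], of "H *\<^sub>R b"] 3 by simp
      then show ?thesis by eventually_elim simp
    qed (use inv[OF b] in auto)
  qed
  have P2: "AE x in lborel. x \<in> Z \<longleftrightarrow> x + (\<Sum>b\<in>S. (v \<bullet> b) *\<^sub>R b) \<in> Z" if "finite S" "S \<subseteq> Basis" for v S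
    using that
  proof (induction S rule: finite_induct)
    case (insert b S)
    let ?w = "\<Sum>b\<in>S. (v \<bullet> b) *\<^sub>R b"
    have "AE x in lborel. x \<in> Z \<longleftrightarrow> x + ?w \<in> Z" using insert by simp
    moreover have "AE x in lborel. x + ?w \<in> Z \<longleftrightarrow> x + ?w + (v \<bullet> b) *\<^sub>R b \<in> Z"
      using AE_lborel_translate[OF P1[of b "v \<bullet> b"], of ?w] insert by simp
    ultimately show ?case by eventually_elim (use insert in \<open>simp add: add_ac\<close>)
  qed simp
  have P: "AE x in lborel. x \<in> Z \<longleftrightarrow> x + v \<in> Z" for v
    using P2[of Basis v] by (simp add: euclidean_representation)
  have "emeasure lborel Z * emeasure lborel (- Z) = (\<integral>\<^sup>+x. indicator Z x * (\<integral>\<^sup>+v. indicator (- Z) (v + x) \<partial>lborel) \<partial>lborel)"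
    by (simp add: nn_integral_lborel_translate[of "indicator (- Z)"] nn_integral_multc)
  also have "\<dots> = (\<integral>\<^sup>+x. \<integral>\<^sup>+v. indicator Z x * indicator (- Z) (v + x) \<partial>lborel \<partial>lborel)"
    by (simp add: nn_integral_cmult)
  also have "\<dots> = (\<integral>\<^sup>+v. \<integral>\<^sup>+x. indicator Z x * indicator (- Z) (v + x) \<partial>lborel \<partial>lborel)"
    by (rule lborel_pair.Fubini') measurable
  also have "\<dots> = (\<integral>\<^sup>+v. 0 \<partial>(lborel :: 'a measure))"
  proof (rule nn_integral_cong)
    fix v :: 'a
    have "(\<integral>\<^sup>+x. indicator Z x * indicator (- Z) (v + x) \<partial>lborel) = (\<integral>\<^sup>+x. 0 \<partial>(lborel :: 'a measure))"
      by (rule nn_integral_cong_AE) (use P[of v] in eventually_elim, auto simp: indicator_def add.commute)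
    then show "(\<integral>\<^sup>+x. indicator Z x * indicator (- Z) (v + x) \<partial>lborel) = 0" by simp
  qed
  finally show ?thesis by simp
qed

lemma minimizer_pos:
  fixes f :: "'a::euclidean_space \<Rightarrow> real"
  assumes \<alpha>: "0 < \<alpha>" "\<alpha> < real DIM('a)" and m: "m > 0"
    and f: "adm m f" "renergy \<alpha> f < \<infinity>" and min: "\<And>g :: 'a \<Rightarrow> real. adm m g \<Longrightarrow> renergy \<alpha> f \<le> renergy \<alpha> g"
  shows "AE x in lborel. 0 < f x"
proof -
  note [measurable] = adm_measurable[OF f(1)]
  define Z where "Z = {x. f x = 0}"
  have [measurable]: "Z \<in> sets borel" unfolding Z_def by measurable
  have "emeasure lborel Z = 0 \<or> emeasure lborel (- Z) = 0"
  proof (rule translation_invariant_null_or_full)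
    show "AE x in lborel. x \<in> Z \<longleftrightarrow> x + H *\<^sub>R b \<in> Z" if "b \<in> Basis" "H > 0" for b H
      using minimizer_zero_set_invariant[OF \<alpha> m f min that] by (simp add: Z_def)
  qed measurable
  moreover have "emeasure lborel (- Z) \<noteq> 0"
  proof
    assume "emeasure lborel (- Z) = 0"
    then have "AE x in lborel. x \<notin> - Z" by (subst AE_iff_measurable[of "- Z"]) auto
    then have "AE x in lborel. sq f x = 0" by eventually_elim (simp add: Z_def sq_def)
    then have "(\<integral>\<^sup>+x. sq f x \<partial>lborel) = 0" by (subst nn_integral_0_iff_AE) simp_all
    then show False using f(1) m by (simp add: adm_def)
  qed
  ultimately have "AE x in lborel. x \<notin> Z" by (subst AE_iff_measurable[of Z]) auto
  then show ?thesis
  proof eventually_elim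
    case (elim x)
    then show ?case using adm_nonneg[OF f(1), of x] by (simp add: Z_def)
  qed
qed

subsection \<open>Complex-valued functions and the energy space\<close>

lemma
  fixes a b :: "'b \<Rightarrow> real"
  assumes "integrable M a" "integrable M b"
  shows integrable_Complex: "integrable M (\<lambda>x. Complex (a x) (b x))"
    and integral_Complex: "(LINT x|M. Complex (a x) (b x)) = Complex (LINT x|M. a x) (LINT x|M. b x)"
proof -
  show i: "integrable M (\<lambda>x. Complex (a x) (b x))"
    unfolding Complex_eq using assms by (intro Bochner_Integration.integrable_add integrable_mult_right integrable_of_real)
  show "(LINT x|M. Complex (a x) (b x)) = Complex (LINT x|M. a x) (LINT x|M. b x)"
    using integral_Re[OF i] integral_Im[OF i] by (intro complex_eqI) simp_all
qed

lemma Complex_measurable [measurable]: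
  assumes [measurable]: "a \<in> borel_measurable M" "b \<in> borel_measurable M"
  shows "(\<lambda>x. Complex (a x) (b x)) \<in> borel_measurable M"
  unfolding Complex_eq by measurable

lemma AE_lebesgue_iff: "(AE x in lebesgue. P x) \<longleftrightarrow> (AE x in lborel. P x)"
  by (simp add: AE_completion_iff)

lemma borel_lebesgue_measurable: "f \<in> borel_measurable borel \<Longrightarrow> f \<in> borel_measurable lebesgue"
  by (simp add: measurable_completion)

lemma lebesgue_measurable_cong_AE:
  fixes u v :: "'a::euclidean_space \<Rightarrow> complex"
  assumes "AE x in lborel. u x = v x" "v \<in> borel_measurable lebesgue"
  shows "u \<in> borel_measurable lebesgue"
  by (rule borel_measurable_AE[OF assms(2)]) (use assms(1) in \<open>simp add: AE_completion_iff eq_commute\<close>)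

lemma exists_borel_Complex:
  fixes u :: "'a::euclidean_space \<Rightarrow> complex"
  assumes "u \<in> borel_measurable lebesgue"
  shows "\<exists>u1 u2. u1 \<in> borel_measurable borel \<and> u2 \<in> borel_measurable borel \<and> (AE x in lborel. u x = Complex (u1 x) (u2 x))"
proof -
  have "(\<lambda>x. Re (u x)) \<in> borel_measurable lebesgue" "(\<lambda>x. Im (u x)) \<in> borel_measurable lebesgue"
    using assms by measurable
  from this[THEN completion_ex_borel_measurable_real] obtain u1 u2 where
    u: "u1 \<in> borel_measurable lborel" "u2 \<in> borel_measurable lborel"
      "AE x in lborel. Re (u x) = u1 x" "AE x in lborel. Im (u x) = u2 x" by blast
  from u(3,4) have "AE x in lborel. u x = Complex (u1 x) (u2 x)"
    by eventually_elim (simp add: complex_eq_iff)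
  with u show ?thesis by auto
qed

lemma integral_lebesgue_cong:
  fixes u v :: "'a::euclidean_space \<Rightarrow> complex"
  assumes "AE x in lborel. u x = v x" "v \<in> borel_measurable borel"
  shows "(LINT x|lebesgue. u x) = (LINT x|lborel. v x)"
proof -
  have v: "v \<in> borel_measurable lebesgue" using assms(2) by (rule borel_lebesgue_measurable)
  have u: "u \<in> borel_measurable lebesgue" using assms(1) v by (rule lebesgue_measurable_cong_AE)
  have "(LINT x|lebesgue. u x) = (LINT x|lebesgue. v x)"
    by (rule integral_cong_AE[OF u v]) (use assms(1) in \<open>simp add: AE_lebesgue_iff\<close>)
  also have "\<dots> = (LINT x|lborel. v x)" using assms(2) by (intro integral_completion) simp
  finally show ?thesis .
qed

lemma integrable_lebesgue_cong:
  fixes u v :: "'a::euclidean_space \<Rightarrow> complex"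
  assumes "AE x in lborel. u x = v x" "v \<in> borel_measurable borel"
  shows "integrable lebesgue u \<longleftrightarrow> integrable lborel v"
proof -
  have v: "v \<in> borel_measurable lebesgue" using assms(2) by (rule borel_lebesgue_measurable)
  have u: "u \<in> borel_measurable lebesgue" using assms(1) v by (rule lebesgue_measurable_cong_AE)
  have "integrable lebesgue u \<longleftrightarrow> integrable lebesgue v"
    by (rule integrable_cong_AE[OF u v]) (use assms(1) in \<open>simp add: AE_lebesgue_iff\<close>)
  also have "\<dots> \<longleftrightarrow> integrable lborel v" using assms(2) by (intro integrable_completion) simp
  finally show ?thesis .
qed

lemma nn_integral_lebesgue_cong:
  assumes "AE x in lborel. u x = v x"
  shows "(\<integral>\<^sup>+x. u x \<partial>lebesgue) = (\<integral>\<^sup>+x. v x \<partial>lborel)"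
  unfolding nn_integral_completion using assms by (rule nn_integral_cong_AE)

lemma compact_subset_cball: "compact (K :: 'a::euclidean_space set) \<Longrightarrow> \<exists>R. K \<subseteq> cball 0 R"
  using compact_imp_bounded[of K] by (auto simp: bounded_iff subset_iff)

lemma locally_integrable_ComplexI:
  fixes u :: "'a::euclidean_space \<Rightarrow> complex"
  assumes u: "AE x in lborel. u x = Complex (u1 x) (u2 x)"
    and [measurable]: "u1 \<in> borel_measurable borel" "u2 \<in> borel_measurable borel"
    and i: "\<And>R. integrable lborel (\<lambda>x. indicator (cball 0 R) x * u1 x)" "\<And>R. integrable lborel (\<lambda>x. indicator (cball 0 R) x * u2 x)"
  shows "locally_integrable u"
  unfolding locally_integrable_def set_integrable_def
proof (intro allI impI)
  fix K :: "'a set" assume K: "compact K"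
  have [measurable]: "K \<in> sets borel" using K by (intro borel_closed compact_imp_closed)
  obtain R where R: "K \<subseteq> cball 0 R" using compact_subset_cball[OF K] by blast
  have "integrable lborel (\<lambda>x. indicator K x * w x)"
    if "integrable lborel (\<lambda>x. indicator (cball 0 R) x * w x)" and [measurable]: "w \<in> borel_measurable borel" for w :: "'a \<Rightarrow> real"
  proof (rule Bochner_Integration.integrable_bound[OF that(1)])
    have "norm (indicator K x * w x) \<le> norm (indicator (cball 0 R) x * w x)" for x
      using subsetD[OF R, of x] by (cases "x \<in> K") simp_all
    then show "AE x in lborel. norm (indicator K x * w x) \<le> norm (indicator (cball 0 R) x * w x)" by simp
  qed measurable
  then have iK: "integrable lborel (\<lambda>x. indicator K x * u1 x)" "integrable lborel (\<lambda>x. indicator K x * u2 x)"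
    using i by auto
  have "AE x in lborel. indicator K x *\<^sub>R u x = Complex (indicator K x * u1 x) (indicator K x * u2 x)"
    using u by eventually_elim (simp add: complex_eq_iff)
  then show "integrable lebesgue (\<lambda>x. indicator K x *\<^sub>R u x)"
    by (subst integrable_lebesgue_cong[where v = "\<lambda>x. Complex (indicator K x * u1 x) (indicator K x * u2 x)"])
       (use integrable_Complex[OF iK] in auto)
qed

lemma locally_integrable_measurable:
  assumes "locally_integrable (u :: 'a::euclidean_space \<Rightarrow> complex)"
  shows "u \<in> borel_measurable lebesgue"
proof (rule borel_measurable_LIMSEQ_metric)
  show "(\<lambda>x. indicator (cball 0 (real n)) x *\<^sub>R u x) \<in> borel_measurable lebesgue" for n
    using assms unfolding locally_integrable_def set_integrable_def by (intro borel_measurable_integrable) simp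
  show "(\<lambda>n. indicator (cball 0 (real n)) x *\<^sub>R u x) \<longlonglongrightarrow> u x" for x
  proof (rule tendsto_eventually)
    obtain N where N: "norm x \<le> real N" using real_arch_simple by blast
    show "\<forall>\<^sub>F n in sequentially. indicator (cball 0 (real n)) x *\<^sub>R u x = u x"
      using eventually_ge_at_top[of N] by eventually_elim (use N in simp)
  qed
qed

lemma locally_integrable_rep:
  fixes u :: "'a::euclidean_space \<Rightarrow> complex"
  assumes "locally_integrable u"
    and u: "AE x in lborel. u x = Complex (u1 x) (u2 x)"
    and [measurable]: "u1 \<in> borel_measurable borel" "u2 \<in> borel_measurable borel"
  shows "integrable lborel (\<lambda>x. indicator (cball 0 R) x * u1 x)" "integrable lborel (\<lambda>x. indicator (cball 0 R) x * u2 x)"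
proof -
  let ?v = "\<lambda>x. Complex (indicator (cball 0 R) x * u1 x) (indicator (cball 0 R) x * u2 x)"
  have "AE x in lborel. indicator (cball 0 R) x *\<^sub>R u x = ?v x"
    using u by eventually_elim (simp add: complex_eq_iff)
  moreover have "integrable lebesgue (\<lambda>x. indicator (cball 0 R) x *\<^sub>R u x)"
    using assms(1) by (simp add: locally_integrable_def set_integrable_def)
  ultimately have "integrable lborel ?v" by (subst (asm) integrable_lebesgue_cong[where v = ?v]) auto
  from integrable_Re[OF this] integrable_Im[OF this]
  show "integrable lborel (\<lambda>x. indicator (cball 0 R) x * u1 x)" "integrable lborel (\<lambda>x. indicator (cball 0 R) x * u2 x)" by simp_all
qed

lemma integral_test_Complex:
  fixes u :: "'a::euclidean_space \<Rightarrow> complex"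
  assumes t: "\<phi> \<in> test_functions" and u: "AE x in lborel. u x = Complex (u1 x) (u2 x)"
    and [measurable]: "u1 \<in> borel_measurable borel" "u2 \<in> borel_measurable borel"
    and i: "\<And>R. integrable lborel (\<lambda>x. indicator (cball 0 R) x * u1 x)" "\<And>R. integrable lborel (\<lambda>x. indicator (cball 0 R) x * u2 x)"
  shows "(LINT x|lebesgue. \<phi> x *\<^sub>R u x) = Complex (LINT x|lborel. \<phi> x * u1 x) (LINT x|lborel. \<phi> x * u2 x)"
proof -
  note [measurable] = test_measurable[OF t]
  have "AE x in lborel. \<phi> x *\<^sub>R u x = Complex (\<phi> x * u1 x) (\<phi> x * u2 x)"
    using u by eventually_elim (simp add: complex_eq_iff)
  then have "(LINT x|lebesgue. \<phi> x *\<^sub>R u x) = (LINT x|lborel. Complex (\<phi> x * u1 x) (\<phi> x * u2 x))"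
    by (rule integral_lebesgue_cong) measurable
  then show ?thesis by (simp add: integral_Complex test_integrable_mult t i)
qed

text \<open>Pins down the arbitrary choice in \<open>weak_partial\<close> up to a null set. The
  derivatives are only locally integrable here, which is the generality of
  \<open>test_orthogonal_imp_zero\<close>.\<close>

lemma has_weak_partial_unique:
  assumes b: "has_weak_partial u b g" "has_weak_partial u b g'"
  shows "AE x in lborel. g x = g' x"
proof -
  have l: "locally_integrable g" "locally_integrable g'" using b by (auto simp: has_weak_partial_def)
  obtain g1 g2 where g: "g1 \<in> borel_measurable borel" "g2 \<in> borel_measurable borel" "AE x in lborel. g x = Complex (g1 x) (g2 x)"
    using exists_borel_Complex[OF locally_integrable_measurable[OF l(1)]] by blast
  obtain h1 h2 where h: "h1 \<in> borel_measurable borel" "h2 \<in> borel_measurable borel" "AE x in lborel. g' x = Complex (h1 x) (h2 x)"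
    using exists_borel_Complex[OF locally_integrable_measurable[OF l(2)]] by blast
  note [measurable] = g(1,2) h(1,2)
  note ig = locally_integrable_rep[OF l(1) g(3,1,2)] and ih = locally_integrable_rep[OF l(2) h(3,1,2)]
  have eq: "(LINT x|lborel. \<phi> x * g1 x) = (LINT x|lborel. \<phi> x * h1 x)" "(LINT x|lborel. \<phi> x * g2 x) = (LINT x|lborel. \<phi> x * h2 x)"
    if t: "\<phi> \<in> test_functions" for \<phi>
  proof -
    have "(LINT x|lebesgue. \<phi> x *\<^sub>R g x) = (LINT x|lebesgue. \<phi> x *\<^sub>R g' x)"
      using b t unfolding has_weak_partial_def by (metis neg_equal_iff_equal)
    then show "(LINT x|lborel. \<phi> x * g1 x) = (LINT x|lborel. \<phi> x * h1 x)" "(LINT x|lborel. \<phi> x * g2 x) = (LINT x|lborel. \<phi> x * h2 x)"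
      unfolding integral_test_Complex[OF t g(3,1,2) ig] integral_test_Complex[OF t h(3,1,2) ih] by simp_all
  qed
  have "AE x in lborel. g1 x - h1 x = 0"
    by (rule test_orthogonal_imp_zero)
       (simp_all add: right_diff_distrib ig ih test_integrable_mult eq)
  moreover have "AE x in lborel. g2 x - h2 x = 0"
    by (rule test_orthogonal_imp_zero)
       (simp_all add: right_diff_distrib ig ih test_integrable_mult eq)
  ultimately show ?thesis using g(3) h(3) by eventually_elim simp
qed

text \<open>The bridge between the complex Lebesgue setting and the Borel calculus above: real and
  imaginary parts together with their weak derivatives, through which mass, potential and energy are
  expressed.\<close>

definition rep :: "('a::euclidean_space \<Rightarrow> complex) \<Rightarrow> ('a \<Rightarrow> real) \<Rightarrow> ('a \<Rightarrow> real) \<Rightarrow> ('a \<Rightarrow> 'a \<Rightarrow> real) \<Rightarrow> ('a \<Rightarrow> 'a \<Rightarrow> real) \<Rightarrow> bool" where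
  "rep u u1 u2 g1 g2 \<longleftrightarrow> sqint u1 \<and> sqint u2 \<and> (AE x in lborel. u x = Complex (u1 x) (u2 x)) \<and>
     (\<forall>b\<in>Basis. wpd u1 b (g1 b) \<and> wpd u2 b (g2 b))"

lemma norm_Complex_sq: "(norm (Complex a b))\<^sup>2 = a\<^sup>2 + b\<^sup>2"
  by (simp add: cmod_power2)

lemma L2_Complex:
  fixes u :: "'a::euclidean_space \<Rightarrow> complex"
  assumes u: "AE x in lborel. u x = Complex (u1 x) (u2 x)" and [measurable]: "u1 \<in> borel_measurable borel" "u2 \<in> borel_measurable borel"
  shows "u \<in> L2 \<longleftrightarrow> sqint u1 \<and> sqint u2"
proof -
  have m: "u \<in> borel_measurable lebesgue"
    by (rule lebesgue_measurable_cong_AE[OF u borel_lebesgue_measurable]) measurable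
  have "(\<integral>\<^sup>+x. ennreal ((norm (u x))\<^sup>2) \<partial>lebesgue) = (\<integral>\<^sup>+x. ennreal ((u1 x)\<^sup>2) + ennreal ((u2 x)\<^sup>2) \<partial>lborel)"
    by (rule nn_integral_lebesgue_cong) (use u in \<open>eventually_elim, simp add: norm_Complex_sq\<close>)
  also have "\<dots> = (\<integral>\<^sup>+x. ennreal ((u1 x)\<^sup>2) \<partial>lborel) + (\<integral>\<^sup>+x. ennreal ((u2 x)\<^sup>2) \<partial>lborel)"
    by (rule nn_integral_add) measurable
  finally show ?thesis using m by (auto simp: L2_def sqint_iff integrable_iff_bounded)
qed

lemma rep_has_weak_partial:
  assumes r: "rep u u1 u2 g1 g2" and b: "b \<in> Basis"
  shows "has_weak_partial u b (\<lambda>x. Complex (g1 b x) (g2 b x))"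
proof -
  have w: "wpd u1 b (g1 b)" "wpd u2 b (g2 b)" and u: "AE x in lborel. u x = Complex (u1 x) (u2 x)"
    using r b by (auto simp: rep_def)
  note s = wpd_sqint[OF w(1)] wpd_sqint[OF w(2)]
  note m = s[THEN sqint_measurable]
  note li = s[THEN sqint_locally_integrable]
  have t: "AE x in lborel. Complex (g1 b x) (g2 b x) = Complex (g1 b x) (g2 b x)" by simp
  show ?thesis
    unfolding has_weak_partial_def
  proof (intro conjI ballI)
    show "locally_integrable u" by (rule locally_integrable_ComplexI[OF u m(1) m(3) li(1) li(3)])
    show "locally_integrable (\<lambda>x. Complex (g1 b x) (g2 b x))" by (rule locally_integrable_ComplexI[OF t m(2) m(4) li(2) li(4)])
    show "(LINT x|lebesgue. partial b \<phi> x *\<^sub>R u x) = - (LINT x|lebesgue. \<phi> x *\<^sub>R Complex (g1 b x) (g2 b x))" if p: "\<phi> \<in> test_functions" for \<phi>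
      unfolding integral_test_Complex[OF p t m(2) m(4) li(2) li(4)] integral_test_Complex[OF test_partial[OF p b] u m(1) m(3) li(1) li(3)]
      using wpdD[OF w(1) p] wpdD[OF w(2) p] by (simp add: complex_eq_iff)
  qed
qed

lemma rep_weak_partial:
  assumes r: "rep u u1 u2 g1 g2" and b: "b \<in> Basis"
  shows "AE x in lborel. weak_partial b u x = Complex (g1 b x) (g2 b x)"
proof (rule has_weak_partial_unique[OF _ rep_has_weak_partial[OF r b]])
  show "has_weak_partial u b (weak_partial b u)"
    unfolding weak_partial_def by (rule someI[of _ "\<lambda>x. Complex (g1 b x) (g2 b x)"]) (rule rep_has_weak_partial[OF r b])
qed

lemma rep_H1:
  assumes r: "rep u u1 u2 g1 g2" shows "u \<in> H1"
proof -
  have u: "AE x in lborel. u x = Complex (u1 x) (u2 x)" and s: "sqint u1" "sqint u2" using r by (auto simp: rep_def)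
  have "u \<in> L2" using L2_Complex[OF u s[THEN sqint_measurable]] s by simp
  moreover have "(\<lambda>x. Complex (g1 b x) (g2 b x)) \<in> L2" if "b \<in> Basis" for b
  proof -
    have sg: "sqint (g1 b)" "sqint (g2 b)" using r that by (auto simp: rep_def intro: wpd_sqint)
    show ?thesis by (subst L2_Complex[OF _ sg[THEN sqint_measurable]]) (simp_all add: sg)
  qed
  ultimately show ?thesis unfolding H1_def using rep_has_weak_partial[OF r] by blast
qed

lemma H1_rep:
  fixes u :: "'a::euclidean_space \<Rightarrow> complex"
  assumes "u \<in> H1" shows "\<exists>u1 u2 g1 g2. rep u u1 u2 g1 g2"
proof -
  have L: "u \<in> L2" and H: "\<And>b. b \<in> Basis \<Longrightarrow> \<exists>g\<in>L2. has_weak_partial u b g" using assms by (auto simp: H1_def)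
  obtain u1 u2 where u: "u1 \<in> borel_measurable borel" "u2 \<in> borel_measurable borel" "AE x in lborel. u x = Complex (u1 x) (u2 x)"
    using exists_borel_Complex[of u] L by (auto simp: L2_def)
  have s: "sqint u1" "sqint u2" using L2_Complex[OF u(3,1,2)] L by auto
  have "\<exists>g1 g2. wpd u1 b g1 \<and> wpd u2 b g2" if b: "b \<in> Basis" for b
  proof -
    obtain g where g: "g \<in> L2" "has_weak_partial u b g" using H[OF b] by blast
    obtain g1 g2 where gg: "g1 \<in> borel_measurable borel" "g2 \<in> borel_measurable borel" "AE x in lborel. g x = Complex (g1 x) (g2 x)"
      using exists_borel_Complex[of g] g by (auto simp: L2_def)
    have sg: "sqint g1" "sqint g2" using L2_Complex[OF gg(3,1,2)] g(1) by auto
    have "(LINT x|lborel. partial b \<phi> x * u1 x) = - (LINT x|lborel. \<phi> x * g1 x)" "(LINT x|lborel. partial b \<phi> x * u2 x) = - (LINT x|lborel. \<phi> x * g2 x)"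
      if t: "\<phi> \<in> test_functions" for \<phi>
    proof -
      have "(LINT x|lebesgue. partial b \<phi> x *\<^sub>R u x) = - (LINT x|lebesgue. \<phi> x *\<^sub>R g x)"
        using g(2) t by (simp add: has_weak_partial_def)
      then show "(LINT x|lborel. partial b \<phi> x * u1 x) = - (LINT x|lborel. \<phi> x * g1 x)" "(LINT x|lborel. partial b \<phi> x * u2 x) = - (LINT x|lborel. \<phi> x * g2 x)"
        unfolding integral_test_Complex[OF t gg(3,1,2) sg[THEN sqint_locally_integrable]]
          integral_test_Complex[OF test_partial[OF t b] u(3,1,2) s[THEN sqint_locally_integrable]]
        by (simp_all add: complex_eq_iff)
    qed
    then show ?thesis using s sg by (auto simp: wpd_def)
  qed
  then obtain g1 g2 where "\<And>b. b \<in> Basis \<Longrightarrow> wpd u1 b (g1 b) \<and> wpd u2 b (g2 b)" by metis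
  then have "rep u u1 u2 g1 g2" using s u(3) by (simp add: rep_def)
  then show ?thesis by blast
qed

lemma rep_harm:
  assumes r: "rep u u1 u2 g1 g2"
  shows "(\<integral>\<^sup>+x. ennreal ((norm x)\<^sup>2 * (norm (u x))\<^sup>2) \<partial>lebesgue) = harm u1 + harm u2"
proof -
  have u: "AE x in lborel. u x = Complex (u1 x) (u2 x)" and [measurable]: "u1 \<in> borel_measurable borel" "u2 \<in> borel_measurable borel"
    using r by (auto simp: rep_def sqint_def)
  have "(\<integral>\<^sup>+x. ennreal ((norm x)\<^sup>2 * (norm (u x))\<^sup>2) \<partial>lebesgue) = (\<integral>\<^sup>+x. ennreal ((norm x)\<^sup>2 * (u1 x)\<^sup>2) + ennreal ((norm x)\<^sup>2 * (u2 x)\<^sup>2) \<partial>lborel)"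
    by (rule nn_integral_lebesgue_cong) (use u in \<open>eventually_elim, simp add: norm_Complex_sq distrib_left\<close>)
  then show ?thesis unfolding harm_def by (simp add: nn_integral_add)
qed

lemma rep_energy_space:
  assumes r: "rep u u1 u2 g1 g2"
  shows "u \<in> energy_space \<longleftrightarrow> harm u1 < \<infinity> \<and> harm u2 < \<infinity>"
proof -
  have "u \<in> L2" using rep_H1[OF r] by (simp add: H1_def)
  then have [measurable]: "u \<in> borel_measurable lebesgue" by (simp add: L2_def)
  have [measurable]: "(\<lambda>x::'a. norm x) \<in> borel_measurable lebesgue" by (rule borel_lebesgue_measurable) measurable
  have "(\<lambda>x. (norm x)\<^sup>2 * (norm (u x))\<^sup>2) \<in> borel_measurable lebesgue" by measurable
  then have "integrable lebesgue (\<lambda>x. (norm x)\<^sup>2 * (norm (u x))\<^sup>2) \<longleftrightarrow> harm u1 + harm u2 < \<infinity>"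
    by (simp add: integrable_iff_bounded flip: rep_harm[OF r])
  then show ?thesis using rep_H1[OF r] by (simp add: energy_space_def)
qed

lemma rep_mass:
  assumes r: "rep u u1 u2 g1 g2"
  shows "ennreal (mass u) = (\<integral>\<^sup>+x. sq u1 x + sq u2 x \<partial>lborel)"
proof -
  have u: "AE x in lborel. u x = Complex (u1 x) (u2 x)" and [measurable]: "u1 \<in> borel_measurable borel" "u2 \<in> borel_measurable borel"
    using r by (auto simp: rep_def sqint_def)
  have "u \<in> L2" using rep_H1[OF r] by (simp add: H1_def)
  then have "ennreal (mass u) = (\<integral>\<^sup>+x. ennreal ((norm (u x))\<^sup>2) \<partial>lebesgue)"
    unfolding mass_def by (intro nn_integral_eq_integral[symmetric]) (auto simp: L2_def)
  also have "\<dots> = (\<integral>\<^sup>+x. sq u1 x + sq u2 x \<partial>lborel)"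
    by (rule nn_integral_lebesgue_cong) (use u in \<open>eventually_elim, simp add: norm_Complex_sq sq_def\<close>)
  finally show ?thesis .
qed

lemma riesz_potential_nonneg:
  assumes "0 < \<alpha>" "\<alpha> < real DIM('a::euclidean_space)"
  shows "0 \<le> riesz_potential \<alpha> (x :: 'a)"
  using riesz_potential_eq[OF assms] by (metis divide_nonneg_nonneg less_imp_le powr_ge_zero)

lemma rep_riesz_conv:
  fixes u :: "'a::euclidean_space \<Rightarrow> complex"
  assumes \<alpha>: "0 < \<alpha>" "\<alpha> < real DIM('a)" and r: "rep u u1 u2 g1 g2"
  shows "riesz_conv \<alpha> (\<lambda>y. (norm (u y))\<^sup>2) x = pot \<alpha> (\<lambda>y. sq u1 y + sq u2 y) x"
proof -
  have u: "AE x in lborel. u x = Complex (u1 x) (u2 x)" using r by (auto simp: rep_def)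
  show ?thesis
    unfolding riesz_conv_def pot_def
    by (rule nn_integral_lebesgue_cong)
       (use u in \<open>eventually_elim, simp add: norm_Complex_sq sq_def ennreal_mult riesz_potential_nonneg[OF \<alpha>]\<close>)
qed

text \<open>The factor 4 clears both divisions by 2 in \<open>energy\<close>, the outer one and the
  one at the nonlocal term.\<close>

lemma rep_energy:
  fixes u :: "'a::euclidean_space \<Rightarrow> complex"
  assumes \<alpha>: "0 < \<alpha>" "\<alpha> < real DIM('a)" and r: "rep u u1 u2 g1 g2"
  shows "4 * energy \<alpha> u = 2 * ((\<Sum>b\<in>Basis. gradE b u1 + gradE b u2) + (harm u1 + harm u2))
    + dbl \<alpha> (\<lambda>x. sq u1 x + sq u2 x) (\<lambda>x. sq u1 x + sq u2 x)"
proof -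
  have u: "AE x in lborel. u x = Complex (u1 x) (u2 x)" and m [measurable]: "u1 \<in> borel_measurable borel" "u2 \<in> borel_measurable borel"
    using r by (auto simp: rep_def sqint_def)
  have w: "wpd u1 b (g1 b)" "wpd u2 b (g2 b)" if "b \<in> Basis" for b using r that by (auto simp: rep_def)
  have [measurable]: "g1 b \<in> borel_measurable borel" "g2 b \<in> borel_measurable borel" if "b \<in> Basis" for b
    using wpd_sqint(2)[OF w(1)[OF that]] wpd_sqint(2)[OF w(2)[OF that]] by (auto simp: sqint_def)
  let ?\<rho> = "\<lambda>x. sq u1 x + sq u2 x"
  have "AE x in lborel. \<forall>b\<in>Basis. weak_partial b u x = Complex (g1 b x) (g2 b x)"
    using rep_weak_partial[OF r] by (simp add: AE_finite_all[OF finite_Basis])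
  with u have ae: "AE x in lborel. ennreal ((\<Sum>b\<in>Basis. (norm (weak_partial b u x))\<^sup>2) + (norm x)\<^sup>2 * (norm (u x))\<^sup>2)
      + riesz_conv \<alpha> (\<lambda>y. (norm (u y))\<^sup>2) x * ennreal ((norm (u x))\<^sup>2) / 2
    = ((\<Sum>b\<in>Basis. ennreal ((g1 b x)\<^sup>2) + ennreal ((g2 b x)\<^sup>2)) + (ennreal ((norm x)\<^sup>2 * (u1 x)\<^sup>2) + ennreal ((norm x)\<^sup>2 * (u2 x)\<^sup>2))) + pot \<alpha> ?\<rho> x * ?\<rho> x / 2"
  proof eventually_elim
    case (elim x)
    have "ennreal ((\<Sum>b\<in>Basis. (norm (weak_partial b u x))\<^sup>2) + (norm x)\<^sup>2 * (norm (u x))\<^sup>2)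
      = ennreal ((\<Sum>b\<in>Basis. (g1 b x)\<^sup>2 + (g2 b x)\<^sup>2) + ((norm x)\<^sup>2 * (u1 x)\<^sup>2 + (norm x)\<^sup>2 * (u2 x)\<^sup>2))"
      using elim by (simp add: norm_Complex_sq distrib_left)
    also have "\<dots> = ennreal (\<Sum>b\<in>Basis. (g1 b x)\<^sup>2 + (g2 b x)\<^sup>2) + (ennreal ((norm x)\<^sup>2 * (u1 x)\<^sup>2) + ennreal ((norm x)\<^sup>2 * (u2 x)\<^sup>2))"
      by (simp add: ennreal_plus sum_nonneg)
    also have "ennreal (\<Sum>b\<in>Basis. (g1 b x)\<^sup>2 + (g2 b x)\<^sup>2) = (\<Sum>b\<in>Basis. ennreal ((g1 b x)\<^sup>2) + ennreal ((g2 b x)\<^sup>2))"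
      by (subst sum_ennreal[symmetric]) (simp_all add: ennreal_plus)
    finally show ?case using elim(1) by (simp add: rep_riesz_conv[OF \<alpha> r] norm_Complex_sq sq_def)
  qed
  have "2 * energy \<alpha> u = (\<integral>\<^sup>+x. ((\<Sum>b\<in>Basis. ennreal ((g1 b x)\<^sup>2) + ennreal ((g2 b x)\<^sup>2)) + (ennreal ((norm x)\<^sup>2 * (u1 x)\<^sup>2) + ennreal ((norm x)\<^sup>2 * (u2 x)\<^sup>2))) + pot \<alpha> ?\<rho> x * ?\<rho> x / 2 \<partial>lborel)"
    unfolding energy_def nn_integral_lebesgue_cong[OF ae]
    by (simp add: ennreal_times_divide mult.commute[of 2] ennreal_mult_divide_eq)
  also have "\<dots> = ((\<Sum>b\<in>Basis. gradE b u1 + gradE b u2) + (harm u1 + harm u2)) + dbl \<alpha> ?\<rho> ?\<rho> / 2"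
  proof -
    have "(\<integral>\<^sup>+x. (\<Sum>b\<in>Basis. ennreal ((g1 b x)\<^sup>2) + ennreal ((g2 b x)\<^sup>2)) \<partial>lborel) = (\<Sum>b\<in>Basis. gradE b u1 + gradE b u2)"
      by (subst nn_integral_sum) (auto simp: nn_integral_add wpd_imp_gradE_eq[OF w(1)] wpd_imp_gradE_eq[OF w(2)] intro!: sum.cong)
    moreover have "(\<integral>\<^sup>+x. ennreal ((norm x)\<^sup>2 * (u1 x)\<^sup>2) + ennreal ((norm x)\<^sup>2 * (u2 x)\<^sup>2) \<partial>lborel) = harm u1 + harm u2"
      unfolding harm_def by (rule nn_integral_add) measurable
    moreover have "(\<integral>\<^sup>+x. pot \<alpha> ?\<rho> x * ?\<rho> x / 2 \<partial>lborel) = dbl \<alpha> ?\<rho> ?\<rho> / 2"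
      unfolding dbl_def by (rule nn_integral_divide) measurable
    ultimately show ?thesis
      by (subst nn_integral_add; (subst nn_integral_add)?) auto
  qed
  finally have "2 * (2 * energy \<alpha> u) = 2 * (((\<Sum>b\<in>Basis. gradE b u1 + gradE b u2) + (harm u1 + harm u2)) + dbl \<alpha> ?\<rho> ?\<rho> / 2)" by simp
  moreover have "2 * (y / 2) = y" for y :: ennreal by (simp add: ennreal_times_divide mult.commute[of 2] ennreal_mult_divide_eq)
  moreover have "2 * (2 * y) = 4 * y" for y :: ennreal by (simp add: mult.assoc[symmetric])
  ultimately show ?thesis by (simp add: distrib_left)
qed

text \<open>The diamagnetic inequality at the level of difference quotients:
  \<open>sqrt_mix_deficit\<close> with \<open>p = q = 1\<close>, its deficit dropped, is the reverse
  triangle inequality for the vector of the two parts.\<close>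

lemma modulus_gradE_le:
  fixes u1 u2 :: "'a::euclidean_space \<Rightarrow> real"
  assumes [measurable]: "u1 \<in> borel_measurable borel" "u2 \<in> borel_measurable borel"
  shows "gradE b (\<lambda>x. sqrt ((u1 x)\<^sup>2 + (u2 x)\<^sup>2)) \<le> gradE b u1 + gradE b u2"
proof -
  have "dq b h (\<lambda>x. sqrt ((u1 x)\<^sup>2 + (u2 x)\<^sup>2)) \<le> dq b h u1 + dq b h u2" for h
  proof -
    have "dq b h (\<lambda>x. sqrt ((u1 x)\<^sup>2 + (u2 x)\<^sup>2)) \<le> (\<integral>\<^sup>+x. ennreal (((u1 (x + h *\<^sub>R b) - u1 x) / h)\<^sup>2) + ennreal (((u2 (x + h *\<^sub>R b) - u2 x) / h)\<^sup>2) \<partial>lborel)"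
      unfolding dq_def
    proof (rule nn_integral_mono)
      fix x
      let ?r = "\<lambda>x. sqrt ((u1 x)\<^sup>2 + (u2 x)\<^sup>2)"
      let ?X = "(u1 x * u2 (x + h *\<^sub>R b) - u1 (x + h *\<^sub>R b) * u2 x)\<^sup>2 / (?r x * ?r (x + h *\<^sub>R b))"
      have "(?r (x + h *\<^sub>R b) - ?r x)\<^sup>2 \<le> (?r (x + h *\<^sub>R b) - ?r x)\<^sup>2 + ?X" by simp
      also have "\<dots> \<le> (u1 (x + h *\<^sub>R b) - u1 x)\<^sup>2 + (u2 (x + h *\<^sub>R b) - u2 x)\<^sup>2"
        using sqrt_mix_deficit[where p = 1 and q = 1 and a = "u1 x" and b = "u2 x" and a' = "u1 (x + h *\<^sub>R b)" and b' = "u2 (x + h *\<^sub>R b)"] by simp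
      finally have "(?r (x + h *\<^sub>R b) - ?r x)\<^sup>2 \<le> (u1 (x + h *\<^sub>R b) - u1 x)\<^sup>2 + (u2 (x + h *\<^sub>R b) - u2 x)\<^sup>2" .
      then have "((?r (x + h *\<^sub>R b) - ?r x) / h)\<^sup>2 \<le> ((u1 (x + h *\<^sub>R b) - u1 x) / h)\<^sup>2 + ((u2 (x + h *\<^sub>R b) - u2 x) / h)\<^sup>2"
        unfolding power_divide add_divide_distrib[symmetric] by (rule divide_right_mono) simp
      from ennreal_leI[OF this] show "ennreal (((?r (x + h *\<^sub>R b) - ?r x) / h)\<^sup>2) \<le> ennreal (((u1 (x + h *\<^sub>R b) - u1 x) / h)\<^sup>2) + ennreal (((u2 (x + h *\<^sub>R b) - u2 x) / h)\<^sup>2)"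
        by (simp add: ennreal_plus)
    qed
    then show ?thesis unfolding dq_def by (simp add: nn_integral_add)
  qed
  then show ?thesis
    unfolding gradE_def[of b "\<lambda>x. sqrt ((u1 x)\<^sup>2 + (u2 x)\<^sup>2)"]
    by (intro SUP_least order_trans[OF _ add_mono[OF dq_le_gradE_dyadic dq_le_gradE_dyadic]])
qed

text \<open>Passing to the modulus preserves the mass, harmonic and nonlocal terms and does not
  increase the gradient term. So a minimizer among nonnegative real functions minimizes the complex
  problem.\<close>

lemma rep_renergy_modulus_le:
  fixes u :: "'a::euclidean_space \<Rightarrow> complex"
  assumes \<alpha>: "0 < \<alpha>" "\<alpha> < real DIM('a)" and r: "rep u u1 u2 g1 g2"
  shows "renergy \<alpha> (\<lambda>x. sqrt ((u1 x)\<^sup>2 + (u2 x)\<^sup>2)) \<le> 4 * energy \<alpha> u"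
    and "adm (mass u) (\<lambda>x. sqrt ((u1 x)\<^sup>2 + (u2 x)\<^sup>2))"
proof -
  have [measurable]: "u1 \<in> borel_measurable borel" "u2 \<in> borel_measurable borel"
    using r by (auto simp: rep_def sqint_def)
  let ?f = "\<lambda>x. sqrt ((u1 x)\<^sup>2 + (u2 x)\<^sup>2)"
  have s: "sq ?f = (\<lambda>x. sq u1 x + sq u2 x)" by (auto simp: sq_def ennreal_plus)
  have h: "harm ?f = harm u1 + harm u2"
    unfolding harm_def by (subst nn_integral_add[symmetric]) (auto simp: distrib_left ennreal_plus)
  show "renergy \<alpha> ?f \<le> 4 * energy \<alpha> u"
    unfolding rep_energy[OF \<alpha> r] renergy_def s h
    by (intro add_mono mult_left_mono sum_mono modulus_gradE_le order_refl) simp_all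
  show "adm (mass u) ?f"
    unfolding adm_def s rep_mass[OF r] by simp
qed

subsection \<open>The Euler-Lagrange equation\<close>

definition ip :: "('a::euclidean_space \<Rightarrow> real) \<Rightarrow> ('a \<Rightarrow> real) \<Rightarrow> real" where
  "ip f g = (LINT x|lborel. f x * g x)"

lemma ip_expand:
  assumes "sqint f" "sqint g"
  shows "(LINT x|lborel. (f x + t * g x)\<^sup>2) = ip f f + 2 * t * ip f g + t\<^sup>2 * ip g g"
proof -
  have "(LINT x|lborel. (f x + t * g x)\<^sup>2) = (LINT x|lborel. f x * f x + 2 * t * (f x * g x) + t\<^sup>2 * (g x * g x))"
    by (rule Bochner_Integration.integral_cong) (simp_all add: power2_eq_square algebra_simps)
  then show ?thesis
    using sqint_mult_integrable[OF assms(1,1)] sqint_mult_integrable[OF assms(1,2)] sqint_mult_integrable[OF assms(2,2)]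
    by (simp add: ip_def)
qed

lemma ip_nonneg: "0 \<le> ip f f"
  unfolding ip_def by (rule Bochner_Integration.integral_nonneg) simp

lemma ip_uminus: "ip f (\<lambda>x. - g x) = - ip f g"
  by (simp add: ip_def)

lemma sqint_nn_integral_ip: "sqint f \<Longrightarrow> (\<integral>\<^sup>+x. ennreal ((f x)\<^sup>2) \<partial>lborel) = ennreal (ip f f)"
  using sqint_nn_integral[of f] by (simp add: ip_def power2_eq_square)

text \<open>A perturbation \<open>f + t \<phi>\<close> may change sign; the absolute value makes it
  admissible, and the reverse triangle inequality makes this free of cost.\<close>

lemma gradE_abs_scale_le:
  assumes [measurable]: "u \<in> borel_measurable borel"
  shows "gradE b (\<lambda>x. \<bar>s * u x\<bar>) \<le> ennreal (s\<^sup>2) * gradE b u"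
proof -
  have "dq b h (\<lambda>x. \<bar>s * u x\<bar>) \<le> ennreal (s\<^sup>2) * dq b h u" for h
    unfolding dq_def
  proof (subst nn_integral_cmult[symmetric])
    show "(\<integral>\<^sup>+x. ennreal (((\<bar>s * u (x + h *\<^sub>R b)\<bar> - \<bar>s * u x\<bar>) / h)\<^sup>2) \<partial>lborel) \<le> (\<integral>\<^sup>+x. ennreal (s\<^sup>2) * ennreal (((u (x + h *\<^sub>R b) - u x) / h)\<^sup>2) \<partial>lborel)"
    proof (rule nn_integral_mono)
      fix x
      have "\<bar>\<bar>s * u (x + h *\<^sub>R b)\<bar> - \<bar>s * u x\<bar>\<bar> \<le> \<bar>s * (u (x + h *\<^sub>R b) - u x)\<bar>"
        using abs_triangle_ineq3[of "s * u (x + h *\<^sub>R b)" "s * u x"] by (simp add: right_diff_distrib)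
      then have "(\<bar>s * u (x + h *\<^sub>R b)\<bar> - \<bar>s * u x\<bar>)\<^sup>2 \<le> (s * (u (x + h *\<^sub>R b) - u x))\<^sup>2"
        by (simp only: abs_le_square_iff)
      then have "((\<bar>s * u (x + h *\<^sub>R b)\<bar> - \<bar>s * u x\<bar>) / h)\<^sup>2 \<le> s\<^sup>2 * ((u (x + h *\<^sub>R b) - u x) / h)\<^sup>2"
        unfolding power_divide power_mult_distrib times_divide_eq_right by (rule divide_right_mono) simp
      from ennreal_leI[OF this]
      show "ennreal (((\<bar>s * u (x + h *\<^sub>R b)\<bar> - \<bar>s * u x\<bar>) / h)\<^sup>2) \<le> ennreal (s\<^sup>2) * ennreal (((u (x + h *\<^sub>R b) - u x) / h)\<^sup>2)"
        by (simp add: ennreal_mult)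
    qed
  qed measurable
  then show ?thesis
    unfolding gradE_def[of b "\<lambda>x. \<bar>s * u x\<bar>"]
    by (intro SUP_least order_trans[OF _ mult_left_mono[OF dq_le_gradE_dyadic]]) simp_all
qed

lemma renergy_abs_scale_le:
  assumes [measurable]: "u \<in> borel_measurable borel"
  shows "renergy \<alpha> (\<lambda>x. \<bar>s * u x\<bar>) \<le> ennreal (s\<^sup>2) * (2 * ((\<Sum>b\<in>Basis. gradE b u) + harm u)) + ennreal (s\<^sup>2) * (ennreal (s\<^sup>2) * dbl \<alpha> (sq u) (sq u))"
proof -
  have s: "sq (\<lambda>x. \<bar>s * u x\<bar>) = (\<lambda>x. ennreal (s\<^sup>2) * sq u x)"
    by (auto simp: sq_def power_mult_distrib ennreal_mult)
  have h: "harm (\<lambda>x. \<bar>s * u x\<bar>) = ennreal (s\<^sup>2) * harm u"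
    unfolding harm_def
    by (subst nn_integral_cmult[symmetric])
       (auto intro!: nn_integral_cong simp: power_mult_distrib mult.left_commute simp flip: ennreal_mult)
  have d: "dbl \<alpha> (\<lambda>x. ennreal (s\<^sup>2) * sq u x) (\<lambda>x. ennreal (s\<^sup>2) * sq u x) = ennreal (s\<^sup>2) * (ennreal (s\<^sup>2) * dbl \<alpha> (sq u) (sq u))"
    by (simp add: dbl_cmult_left dbl_cmult_right)
  have "renergy \<alpha> (\<lambda>x. \<bar>s * u x\<bar>) \<le> 2 * ((\<Sum>b\<in>Basis. ennreal (s\<^sup>2) * gradE b u) + ennreal (s\<^sup>2) * harm u) + ennreal (s\<^sup>2) * (ennreal (s\<^sup>2) * dbl \<alpha> (sq u) (sq u))"
    unfolding renergy_def s h d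
    by (intro add_mono mult_left_mono sum_mono gradE_abs_scale_le order_refl) simp_all
  also have "2 * ((\<Sum>b\<in>Basis. ennreal (s\<^sup>2) * gradE b u) + ennreal (s\<^sup>2) * harm u) = ennreal (s\<^sup>2) * (2 * ((\<Sum>b\<in>Basis. gradE b u) + harm u))"
    by (simp only: sum_distrib_left[symmetric] distrib_left[symmetric] mult.left_commute[of 2])
  finally show ?thesis .
qed

text \<open>Scaling by \<open>s = sqrt (m / \<mu>)\<close> restores the mass; the quadratic part
  picks up \<open>m / \<mu>\<close>, the quartic part its square. Multiplying by
  \<open>\<mu>^2\<close> leaves an inequality that is polynomial in the data of
  \<open>u\<close>.\<close>

lemma minimizer_scaled_ineq:
  fixes f u :: "'a::euclidean_space \<Rightarrow> real"
  assumes m: "m > 0" and min: "\<And>g :: 'a \<Rightarrow> real. adm m g \<Longrightarrow> renergy \<alpha> f \<le> renergy \<alpha> g"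
    and E0: "renergy \<alpha> f = ennreal E0"
    and u [measurable]: "u \<in> borel_measurable borel" and \<mu>: "(\<integral>\<^sup>+x. sq u x \<partial>lborel) = ennreal \<mu>" "\<mu> > 0"
    and A: "(\<Sum>b\<in>Basis. gradE b u) + harm u = ennreal A" "A \<ge> 0" and B: "dbl \<alpha> (sq u) (sq u) \<le> ennreal B" "B \<ge> 0"
  shows "E0 * \<mu>\<^sup>2 \<le> 2 * m * \<mu> * A + m\<^sup>2 * B"
proof -
  define s where "s = sqrt (m / \<mu>)"
  have s2: "s\<^sup>2 = m / \<mu>" using m \<mu> by (simp add: s_def)
  have q: "m / \<mu> \<ge> 0" using m \<mu> by simp
  have "(\<integral>\<^sup>+x. sq (\<lambda>x. \<bar>s * u x\<bar>) x \<partial>lborel) = (\<integral>\<^sup>+x. ennreal (m / \<mu>) * sq u x \<partial>lborel)"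
    unfolding sq_def power2_abs power_mult_distrib s2 by (subst ennreal_mult[OF q zero_le_power2]) (rule refl)
  also have "\<dots> = ennreal (m / \<mu>) * ennreal \<mu>" by (simp add: nn_integral_cmult \<mu>)
  also have "\<dots> = ennreal m" using m \<mu> by (simp flip: ennreal_mult)
  finally have "adm m (\<lambda>x. \<bar>s * u x\<bar>)" by (simp add: adm_def)
  then have "ennreal E0 \<le> renergy \<alpha> (\<lambda>x. \<bar>s * u x\<bar>)" unfolding E0[symmetric] by (rule min)
  also have "\<dots> \<le> ennreal (m / \<mu>) * (2 * ((\<Sum>b\<in>Basis. gradE b u) + harm u)) + ennreal (m / \<mu>) * (ennreal (m / \<mu>) * dbl \<alpha> (sq u) (sq u))"
    unfolding s2[symmetric] by (rule renergy_abs_scale_le[OF u])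
  also have "\<dots> \<le> ennreal (m / \<mu>) * (2 * ennreal A) + ennreal (m / \<mu>) * (ennreal (m / \<mu>) * ennreal B)"
    unfolding A(1) by (intro add_mono mult_left_mono B order_refl) simp_all
  also have "\<dots> = ennreal (m / \<mu> * (2 * A) + m / \<mu> * (m / \<mu> * B))"
  proof -
    have "ennreal k * (2 * ennreal A) + ennreal k * (ennreal k * ennreal B) = ennreal (k * (2 * A) + k * (k * B))" if "k \<ge> 0" for k
      using that A B by (simp add: ennreal_mult ennreal_plus)
    then show ?thesis using q by blast
  qed
  finally have "E0 \<le> m / \<mu> * (2 * A) + m / \<mu> * (m / \<mu> * B)"
    using m \<mu>(2) A B by (subst (asm) ennreal_le_iff) (auto intro!: add_nonneg_nonneg mult_nonneg_nonneg)
  then have "E0 * \<mu>\<^sup>2 \<le> (m / \<mu> * (2 * A) + m / \<mu> * (m / \<mu> * B)) * \<mu>\<^sup>2" by (rule mult_right_mono) simp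
  also have "\<dots> = 2 * m * \<mu> * A + m\<^sup>2 * B" using \<mu> by (simp add: field_simps power2_eq_square)
  finally show ?thesis .
qed

section \<open>First-order behaviour of the nonlocal term\<close>

lemma dbl_iterated:
  assumes [measurable]: "\<rho> \<in> borel_measurable borel" "\<sigma> \<in> borel_measurable borel"
  shows "dbl \<alpha> \<rho> \<sigma> = (\<integral>\<^sup>+x. \<integral>\<^sup>+y. ennreal (riesz_potential \<alpha> (x - y)) * (\<rho> y * \<sigma> x) \<partial>lborel \<partial>lborel)"
  unfolding dbl_def pot_def mult.assoc[symmetric] by (subst nn_integral_multc) simp_all

lemma dbl_mono:
  assumes "\<And>x. \<rho> x \<le> \<rho>' x" "\<And>x. \<sigma> x \<le> \<sigma>' x"
  shows "dbl \<alpha> \<rho> \<sigma> \<le> dbl \<alpha> \<rho>' \<sigma>'"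
  unfolding dbl_def pot_def by (intro nn_integral_mono mult_mono assms) simp_all

text \<open>This is \<open>D(a + \<tau>, a + \<tau>) = D(a, a) + 2 D(a, \<tau>) + D(\<tau>, \<tau>)\<close>, with the last term estimated and
  the positive and negative parts of \<open>\<tau>\<close> on different sides.\<close>

lemma dbl_perturb_le:
  fixes a \<tau> :: "'a::euclidean_space \<Rightarrow> real"
  assumes [measurable]: "a \<in> borel_measurable borel" "\<tau> \<in> borel_measurable borel"
    and a: "\<And>x. 0 \<le> a x" and s: "\<And>x. 0 \<le> a x + \<tau> x"
  shows "dbl \<alpha> (\<lambda>x. ennreal (a x + \<tau> x)) (\<lambda>x. ennreal (a x + \<tau> x)) + 2 * dbl \<alpha> (\<lambda>x. ennreal (a x)) (\<lambda>x. ennreal (- \<tau> x))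
    \<le> dbl \<alpha> (\<lambda>x. ennreal (a x)) (\<lambda>x. ennreal (a x)) + 2 * dbl \<alpha> (\<lambda>x. ennreal (a x)) (\<lambda>x. ennreal (\<tau> x))
      + dbl \<alpha> (\<lambda>x. ennreal \<bar>\<tau> x\<bar>) (\<lambda>x. ennreal \<bar>\<tau> x\<bar>)"
proof -
  let ?k = "\<lambda>x y. ennreal (riesz_potential \<alpha> (x - y :: 'a))"
  have two: "2 * dbl \<alpha> (\<lambda>x. ennreal (a x)) (\<lambda>x. ennreal (w x)) =
      (\<integral>\<^sup>+x. \<integral>\<^sup>+y. ?k x y * (ennreal (a y) * ennreal (w x)) + ?k x y * (ennreal (w y) * ennreal (a x)) \<partial>lborel \<partial>lborel)"
    if [measurable]: "w \<in> borel_measurable borel" for w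
  proof -
    have "2 * dbl \<alpha> (\<lambda>x. ennreal (a x)) (\<lambda>x. ennreal (w x)) = dbl \<alpha> (\<lambda>x. ennreal (a x)) (\<lambda>x. ennreal (w x)) + dbl \<alpha> (\<lambda>x. ennreal (w x)) (\<lambda>x. ennreal (a x))"
      by (subst (3) dbl_commute) (simp_all add: mult_2)
    then show ?thesis by (simp add: dbl_iterated nn_integral_add)
  qed
  have two': "2 * dbl \<alpha> (\<lambda>x. ennreal (a x)) (\<lambda>x. ennreal (\<tau> x)) =
      (\<integral>\<^sup>+x. \<integral>\<^sup>+y. ?k x y * (ennreal (a y) * ennreal (\<tau> x)) + ?k x y * (ennreal (\<tau> y) * ennreal (a x)) \<partial>lborel \<partial>lborel)"
    "2 * dbl \<alpha> (\<lambda>x. ennreal (a x)) (\<lambda>x. ennreal (- \<tau> x)) =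
      (\<integral>\<^sup>+x. \<integral>\<^sup>+y. ?k x y * (ennreal (a y) * ennreal (- \<tau> x)) + ?k x y * (ennreal (- \<tau> y) * ennreal (a x)) \<partial>lborel \<partial>lborel)"
    by (rule two; measurable)+
  have pt: "ennreal (a y + \<tau> y) * ennreal (a x + \<tau> x) + (ennreal (a y) * ennreal (- \<tau> x) + ennreal (- \<tau> y) * ennreal (a x))
    \<le> ennreal (a y) * ennreal (a x) + (ennreal (a y) * ennreal (\<tau> x) + ennreal (\<tau> y) * ennreal (a x)) + ennreal \<bar>\<tau> y\<bar> * ennreal \<bar>\<tau> x\<bar>" for x y
  proof -
    define p n where "p = (\<lambda>x. max 0 (\<tau> x))" and "n = (\<lambda>x. max 0 (- \<tau> x))"
    have pn: "p x \<ge> 0" "n x \<ge> 0" "\<tau> x = p x - n x" "ennreal (\<tau> x) = ennreal (p x)" "ennreal (- \<tau> x) = ennreal (n x)" for x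
      by (auto simp: p_def n_def max_def ennreal_neg)
    have "\<tau> y * \<tau> x \<le> \<bar>\<tau> y\<bar> * \<bar>\<tau> x\<bar>" using abs_ge_self[of "\<tau> y * \<tau> x"] by (simp add: abs_mult)
    then have "(a y + \<tau> y) * (a x + \<tau> x) + (a y * n x + n y * a x) \<le> a y * a x + (a y * p x + p y * a x) + \<bar>\<tau> y\<bar> * \<bar>\<tau> x\<bar>"
    proof -
      have "a y * \<tau> x = a y * p x - a y * n x" by (simp add: pn(3)[of x] right_diff_distrib)
      moreover have "\<tau> y * a x = p y * a x - n y * a x" by (simp add: pn(3)[of y] left_diff_distrib)
      moreover have "(a y + \<tau> y) * (a x + \<tau> x) = a y * a x + a y * \<tau> x + \<tau> y * a x + \<tau> y * \<tau> x" by (simp add: algebra_simps)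
      ultimately show ?thesis using \<open>\<tau> y * \<tau> x \<le> \<bar>\<tau> y\<bar> * \<bar>\<tau> x\<bar>\<close> by linarith
    qed
    from ennreal_leI[OF this] show ?thesis
      using a s pn(1,2) unfolding pn(4,5) by (simp add: ennreal_mult ennreal_plus)
  qed
  have "dbl \<alpha> (\<lambda>x. ennreal (a x + \<tau> x)) (\<lambda>x. ennreal (a x + \<tau> x)) + 2 * dbl \<alpha> (\<lambda>x. ennreal (a x)) (\<lambda>x. ennreal (- \<tau> x))
    = (\<integral>\<^sup>+x. \<integral>\<^sup>+y. ?k x y * (ennreal (a y + \<tau> y) * ennreal (a x + \<tau> x) + (ennreal (a y) * ennreal (- \<tau> x) + ennreal (- \<tau> y) * ennreal (a x))) \<partial>lborel \<partial>lborel)"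
    unfolding two' by (simp add: dbl_iterated nn_integral_add distrib_left)
  also have "\<dots> \<le> (\<integral>\<^sup>+x. \<integral>\<^sup>+y. ?k x y * (ennreal (a y) * ennreal (a x) + (ennreal (a y) * ennreal (\<tau> x) + ennreal (\<tau> y) * ennreal (a x)) + ennreal \<bar>\<tau> y\<bar> * ennreal \<bar>\<tau> x\<bar>) \<partial>lborel \<partial>lborel)"
    by (intro nn_integral_mono mult_left_mono pt) simp
  also have "\<dots> = dbl \<alpha> (\<lambda>x. ennreal (a x)) (\<lambda>x. ennreal (a x)) + 2 * dbl \<alpha> (\<lambda>x. ennreal (a x)) (\<lambda>x. ennreal (\<tau> x))
      + dbl \<alpha> (\<lambda>x. ennreal \<bar>\<tau> x\<bar>) (\<lambda>x. ennreal \<bar>\<tau> x\<bar>)"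
    unfolding two' by (simp add: dbl_iterated nn_integral_add distrib_left)
  finally show ?thesis .
qed

text \<open>By symmetry of the kernel, integrating the potential of \<open>f^2\<close> over a ball
  is integrating \<open>f^2\<close> against the bounded potential of the ball. So the potential is
  locally integrable without any bound on the nonlocal energy.\<close>

lemma pot_ball_finite:
  fixes f :: "'a::euclidean_space \<Rightarrow> real"
  assumes \<alpha>: "0 < \<alpha>" "\<alpha> < real DIM('a)" and f: "sqint f"
  shows "dbl \<alpha> (sq f) (indicator (cball 0 R)) < \<infinity>"
proof -
  note [measurable] = sqint_measurable[OF f]
  obtain C where C: "C \<ge> 0" "\<And>x. pot \<alpha> (indicator (cball (0::'a) R)) x \<le> ennreal C"
    using pot_indicator_bounded[OF \<alpha>, of R] by auto
  have "dbl \<alpha> (sq f) (indicator (cball 0 R)) = dbl \<alpha> (indicator (cball 0 R)) (sq f)"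
    by (rule dbl_commute) measurable
  also have "\<dots> \<le> ennreal C * (\<integral>\<^sup>+x. sq f x \<partial>lborel)"
    by (rule dbl_le_of_pot_le[OF _ _ C(2)]) measurable
  also have "\<dots> < \<infinity>" using f by (simp add: sqint_iff sq_def ennreal_mult_less_top)
  finally show ?thesis .
qed

lemma pot_AE_finite:
  fixes f :: "'a::euclidean_space \<Rightarrow> real"
  assumes \<alpha>: "0 < \<alpha>" "\<alpha> < real DIM('a)" and f: "sqint f"
  shows "AE x in lborel. pot \<alpha> (sq f) x < \<infinity>"
proof -
  note [measurable] = sqint_measurable[OF f]
  have "AE x in lborel. pot \<alpha> (sq f) x * indicator (cball 0 (real N)) x \<noteq> \<infinity>" for N :: nat
    by (rule nn_integral_noteq_infinite) (use pot_ball_finite[OF \<alpha> f, of "real N"] in \<open>auto simp: dbl_def\<close>)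
  then have "AE x in lborel. \<forall>N::nat. pot \<alpha> (sq f) x * indicator (cball 0 (real N)) x \<noteq> \<infinity>"
    unfolding AE_all_countable by blast
  then show ?thesis
  proof eventually_elim
    case (elim x)
    obtain N where "norm x \<le> real N" using real_arch_simple by blast
    with elim[rule_format, of N] show ?case by (simp add: top.not_eq_extremum)
  qed
qed

text \<open>The right side minus the left side vanishes at \<open>t = 0\<close> because
  \<open>E = 2 * A0 + B0\<close>, and is nonnegative for small \<open>t > 0\<close>. Its derivative
  at 0, which is \<open>4 m\<close> times the asserted quantity, is therefore nonnegative.\<close>

lemma quadratic_first_order:
  fixes E A0 A1 A' B0 V1 B' m c1 c' :: real
  assumes m: "m > 0" and E: "E = 2 * A0 + B0"
    and le: "\<And>t. 0 < t \<Longrightarrow> t \<le> 1 \<Longrightarrow> m + 2 * t * c1 + t\<^sup>2 * c' > 0 \<Longrightarrow>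
      E * (m + 2 * t * c1 + t\<^sup>2 * c')\<^sup>2 \<le> 2 * m * (m + 2 * t * c1 + t\<^sup>2 * c') * (A0 + 2 * t * A1 + t\<^sup>2 * A') + m\<^sup>2 * (B0 + 4 * t * V1 + t\<^sup>2 * B')"
  shows "0 \<le> m * (A1 + V1) - (A0 + B0) * c1"
proof -
  define \<mu> where "\<mu> t = m + 2 * t * c1 + t\<^sup>2 * c'" for t
  define F where "F t = 2 * m * \<mu> t * (A0 + 2 * t * A1 + t\<^sup>2 * A') + m\<^sup>2 * (B0 + 4 * t * V1 + t\<^sup>2 * B') - E * (\<mu> t)\<^sup>2" for t
  have F0: "F 0 = 0" by (simp add: F_def \<mu>_def E power2_eq_square algebra_simps)
  have D\<mu>: "(\<mu> has_real_derivative 2 * c1) (at 0)"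
    unfolding \<mu>_def[abs_def] by (auto intro!: derivative_eq_intros)
  have "(F has_real_derivative 4 * m * (m * (A1 + V1) - (A0 + B0) * c1)) (at 0)"
    unfolding F_def[abs_def]
    by (rule derivative_eq_intros D\<mu> refl | simp)+ (simp add: \<mu>_def E power2_eq_square algebra_simps)
  then have "((\<lambda>t. F t / t) \<longlongrightarrow> 4 * m * (m * (A1 + V1) - (A0 + B0) * c1)) (at_right 0)"
    by (simp add: has_field_derivative_iff F0 filterlim_at_split)
  moreover have "eventually (\<lambda>t. 0 \<le> F t / t) (at_right 0)"
  proof -
    have "isCont \<mu> 0" using D\<mu> by (rule DERIV_isCont)
    then have "(\<mu> \<longlongrightarrow> \<mu> 0) (at_right 0)" by (simp add: isCont_def filterlim_at_split)
    then have "eventually (\<lambda>t. \<mu> t > 0) (at_right 0)"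
      by (rule order_tendstoD) (simp add: \<mu>_def m)
    moreover have "eventually (\<lambda>t::real. t \<in> {0<..<1}) (at_right 0)"
      by (rule eventually_at_rightI) auto
    ultimately show ?thesis
    proof eventually_elim
      case (elim t)
      then show ?case using le[of t] by (auto simp: F_def \<mu>_def)
    qed
  qed
  ultimately have "0 \<le> 4 * m * (m * (A1 + V1) - (A0 + B0) * c1)"
    by (rule tendsto_lowerbound) simp
  then show ?thesis using m by (simp add: zero_le_mult_iff)
qed

lemma sqint_norm_mult:
  assumes [measurable]: "u \<in> borel_measurable borel" and "harm u < \<infinity>"
  shows "sqint (\<lambda>x. norm x * u x)"
  using assms unfolding sqint_iff harm_def by (simp add: power_mult_distrib)

lemma harm_eq_ip:
  assumes "u \<in> borel_measurable borel" "harm u < \<infinity>"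
  shows "harm u = ennreal (ip (\<lambda>x. norm x * u x) (\<lambda>x. norm x * u x))"
  using sqint_nn_integral_ip[OF sqint_norm_mult[OF assms]] by (simp add: harm_def power_mult_distrib)

lemma partial_uminus_test:
  assumes "\<phi> \<in> test_functions" shows "partial b (\<lambda>x. - \<phi> x) = (\<lambda>x. - partial b \<phi> x)"
proof
  fix x
  have "((\<lambda>x. - \<phi> x) has_derivative (\<lambda>h. - frechet_derivative \<phi> (at x) h)) (at x)"
    by (intro has_derivative_minus has_derivative_partial smooth_differentiable test_smooth assms)
  then show "partial b (\<lambda>x. - \<phi> x) x = - partial b \<phi> x" by (simp add: partialI partial_def[of b \<phi>])
qed

lemma wpd_zero: "b \<in> Basis \<Longrightarrow> wpd (\<lambda>x. 0) b (\<lambda>x. 0)"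
  by (simp add: wpd_def sqint_def)

lemma gradE_zero: "gradE b (\<lambda>x. 0) = 0"
  by (simp add: gradE_def dq_def)

lemma mass_nonneg: "0 \<le> mass u"
  unfolding mass_def by (rule Bochner_Integration.integral_nonneg) simp

locale real_minimizer =
  fixes \<alpha> m :: real and f :: "'a::euclidean_space \<Rightarrow> real" and g :: "'a \<Rightarrow> 'a \<Rightarrow> real"
  assumes \<alpha>: "0 < \<alpha>" "\<alpha> < real DIM('a)" and m: "m > 0"
    and f: "adm m f" "renergy \<alpha> f < \<infinity>" and min: "\<And>h :: 'a \<Rightarrow> real. adm m h \<Longrightarrow> renergy \<alpha> f \<le> renergy \<alpha> h"
    and g: "\<And>b. b \<in> Basis \<Longrightarrow> wpd f b (g b)"
begin

text \<open>\<open>enn2real\<close> turns an infinite potential into 0; by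
  \<open>pot_AE_finite\<close> this affects a null set only.\<close>

definition "V x = enn2real (pot \<alpha> (sq f) x)"
definition "xf x = norm x * f x"
definition "B0 = enn2real (dbl \<alpha> (sq f) (sq f))"
definition "A0 = (\<Sum>b\<in>Basis. ip (g b) (g b)) + ip xf xf"

lemma sf: "sqint f" by (rule adm_sqint[OF f(1)])
lemma sg: "b \<in> Basis \<Longrightarrow> sqint (g b)" using wpd_sqint(2)[OF g] .

lemma fm [measurable]: "f \<in> borel_measurable borel" by (rule sqint_measurable[OF sf])

lemma V_measurable [measurable]: "V \<in> borel_measurable borel"
  unfolding V_def[abs_def] by measurable

lemma V_nonneg: "0 \<le> V x" by (simp add: V_def)

lemma pot_eq_V: "AE x in lborel. pot \<alpha> (sq f) x = ennreal (V x)"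
  using pot_AE_finite[OF \<alpha> sf] by eventually_elim (simp add: V_def)

lemma harm_fin: "harm f < \<infinity>"
  using f(2) by (auto simp add: renergy_def ennreal_mult_less_top)

lemma sxf: "sqint xf"
  unfolding xf_def[abs_def] by (rule sqint_norm_mult[OF fm harm_fin])

lemma dbl_fin: "dbl \<alpha> (sq f) (sq f) < \<infinity>"
  using f(2) by (simp add: renergy_def)

text \<open>The weight is split evenly, so an integral of \<open>V u w\<close> is an L2 pairing of
  \<open>sqrt V u\<close> with \<open>sqrt V w\<close>, whose squared norms are mutual energies
  already known to be finite.\<close>

lemma sqint_sqrt_V:
  assumes [measurable]: "u \<in> borel_measurable borel" and "dbl \<alpha> (sq f) (sq u) < \<infinity>"
  shows "sqint (\<lambda>x. sqrt (V x) * u x)"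
proof -
  have "(\<integral>\<^sup>+x. ennreal ((sqrt (V x) * u x)\<^sup>2) \<partial>lborel) = dbl \<alpha> (sq f) (sq u)"
    unfolding dbl_def
    by (rule nn_integral_cong_AE)
       (use pot_eq_V in \<open>eventually_elim, simp add: V_nonneg power_mult_distrib sq_def ennreal_mult\<close>)
  then show ?thesis using assms by (simp add: sqint_iff)
qed

lemma sVf: "sqint (\<lambda>x. sqrt (V x) * f x)"
  by (rule sqint_sqrt_V[OF fm dbl_fin])

lemma V_integrable_mult:
  assumes "sqint (\<lambda>x. sqrt (V x) * u x)" "sqint (\<lambda>x. sqrt (V x) * w x)"
  shows "integrable lborel (\<lambda>x. V x * u x * w x)"
proof -
  have "(sqrt (V x) * u x) * (sqrt (V x) * w x) = V x * u x * w x" for x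
  proof -
    have "(sqrt (V x) * u x) * (sqrt (V x) * w x) = (sqrt (V x) * sqrt (V x)) * (u x * w x)" by (simp only: mult_ac)
    also have "sqrt (V x) * sqrt (V x) = V x" using V_nonneg[of x] by simp
    finally show ?thesis by (simp only: mult.assoc)
  qed
  with sqint_mult_integrable[OF assms] show ?thesis by simp
qed

lemma renergy_eq: "renergy \<alpha> f = ennreal (2 * A0 + B0)"
proof -
  have "(\<Sum>b\<in>Basis. gradE b f) = ennreal (\<Sum>b\<in>Basis. ip (g b) (g b))"
    by (subst sum_ennreal[symmetric]) (auto simp: ip_nonneg wpd_imp_gradE_eq[OF g] sqint_nn_integral_ip sg intro!: sum.cong)
  moreover have "harm f = ennreal (ip xf xf)"
    unfolding xf_def[abs_def] by (rule harm_eq_ip[OF fm harm_fin])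
  moreover have "dbl \<alpha> (sq f) (sq f) = ennreal B0" using dbl_fin by (simp add: B0_def)
  ultimately show ?thesis
    unfolding renergy_def A0_def
    by (simp add: ennreal_plus ennreal_mult sum_nonneg ip_nonneg B0_def)
qed

text \<open>An upper bound with exact first-order term is enough, since minimality is used in one
  direction only. \<open>B2\<close> collects the second-order part of the linear term in the density
  and a crude bound for the quadratic one.\<close>

lemma dbl_perturbed_le:
  assumes \<phi>: "\<phi> \<in> test_functions"
  shows "\<exists>B2. \<forall>t. 0 < t \<and> t \<le> 1 \<longrightarrow> 0 \<le> B0 + 4 * t * (LINT x|lborel. V x * f x * \<phi> x) + t\<^sup>2 * B2 \<and>
    dbl \<alpha> (sq (\<lambda>x. f x + t * \<phi> x)) (sq (\<lambda>x. f x + t * \<phi> x)) \<le> ennreal (B0 + 4 * t * (LINT x|lborel. V x * f x * \<phi> x) + t\<^sup>2 * B2)"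
proof -
  note [measurable] = test_measurable[OF \<phi>]
  have com: "dbl \<alpha> (sq f) (sq \<phi>) = dbl \<alpha> (sq \<phi>) (sq f)" by (rule dbl_commute) measurable
  have fin: "dbl \<alpha> (sq f) (sq \<phi>) < \<infinity>" "dbl \<alpha> (sq \<phi>) (sq f) < \<infinity>" "dbl \<alpha> (sq \<phi>) (sq \<phi>) < \<infinity>"
    using dbl_test_finite[OF \<alpha> \<phi> sf] dbl_test_finite[OF \<alpha> \<phi> test_sqint[OF \<phi>]] com by auto
  have sV: "sqint (\<lambda>x. sqrt (V x) * \<phi> x)" by (rule sqint_sqrt_V[OF _ fin(1)]) measurable
  note i1 = V_integrable_mult[OF sVf sV] and i2 = V_integrable_mult[OF sV sV]
  let ?V1 = "LINT x|lborel. V x * f x * \<phi> x" and ?V2 = "LINT x|lborel. V x * \<phi> x * \<phi> x"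
  let ?S = "\<lambda>x. sq f x + sq \<phi> x"
  define DS where "DS = enn2real (dbl \<alpha> ?S ?S)"
  have "dbl \<alpha> ?S ?S < \<infinity>" using fin dbl_fin by (simp add: dbl_add_left dbl_add_right)
  then have DS: "dbl \<alpha> ?S ?S = ennreal DS" "DS \<ge> 0" by (simp_all add: DS_def)
  have "0 \<le> B0 + 4 * t * ?V1 + t\<^sup>2 * (2 * ?V2 + 4 * DS) \<and>
    dbl \<alpha> (sq (\<lambda>x. f x + t * \<phi> x)) (sq (\<lambda>x. f x + t * \<phi> x)) \<le> ennreal (B0 + 4 * t * ?V1 + t\<^sup>2 * (2 * ?V2 + 4 * DS))"
    if t: "0 < t" "t \<le> 1" for t
  proof -
    define a \<tau> where "a x = (f x)\<^sup>2" and "\<tau> x = 2 * t * (f x * \<phi> x) + t\<^sup>2 * (\<phi> x * \<phi> x)" for x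
    have [measurable]: "a \<in> borel_measurable borel" "\<tau> \<in> borel_measurable borel"
      unfolding a_def[abs_def] \<tau>_def[abs_def] by measurable
    have sum: "a x + \<tau> x = (f x + t * \<phi> x)\<^sup>2" for x
      by (simp add: a_def \<tau>_def power2_eq_square algebra_simps)
    have sqa: "(\<lambda>x. ennreal (a x)) = sq f" by (simp add: a_def sq_def[abs_def])
    have Vt: "V x * \<tau> x = 2 * t * (V x * f x * \<phi> x) + t\<^sup>2 * (V x * \<phi> x * \<phi> x)" for x
      by (simp add: \<tau>_def algebra_simps)
    have iV: "integrable lborel (\<lambda>x. V x * \<tau> x)" unfolding Vt using i1 i2 by simp
    have IV: "(LINT x|lborel. V x * \<tau> x) = 2 * t * ?V1 + t\<^sup>2 * ?V2" unfolding Vt using i1 i2 by simp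
    \<comment> \<open>Positive and negative part of the linear term are kept apart, as
      \<open>dbl_perturb_le\<close> places them on different sides.\<close>
    define P N where "P = enn2real (\<integral>\<^sup>+x. ennreal (V x * \<tau> x) \<partial>lborel)" and "N = enn2real (\<integral>\<^sup>+x. ennreal (- (V x * \<tau> x)) \<partial>lborel)"
    have PN: "P - N = 2 * t * ?V1 + t\<^sup>2 * ?V2"
      using real_lebesgue_integral_def[OF iV] IV by (simp add: P_def N_def)
    have dP: "dbl \<alpha> (sq f) (\<lambda>x. ennreal (\<tau> x)) = ennreal P"
    proof -
      have "dbl \<alpha> (sq f) (\<lambda>x. ennreal (\<tau> x)) = (\<integral>\<^sup>+x. ennreal (V x * \<tau> x) \<partial>lborel)"
        unfolding dbl_def by (rule nn_integral_cong_AE) (use pot_eq_V in \<open>eventually_elim, simp add: ennreal_mult' V_nonneg\<close>)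
      then show ?thesis using iV by (simp add: P_def real_integrable_def top.not_eq_extremum)
    qed
    have dN: "dbl \<alpha> (sq f) (\<lambda>x. ennreal (- \<tau> x)) = ennreal N"
    proof -
      have "dbl \<alpha> (sq f) (\<lambda>x. ennreal (- \<tau> x)) = (\<integral>\<^sup>+x. ennreal (V x * (- \<tau> x)) \<partial>lborel)"
        unfolding dbl_def by (rule nn_integral_cong_AE) (use pot_eq_V in \<open>eventually_elim, simp only: ennreal_mult'[OF V_nonneg]\<close>)
      then show ?thesis using iV by (simp add: N_def real_integrable_def top.not_eq_extremum)
    qed
    have T: "dbl \<alpha> (\<lambda>x. ennreal \<bar>\<tau> x\<bar>) (\<lambda>x. ennreal \<bar>\<tau> x\<bar>) \<le> ennreal (4 * t\<^sup>2 * DS)"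
    proof -
      \<comment> \<open>For \<open>t \<le> 1\<close> the change of the density is at most
        \<open>2 t (f^2 + \<phi>^2)\<close>, so the term quadratic in \<open>\<tau>\<close> is of
        order \<open>t^2\<close> with the finite constant \<open>4 * DS\<close>.\<close>
      have "ennreal \<bar>\<tau> x\<bar> \<le> ennreal (2 * t) * ?S x" for x
      proof -
        have "\<bar>2 * (f x * \<phi> x)\<bar> \<le> (f x)\<^sup>2 + (\<phi> x)\<^sup>2"
          using sum_squares_bound[of "f x" "\<phi> x"] sum_squares_bound[of "f x" "- \<phi> x"] by (simp add: abs_le_iff)
        then have "t * \<bar>2 * (f x * \<phi> x)\<bar> \<le> t * ((f x)\<^sup>2 + (\<phi> x)\<^sup>2)" using t by (intro mult_left_mono) auto
        moreover have "t\<^sup>2 * (\<phi> x)\<^sup>2 \<le> t * (\<phi> x)\<^sup>2" using t by (intro mult_right_mono) (auto simp: power2_eq_square)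
        moreover have "t * (\<phi> x)\<^sup>2 \<le> t * ((f x)\<^sup>2 + (\<phi> x)\<^sup>2)" using t by (intro mult_left_mono) auto
        moreover have "\<bar>\<tau> x\<bar> \<le> t * \<bar>2 * (f x * \<phi> x)\<bar> + t\<^sup>2 * (\<phi> x)\<^sup>2"
        proof -
          have "\<bar>\<tau> x\<bar> \<le> \<bar>2 * t * (f x * \<phi> x)\<bar> + \<bar>t\<^sup>2 * (\<phi> x * \<phi> x)\<bar>" unfolding \<tau>_def by (rule abs_triangle_ineq)
          then show ?thesis using t by (simp add: abs_mult power2_eq_square)
        qed
        ultimately have "\<bar>\<tau> x\<bar> \<le> 2 * t * ((f x)\<^sup>2 + (\<phi> x)\<^sup>2)" by (simp add: algebra_simps)
        from ennreal_leI[OF this] show ?thesis using t by (simp add: sq_def ennreal_mult ennreal_plus)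
      qed
      then have "dbl \<alpha> (\<lambda>x. ennreal \<bar>\<tau> x\<bar>) (\<lambda>x. ennreal \<bar>\<tau> x\<bar>) \<le> dbl \<alpha> (\<lambda>x. ennreal (2 * t) * ?S x) (\<lambda>x. ennreal (2 * t) * ?S x)"
        by (intro dbl_mono)
      also have "\<dots> = ennreal (2 * t) * (ennreal (2 * t) * dbl \<alpha> ?S ?S)"
        by (subst dbl_cmult_left, measurable, subst dbl_cmult_right) simp_all
      also have "\<dots> = ennreal (4 * t\<^sup>2 * DS)"
        using t DS by (simp add: power2_eq_square mult_ac flip: ennreal_mult)
      finally show ?thesis .
    qed
    let ?L = "dbl \<alpha> (sq (\<lambda>x. f x + t * \<phi> x)) (sq (\<lambda>x. f x + t * \<phi> x))"
    have "?L + 2 * ennreal N \<le> dbl \<alpha> (sq f) (sq f) + 2 * ennreal P + dbl \<alpha> (\<lambda>x. ennreal \<bar>\<tau> x\<bar>) (\<lambda>x. ennreal \<bar>\<tau> x\<bar>)"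
      using dbl_perturb_le[of a \<tau> \<alpha>] unfolding sum sqa dP dN sq_def[symmetric] by (simp add: a_def sq_def[abs_def])
    also have "\<dots> \<le> dbl \<alpha> (sq f) (sq f) + 2 * ennreal P + ennreal (4 * t\<^sup>2 * DS)" by (intro add_left_mono T)
    also have "dbl \<alpha> (sq f) (sq f) = ennreal B0" using dbl_fin by (simp add: B0_def)
    also have "ennreal B0 + 2 * ennreal P + ennreal (4 * t\<^sup>2 * DS) = ennreal (B0 + 2 * P + 4 * t\<^sup>2 * DS)"
      using DS by (simp add: ennreal_plus ennreal_mult B0_def P_def)
    finally have le: "?L + 2 * ennreal N \<le> ennreal (B0 + 2 * P + 4 * t\<^sup>2 * DS)" .
    have "?L < \<infinity>" using le by (auto simp: less_top[symmetric] top_unique)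
    then obtain l where l: "?L = ennreal l" "l \<ge> 0" by (cases ?L) auto
    have "ennreal (l + 2 * N) \<le> ennreal (B0 + 2 * P + 4 * t\<^sup>2 * DS)"
      using le l by (simp add: ennreal_plus ennreal_mult N_def)
    then have "l + 2 * N \<le> B0 + 2 * P + 4 * t\<^sup>2 * DS"
      using DS by (subst (asm) ennreal_le_iff) (auto simp: B0_def P_def)
    then have "l \<le> B0 + 4 * t * ?V1 + t\<^sup>2 * (2 * ?V2 + 4 * DS)"
      using PN by (simp add: algebra_simps)
    then show ?thesis using l by (auto intro: ennreal_leI)
  qed
  then show ?thesis by blast
qed

text \<open>First-order optimality for the perturbation \<open>f + t \<phi>\<close> with
  \<open>t > 0\<close>, rescaled to mass \<open>m\<close>. The reverse inequality comes from
  \<open>- \<phi>\<close>.\<close>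

lemma euler_lagrange_ge:
  assumes \<phi>: "\<phi> \<in> test_functions"
  shows "0 \<le> m * ((\<Sum>b\<in>Basis. ip (g b) (partial b \<phi>)) + ip xf (\<lambda>x. norm x * \<phi> x) + (LINT x|lborel. V x * f x * \<phi> x)) - (A0 + B0) * ip f \<phi>"
proof -
  note [measurable] = test_measurable[OF \<phi>]
  note s\<phi> = test_sqint[OF \<phi>]
  obtain B2 where B2: "\<And>t. 0 < t \<Longrightarrow> t \<le> 1 \<Longrightarrow> 0 \<le> B0 + 4 * t * (LINT x|lborel. V x * f x * \<phi> x) + t\<^sup>2 * B2"
    "\<And>t. 0 < t \<Longrightarrow> t \<le> 1 \<Longrightarrow> dbl \<alpha> (sq (\<lambda>x. f x + t * \<phi> x)) (sq (\<lambda>x. f x + t * \<phi> x)) \<le> ennreal (B0 + 4 * t * (LINT x|lborel. V x * f x * \<phi> x) + t\<^sup>2 * B2)"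
    using dbl_perturbed_le[OF \<phi>] by blast
  let ?x\<phi> = "\<lambda>x. norm x * \<phi> x"
  have sx\<phi>: "sqint ?x\<phi>" by (rule sqint_norm_mult[OF _ test_harm_finite[OF \<phi>]]) measurable
  let ?A1 = "(\<Sum>b\<in>Basis. ip (g b) (partial b \<phi>)) + ip xf ?x\<phi>"
  let ?A2 = "(\<Sum>b\<in>Basis. ip (partial b \<phi>) (partial b \<phi>)) + ip ?x\<phi> ?x\<phi>"
  have mff: "ip f f = m"
    using f(1) sqint_nn_integral_ip[OF sf] m ip_nonneg[of f] by (simp add: adm_def sq_def[abs_def])
  show ?thesis
  proof (rule quadratic_first_order[where A' = ?A2 and B' = B2 and c' = "ip \<phi> \<phi>", OF m refl])
    fix t :: real assume t: "0 < t" "t \<le> 1" and pos: "m + 2 * t * ip f \<phi> + t\<^sup>2 * ip \<phi> \<phi> > 0"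
    let ?u = "\<lambda>x. f x + t * \<phi> x"
    have su: "sqint ?u" by (intro sqint_add sqint_cmult sf s\<phi>)
    have mu: "(\<integral>\<^sup>+x. sq ?u x \<partial>lborel) = ennreal (m + 2 * t * ip f \<phi> + t\<^sup>2 * ip \<phi> \<phi>)"
      unfolding sq_def sqint_nn_integral[OF su] ip_expand[OF sf s\<phi>] mff ..
    have gr: "gradE b ?u = ennreal (ip (g b) (g b) + 2 * t * ip (g b) (partial b \<phi>) + t\<^sup>2 * ip (partial b \<phi>) (partial b \<phi>))" if b: "b \<in> Basis" for b
    proof -
      note sp = test_sqint[OF test_partial[OF \<phi> b]]
      have "sqint (\<lambda>x. g b x + t * partial b \<phi> x)" by (intro sqint_add sqint_cmult sg b sp)
      then show ?thesis
        unfolding wpd_imp_gradE_eq[OF wpd_add_cmult[OF g[OF b] wpd_test[OF \<phi> b] b] b]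
        by (simp only: sqint_nn_integral ip_expand[OF sg[OF b] sp])
    qed
    have gr0: "0 \<le> ip (g b) (g b) + 2 * t * ip (g b) (partial b \<phi>) + t\<^sup>2 * ip (partial b \<phi>) (partial b \<phi>)" if b: "b \<in> Basis" for b
      unfolding ip_expand[OF sg[OF b] test_sqint[OF test_partial[OF \<phi> b]], symmetric]
      by (rule Bochner_Integration.integral_nonneg) simp
    have ha: "harm ?u = ennreal (ip xf xf + 2 * t * ip xf ?x\<phi> + t\<^sup>2 * ip ?x\<phi> ?x\<phi>)"
    proof -
      have "sqint (\<lambda>x. xf x + t * ?x\<phi> x)" by (intro sqint_add sqint_cmult sxf sx\<phi>)
      then have "(\<integral>\<^sup>+x. ennreal ((xf x + t * ?x\<phi> x)\<^sup>2) \<partial>lborel) = ennreal (ip xf xf + 2 * t * ip xf ?x\<phi> + t\<^sup>2 * ip ?x\<phi> ?x\<phi>)"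
        by (simp only: sqint_nn_integral ip_expand[OF sxf sx\<phi>])
      moreover have "(xf x + t * ?x\<phi> x)\<^sup>2 = (norm x)\<^sup>2 * (?u x)\<^sup>2" for x
        by (simp add: xf_def power2_eq_square algebra_simps)
      ultimately show ?thesis by (simp add: harm_def)
    qed
    have ha0: "0 \<le> ip xf xf + 2 * t * ip xf ?x\<phi> + t\<^sup>2 * ip ?x\<phi> ?x\<phi>"
      unfolding ip_expand[OF sxf sx\<phi>, symmetric] by (rule Bochner_Integration.integral_nonneg) simp
    have e: "(\<Sum>b\<in>Basis. ip (g b) (g b) + 2 * t * ip (g b) (partial b \<phi>) + t\<^sup>2 * ip (partial b \<phi>) (partial b \<phi>)) + (ip xf xf + 2 * t * ip xf ?x\<phi> + t\<^sup>2 * ip ?x\<phi> ?x\<phi>)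
      = A0 + 2 * t * ?A1 + t\<^sup>2 * ?A2"
      unfolding A0_def by (simp add: sum.distrib sum_distrib_left algebra_simps)
    have sumE: "(\<Sum>b\<in>Basis. gradE b ?u) = ennreal (\<Sum>b\<in>Basis. ip (g b) (g b) + 2 * t * ip (g b) (partial b \<phi>) + t\<^sup>2 * ip (partial b \<phi>) (partial b \<phi>))"
      by (subst sum_ennreal[symmetric]) (auto simp: gr gr0 intro!: sum.cong)
    have A: "(\<Sum>b\<in>Basis. gradE b ?u) + harm ?u = ennreal (A0 + 2 * t * ?A1 + t\<^sup>2 * ?A2)"
      unfolding sumE ha e[symmetric] by (rule ennreal_plus[symmetric]) (auto intro: sum_nonneg gr0 ha0)
    have Apos: "0 \<le> A0 + 2 * t * ?A1 + t\<^sup>2 * ?A2"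
      unfolding e[symmetric] by (intro add_nonneg_nonneg sum_nonneg gr0 ha0)
    show "(2 * A0 + B0) * (m + 2 * t * ip f \<phi> + t\<^sup>2 * ip \<phi> \<phi>)\<^sup>2 \<le> 2 * m * (m + 2 * t * ip f \<phi> + t\<^sup>2 * ip \<phi> \<phi>) * (A0 + 2 * t * ?A1 + t\<^sup>2 * ?A2)
        + m\<^sup>2 * (B0 + 4 * t * (LINT x|lborel. V x * f x * \<phi> x) + t\<^sup>2 * B2)"
      by (rule minimizer_scaled_ineq[OF m min renergy_eq sqint_measurable[OF su] mu pos A Apos B2(2)[OF t] B2(1)[OF t]])
  qed
qed

text \<open>The value suggested by formally testing the equation with \<open>f\<close> itself, which
  reads \<open>A0 + B0 + \<omega> * m = 0\<close>.\<close>

definition "\<omega> = - (A0 + B0) / m"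

lemma euler_lagrange:
  assumes \<phi>: "\<phi> \<in> test_functions"
  shows "(\<Sum>b\<in>Basis. ip (g b) (partial b \<phi>)) + ip xf (\<lambda>x. norm x * \<phi> x) + (LINT x|lborel. V x * f x * \<phi> x) + \<omega> * ip f \<phi> = 0"
proof -
  let ?X = "(\<Sum>b\<in>Basis. ip (g b) (partial b \<phi>)) + ip xf (\<lambda>x. norm x * \<phi> x) + (LINT x|lborel. V x * f x * \<phi> x)"
  have "(\<lambda>x. - \<phi> x) \<in> test_functions" using test_cmult[OF \<phi>, of "-1"] by simp
  from euler_lagrange_ge[OF this] have "0 \<le> m * (- ?X) - (A0 + B0) * (- ip f \<phi>)"
    by (simp add: partial_uminus_test[OF \<phi>] ip_uminus sum_negf algebra_simps)
  with euler_lagrange_ge[OF \<phi>] have "m * ?X = (A0 + B0) * ip f \<phi>" by (simp add: algebra_simps)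
  then show ?thesis using m by (simp add: \<omega>_def field_simps)
qed

text \<open>Strictness comes from the harmonic term: if \<open>|x| f\<close> vanished almost
  everywhere, \<open>f\<close> would vanish off the origin and have mass 0.\<close>

lemma \<omega>_neg: "\<omega> < 0"
proof -
  have "A0 + B0 > 0"
  proof -
    have "ip xf xf \<noteq> 0"
    proof
      assume "ip xf xf = 0"
      then have "(\<integral>\<^sup>+x. ennreal ((xf x)\<^sup>2) \<partial>lborel) = 0" using sqint_nn_integral_ip[OF sxf] by simp
      then have "AE x in lborel. ennreal ((xf x)\<^sup>2) = 0"
        using sqint_measurable[OF sxf] by (subst (asm) nn_integral_0_iff_AE) simp_all
      moreover have "AE x in lborel. x \<noteq> (0::'a)" by (rule AE_lborel_singleton)
      ultimately have "AE x in lborel. sq f x = 0"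
        by eventually_elim (auto simp: xf_def sq_def ennreal_eq_0_iff)
      then have "(\<integral>\<^sup>+x. sq f x \<partial>lborel) = 0" by (subst nn_integral_0_iff_AE) simp_all
      then show False using f(1) m by (simp add: adm_def)
    qed
    then have "ip xf xf > 0" using ip_nonneg[of xf] by simp
    moreover have "0 \<le> (\<Sum>b\<in>Basis. ip (g b) (g b))" by (intro sum_nonneg ip_nonneg)
    moreover have "0 \<le> B0" by (simp add: B0_def)
    ultimately show ?thesis by (simp add: A0_def)
  qed
  then show ?thesis using m by (simp add: \<omega>_def divide_less_0_iff)
qed

section \<open>The complex-valued ground state\<close>

lemma f_pos: "AE x in lborel. 0 < f x"
  by (rule minimizer_pos[OF \<alpha> m f min])

text \<open>On the null set where \<open>f\<close> is not positive the value is reset to 1, because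
  \<open>positive_fun\<close> asks for positivity at every point.\<close>

definition "Q x = complex_of_real (if f x > 0 then f x else 1)"

lemma Q_eq: "AE x in lborel. Q x = Complex (f x) 0"
  using f_pos by eventually_elim (simp add: Q_def complex_of_real_def)

lemma Q_rep: "rep Q f (\<lambda>x. 0) g (\<lambda>b x. 0)"
  unfolding rep_def by (intro conjI ballI sf Q_eq g wpd_zero) (simp_all add: sqint_def)

lemma Q_energy: "4 * energy \<alpha> Q = renergy \<alpha> f"
  unfolding rep_energy[OF \<alpha> Q_rep] renergy_def
  by (simp add: gradE_zero harm_def[of "\<lambda>x. 0"] sq_def[of "\<lambda>x. 0"])

lemma Q_energy_space: "Q \<in> energy_space"
  unfolding rep_energy_space[OF Q_rep] using harm_fin by (simp add: harm_def[of "\<lambda>x. 0"])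

lemma Q_mass: "mass Q = m"
proof -
  have "ennreal (mass Q) = ennreal m"
    using f(1) by (simp add: rep_mass[OF Q_rep] adm_def sq_def[of "\<lambda>x. 0"])
  then show ?thesis using m mass_nonneg[of Q] by simp
qed

lemma Q_minimal:
  fixes u :: "'a \<Rightarrow> complex"
  assumes "u \<in> energy_space" "mass u = m" shows "energy \<alpha> Q \<le> energy \<alpha> u"
proof -
  obtain u1 u2 g1 g2 where r: "rep u u1 u2 g1 g2" using H1_rep[of u] assms(1) unfolding energy_space_def by blast
  have "4 * energy \<alpha> Q \<le> renergy \<alpha> (\<lambda>x. sqrt ((u1 x)\<^sup>2 + (u2 x)\<^sup>2))"
    unfolding Q_energy using rep_renergy_modulus_le(2)[OF \<alpha> r] assms(2) by (intro min) simp
  also have "\<dots> \<le> 4 * energy \<alpha> u" by (rule rep_renergy_modulus_le(1)[OF \<alpha> r])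
  finally show ?thesis by (subst (asm) ennreal_mult_le_mult_iff) simp_all
qed

lemma Q_ground_state: "normalized_ground_state \<alpha> m Q"
  unfolding normalized_ground_state_def
proof
  show "positive_fun Q" by (simp add: positive_fun_def Q_def)
  have "energy \<alpha> Q < \<infinity>"
    using f(2) by (auto simp add: Q_energy[symmetric] ennreal_mult_less_top)
  moreover have "energy \<alpha> Q = min_energy TYPE('a) \<alpha> m"
    unfolding min_energy_def
  proof (rule antisym)
    show "energy \<alpha> Q \<le> (INF u\<in>{u :: 'a \<Rightarrow> complex. u \<in> energy_space \<and> mass u = m}. energy \<alpha> u)"
    proof (rule INF_greatest)
      fix u :: "'a \<Rightarrow> complex" assume "u \<in> {u. u \<in> energy_space \<and> mass u = m}"
      then show "energy \<alpha> Q \<le> energy \<alpha> u" by (intro Q_minimal) simp_all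
    qed
    show "(INF u\<in>{u :: 'a \<Rightarrow> complex. u \<in> energy_space \<and> mass u = m}. energy \<alpha> u) \<le> energy \<alpha> Q"
      by (rule INF_lower) (simp add: Q_energy_space Q_mass)
  qed
  ultimately show "is_minimizer \<alpha> m Q"
    by (simp add: is_minimizer_def Q_energy_space Q_mass)
qed

lemma Q_riesz_conv: "riesz_conv \<alpha> (\<lambda>y. (norm (Q y))\<^sup>2) x = pot \<alpha> (sq f) x"
  by (simp add: rep_riesz_conv[OF \<alpha> Q_rep] sq_def[of "\<lambda>x. 0"])

lemma Q_solves: "solves_equation \<alpha> \<omega> Q"
  unfolding solves_equation_def Q_riesz_conv
proof (intro conjI ballI)
  show "Q \<in> energy_space" by (rule Q_energy_space)
  show "AE x in lebesgue. pot \<alpha> (sq f) x < \<infinity>"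
    using pot_AE_finite[OF \<alpha> sf] by (rule AE_completion)
  show "locally_integrable (\<lambda>x. enn2real (pot \<alpha> (sq f) x) *\<^sub>R Q x)"
  proof (rule locally_integrable_ComplexI)
    show "AE x in lborel. enn2real (pot \<alpha> (sq f) x) *\<^sub>R Q x = Complex (V x * f x) 0"
      using Q_eq by eventually_elim (simp add: V_def complex_eq_iff)
    show "integrable lborel (\<lambda>x. indicator (cball 0 R) x * (V x * f x))" for R
    proof -
      \<comment> \<open>On a ball, \<open>V f\<close> is the product of \<open>sqrt V\<close> times
        the indicator and \<open>sqrt V f\<close>; \<open>pot_ball_finite\<close> makes the first
        factor square integrable.\<close>
      have "sq (indicator (cball (0::'a) R)) = indicator (cball 0 R)"
        by (auto simp: sq_def fun_eq_iff indicator_def)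
      then have "sqint (\<lambda>x. sqrt (V x) * indicator (cball 0 R) x)"
        using pot_ball_finite[OF \<alpha> sf, of R] by (intro sqint_sqrt_V) simp_all
      from V_integrable_mult[OF this sVf] show ?thesis by (simp add: mult_ac)
    qed
  qed simp_all
  fix \<phi> :: "'a \<Rightarrow> real" assume \<phi>: "\<phi> \<in> test_functions"
  note [measurable] = test_measurable[OF \<phi>]
  note s\<phi> = test_sqint[OF \<phi>]
  have sx\<phi>: "sqint (\<lambda>x. norm x * \<phi> x)" by (rule sqint_norm_mult[OF _ test_harm_finite[OF \<phi>]]) measurable
  have gm [measurable]: "g b \<in> borel_measurable borel" "partial b \<phi> \<in> borel_measurable borel" if "b \<in> Basis" for b
    using sqint_measurable[OF sg[OF that]] test_measurable[OF test_partial[OF \<phi> that]] by auto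
  let ?R = "\<lambda>x. (\<Sum>b\<in>Basis. g b x * partial b \<phi> x) + xf x * (norm x * \<phi> x) + V x * f x * \<phi> x + \<omega> * (f x * \<phi> x)"
  have [measurable]: "xf \<in> borel_measurable borel" by (rule sqint_measurable[OF sxf])
  have "dbl \<alpha> (sq f) (sq \<phi>) = dbl \<alpha> (sq \<phi>) (sq f)" by (rule dbl_commute) measurable
  then have "sqint (\<lambda>x. sqrt (V x) * \<phi> x)"
    using dbl_test_finite[OF \<alpha> \<phi> sf] by (intro sqint_sqrt_V) simp_all
  note iV = V_integrable_mult[OF sVf this]
  note ig = sqint_mult_integrable[OF sg test_sqint[OF test_partial[OF \<phi>]]]
  \<comment> \<open>Every summand is integrable on its own, so the identity between separate
    integrals becomes one for the single integral in \<open>solves_equation\<close>, and no default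
    value of a divergent integral enters.\<close>
  have R0: "(LINT x|lborel. ?R x) = 0"
    using euler_lagrange[OF \<phi>] iV ig sqint_mult_integrable[OF sxf sx\<phi>] sqint_mult_integrable[OF sf s\<phi>]
    by (simp add: ip_def)
  have "AE x in lborel. \<forall>b\<in>Basis. weak_partial b Q x = Complex (g b x) 0"
    using rep_weak_partial[OF Q_rep] by (simp add: AE_finite_all[OF finite_Basis])
  with Q_eq have "AE x in lborel. (\<Sum>b\<in>Basis. partial b \<phi> x *\<^sub>R weak_partial b Q x)
           + \<phi> x *\<^sub>R (\<omega> *\<^sub>R Q x + (norm x)\<^sup>2 *\<^sub>R Q x + enn2real (pot \<alpha> (sq f) x) *\<^sub>R Q x) = complex_of_real (?R x)"
  proof eventually_elim
    case (elim x)
    have "(\<Sum>b\<in>Basis. partial b \<phi> x *\<^sub>R weak_partial b Q x) = complex_of_real (\<Sum>b\<in>Basis. g b x * partial b \<phi> x)"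
      using elim(2) by (simp add: complex_eq_iff mult.commute)
    then show ?case
      using elim(1) by (simp add: complex_eq_iff V_def xf_def power2_eq_square algebra_simps)
  qed
  then have "(LINT x|lebesgue. (\<Sum>b\<in>Basis. partial b \<phi> x *\<^sub>R weak_partial b Q x)
           + \<phi> x *\<^sub>R (\<omega> *\<^sub>R Q x + (norm x)\<^sup>2 *\<^sub>R Q x + enn2real (pot \<alpha> (sq f) x) *\<^sub>R Q x)) = (LINT x|lborel. complex_of_real (?R x))"
    by (rule integral_lebesgue_cong) measurable
  also have "\<dots> = complex_of_real (LINT x|lborel. ?R x)" by (rule integral_complex_of_real)
  also have "\<dots> = 0" unfolding R0 by simp
  finally show "(LINT x|lebesgue. (\<Sum>b\<in>Basis. partial b \<phi> x *\<^sub>R weak_partial b Q x)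
           + \<phi> x *\<^sub>R (\<omega> *\<^sub>R Q x + (norm x)\<^sup>2 *\<^sub>R Q x + enn2real (pot \<alpha> (sq f) x) *\<^sub>R Q x)) = 0" .
qed

end

theorem theorem3p2:
  fixes \<alpha> m :: real
  assumes "0 < \<alpha>" and "\<alpha> < real DIM('a::euclidean_space)" and "0 < m"
  shows "\<exists>(Q :: 'a \<Rightarrow> complex) \<omega>.
           normalized_ground_state \<alpha> m Q \<and> solves_equation \<alpha> \<omega> Q \<and> \<omega> < 0"
proof -
  obtain f :: "'a \<Rightarrow> real" where f: "adm m f" "renergy \<alpha> f < \<infinity>"
    and min: "\<And>h :: 'a \<Rightarrow> real. adm m h \<Longrightarrow> renergy \<alpha> f \<le> renergy \<alpha> h"
    using exists_minimizer[OF assms] by blast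
  have "\<exists>g. wpd f b g" if "b \<in> Basis" for b
  proof (rule gradE_finite_imp_wpd[OF adm_sqint[OF f(1)] that])
    have "gradE b f \<le> (\<Sum>b\<in>Basis. gradE b f)" using that by (intro member_le_sum) auto
    also have "\<dots> < \<infinity>" using f(2) by (auto simp: renergy_def ennreal_mult_less_top)
    finally show "gradE b f < \<infinity>" .
  qed
  then obtain g where g: "\<And>b. b \<in> Basis \<Longrightarrow> wpd f b (g b)" by metis
  interpret real_minimizer \<alpha> m f g
    by unfold_locales (fact assms f min g)+
  show ?thesis using Q_ground_state Q_solves \<omega>_neg by blast
qed

end
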